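(* Let $\mathcal{C}$ be an algebraically closed field of arbitrary characteristic, $(\mathcal{E},o)$ an elliptic curve over $\mathcal{C}$ with function field $\mathcal{K}$, $s\in\mathcal{E}(\mathcal{C})$ a non-torsion point, and $\tau$ the automorphism of $\mathcal{K}$ induced by addition by $s$. Let $0\neq\varpi\in H^0(\mathcal{E},\Omega^1_{\mathcal{E}/\mathcal{C}})$ and let $\delta$ be the derivation on $\mathcal{K}$ with $df=\delta(f)\varpi$ for all $f\in\mathcal{K}$. Let $\mathcal{R}=\{\alpha_\omega\}_{\omega\in\mathcal{E}/\tau}$ be a set of $\tau$-orbit representatives in $\mathcal{E}(\mathcal{C})$, and let $a\in\mathcal{K}^\times$. Suppose moreover that $\mathcal{C}$ admits a non-Archimedean absolute value $|\cdot|$ with respect to which the $j$-invariant satisfies $|j(\mathcal{E})|>1$, and that the following conditions hold: (1) $\displaystyle\sum_{\alpha\in\omega}\nu_\alpha(a)=0$ for each $\omega\in\mathcal{E}/\tau$; and (2) $\displaystyle\sum_{\omega\in\mathcal{E}/\tau}\sum_{n\in\mathbb{Z}}n\cdot\nu_{\alpha_\omega\oplus ns}(a)=0$. Then $\delta(a)/a$ is summable.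
   Context: $\oplus$ is the group law of $\mathcal{E}$; $\nu_\alpha$ is the valuation of $\mathcal{K}=\mathcal{C}(\mathcal{E})$ at $\alpha\in\mathcal{E}(\mathcal{C})$; $\tau$ is the $\mathcal{C}$-linear automorphism of $\mathcal{K}$ induced by $\alpha\mapsto\alpha\oplus s$, so $\nu_\alpha(\tau(f))=\nu_{\alpha\oplus s}(f)$. $\mathcal{E}/\tau$ is the set of cosets (orbits) of $\mathbb{Z}s$ in $\mathcal{E}(\mathcal{C})$; a set of $\tau$-orbit representatives is a choice of one $\alpha_\omega\in\omega$ for each $\omega\in\mathcal{E}/\tau$. An element $f\in\mathcal{K}$ is summable if $f=\tau(g)-g$ for some $g\in\mathcal{K}$. The equalities in (1) and (2) are equalities of integers. *)

theory Defs
  imports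
    "HOL-Algebra.Coset"
    "HOL-Computational_Algebra.Polynomial"
    "HOL-Library.Poly_Mapping"
begin

section \<open>Elliptic curves and their function fields\<close>

text \<open>
  An elliptic curve over \<open>'c\<close> is a nonsingular Weierstrass cubic
  \<open>y^2 + a1 x y + a3 y = x^3 + a2 x^2 + a4 x + a6\<close> (general form, so that all
  characteristics are covered), with base point its point at infinity.  The record also
  carries its function field: the field type \<open>'k\<close>, the inclusion \<open>cst\<close> of the constants,
  and the coordinate functions \<open>xfun\<close>, \<open>yfun\<close>.
\<close>

record ('c, 'k) curve =
  a1 :: 'c
  a2 :: 'c
  a3 :: 'c
  a4 :: 'c
  a6 :: 'c
  cst :: "'c \<Rightarrow> 'k"
  xfun :: 'k
  yfun :: 'k

definition b2 :: "('c::field, 'k) curve \<Rightarrow> 'c" where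
  "b2 E = (a1 E)\<^sup>2 + 4 * a2 E"

definition b4 :: "('c::field, 'k) curve \<Rightarrow> 'c" where
  "b4 E = 2 * a4 E + a1 E * a3 E"

definition b6 :: "('c::field, 'k) curve \<Rightarrow> 'c" where
  "b6 E = (a3 E)\<^sup>2 + 4 * a6 E"

definition b8 :: "('c::field, 'k) curve \<Rightarrow> 'c" where
  "b8 E = (a1 E)\<^sup>2 * a6 E + 4 * a2 E * a6 E - a1 E * a3 E * a4 E + a2 E * (a3 E)\<^sup>2 - (a4 E)\<^sup>2"

definition discriminant :: "('c::field, 'k) curve \<Rightarrow> 'c" where
  "discriminant E = - (b2 E)\<^sup>2 * b8 E - 8 * b4 E ^ 3 - 27 * (b6 E)\<^sup>2 + 9 * b2 E * b4 E * b6 E"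

definition j_invariant :: "('c::field, 'k) curve \<Rightarrow> 'c" where
  "j_invariant E = ((b2 E)\<^sup>2 - 24 * b4 E) ^ 3 / discriminant E"

text \<open>
  A polynomial in \<open>x\<close> and \<open>y\<close> is an element of \<open>'c poly poly\<close> whose outer variable is \<open>y\<close>;
  \<open>eval2 h u v p\<close> is its value at \<open>x = u\<close>, \<open>y = v\<close> after mapping coefficients through \<open>h\<close>.
\<close>

definition eval2 :: "('c::zero \<Rightarrow> 'r::comm_ring_1) \<Rightarrow> 'r \<Rightarrow> 'r \<Rightarrow> 'c poly poly \<Rightarrow> 'r" where
  "eval2 h u v p = poly (map_poly (\<lambda>q. poly (map_poly h q) u) p) v"

definition weierstrass_poly :: "('c::field, 'k) curve \<Rightarrow> 'c poly poly" where
  "weierstrass_poly E = [: [: - a6 E, - a4 E, - a2 E, - 1 :], [: a3 E, a1 E :], 1 :]"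

text \<open>
  \<open>'k\<close> is the fraction field of the coordinate ring \<open>'c[x,y]/(weierstrass_poly E)\<close>, up to
  isomorphism: the coordinate ring embeds, and every element is a quotient of its elements.
\<close>

definition is_function_field :: "('c::field, 'k::field) curve \<Rightarrow> bool" where
  "is_function_field E \<longleftrightarrow>
     cst E 1 = 1 \<and>
     (\<forall>c d. cst E (c + d) = cst E c + cst E d) \<and>
     (\<forall>c d. cst E (c * d) = cst E c * cst E d) \<and>
     (\<forall>p. eval2 (cst E) (xfun E) (yfun E) p = 0 \<longleftrightarrow> weierstrass_poly E dvd p) \<and>
     (\<forall>f. \<exists>p q. eval2 (cst E) (xfun E) (yfun E) q \<noteq> 0 \<and>
        f = eval2 (cst E) (xfun E) (yfun E) p / eval2 (cst E) (xfun E) (yfun E) q)"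

definition elliptic_curve :: "('c::field, 'k::field) curve \<Rightarrow> bool" where
  "elliptic_curve E \<longleftrightarrow> discriminant E \<noteq> 0 \<and> is_function_field E"


section \<open>The group of points\<close>

datatype 'c point = Infinity | Affine 'c 'c

fun on_curve :: "('c::field, 'k) curve \<Rightarrow> 'c point \<Rightarrow> bool" where
  "on_curve E Infinity \<longleftrightarrow> True"
| "on_curve E (Affine x y) \<longleftrightarrow> eval2 id x y (weierstrass_poly E) = 0"

text \<open>
  Chord-and-tangent addition; \<open>l\<close> is the slope of the line through the two points (of the
  tangent line if they coincide).  The sum of two affine points is \<open>Infinity\<close> when this line
  is vertical.
\<close>

fun point_add :: "('c::field, 'k) curve \<Rightarrow> 'c point \<Rightarrow> 'c point \<Rightarrow> 'c point" where
  "point_add E Infinity Q = Q"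
| "point_add E (Affine x y) Infinity = Affine x y"
| "point_add E (Affine x1 y1) (Affine x2 y2) =
     (if x1 = x2 \<and> y1 + y2 + a1 E * x2 + a3 E = 0 then Infinity
      else let
        l = (if x1 = x2
             then (3 * x1\<^sup>2 + 2 * a2 E * x1 + a4 E - a1 E * y1) / (2 * y1 + a1 E * x1 + a3 E)
             else (y2 - y1) / (x2 - x1));
        x3 = l\<^sup>2 + a1 E * l - a2 E - x1 - x2
      in Affine x3 (l * (x1 - x3) - y1 - a1 E * x3 - a3 E))"

definition points :: "('c::field, 'k) curve \<Rightarrow> 'c point monoid" where
  "points E = \<lparr>carrier = {P. on_curve E P}, monoid.mult = point_add E, one = Infinity\<rparr>"

definition non_torsion :: "('c::field, 'k) curve \<Rightarrow> 'c point \<Rightarrow> bool" where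
  "non_torsion E s \<longleftrightarrow>
     s \<in> carrier (points E) \<and> (\<forall>n::nat. n > 0 \<longrightarrow> s [^]\<^bsub>points E\<^esub> n \<noteq> \<one>\<^bsub>points E\<^esub>)"

definition orbits :: "('c::field, 'k) curve \<Rightarrow> 'c point \<Rightarrow> 'c point set set" where
  "orbits E s = rcosets\<^bsub>points E\<^esub> (range (\<lambda>n::int. s [^]\<^bsub>points E\<^esub> n))"

definition orbit_representatives ::
  "('c::field, 'k) curve \<Rightarrow> 'c point \<Rightarrow> ('c point set \<Rightarrow> 'c point) \<Rightarrow> bool" where
  "orbit_representatives E s r \<longleftrightarrow> (\<forall>\<omega>\<in>orbits E s. r \<omega> \<in> \<omega>)"


section \<open>Local rings and valuations\<close>

text \<open>
  At infinity we use the chart of the projective closure given by \<open>x / y\<close> and \<open>1 / y\<close>,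
  in which the point at infinity is the origin.
\<close>

fun local_ring :: "('c::field, 'k::field) curve \<Rightarrow> 'c point \<Rightarrow> 'k set" where
  "local_ring E (Affine x y) =
     {eval2 (cst E) (xfun E) (yfun E) p / eval2 (cst E) (xfun E) (yfun E) q | p q.
        eval2 id x y q \<noteq> 0}"
| "local_ring E Infinity =
     {eval2 (cst E) (xfun E / yfun E) (1 / yfun E) p /
      eval2 (cst E) (xfun E / yfun E) (1 / yfun E) q | p q.
        eval2 id 0 0 q \<noteq> 0}"

definition local_units :: "('c::field, 'k::field) curve \<Rightarrow> 'c point \<Rightarrow> 'k set" where
  "local_units E \<alpha> = {u \<in> local_ring E \<alpha>. u \<noteq> 0 \<and> inverse u \<in> local_ring E \<alpha>}"

definition maximal_ideal_at :: "('c::field, 'k::field) curve \<Rightarrow> 'c point \<Rightarrow> 'k set" where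
  "maximal_ideal_at E \<alpha> = local_ring E \<alpha> - local_units E \<alpha>"

definition uniformizer :: "('c::field, 'k::field) curve \<Rightarrow> 'c point \<Rightarrow> 'k \<Rightarrow> bool" where
  "uniformizer E \<alpha> t \<longleftrightarrow> t \<noteq> 0 \<and> maximal_ideal_at E \<alpha> = {t * f | f. f \<in> local_ring E \<alpha>}"

text \<open>The value \<open>0\<close> at the zero function (instead of infinity) is a dummy.\<close>

definition valuation :: "('c::field, 'k::field) curve \<Rightarrow> 'c point \<Rightarrow> 'k \<Rightarrow> int" where
  "valuation E \<alpha> f =
     (if f = 0 then 0
      else THE n. \<exists>t u. uniformizer E \<alpha> t \<and> u \<in> local_units E \<alpha> \<and> f = u * t powi n)"

text \<open>The value \<open>f(\<alpha>)\<close> of a function \<open>f\<close> that is regular at \<open>\<alpha>\<close>: its class in the residue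
  field \<open>'c\<close>.\<close>

definition value_at :: "('c::field, 'k::field) curve \<Rightarrow> 'c point \<Rightarrow> 'k \<Rightarrow> 'c" where
  "value_at E \<alpha> f = (THE c. f - cst E c \<in> maximal_ideal_at E \<alpha>)"


section \<open>Translation and summability\<close>

definition automorphism_over_constants :: "('c, 'k::field) curve \<Rightarrow> ('k \<Rightarrow> 'k) \<Rightarrow> bool" where
  "automorphism_over_constants E \<tau> \<longleftrightarrow>
     bij \<tau> \<and> (\<forall>f g. \<tau> (f + g) = \<tau> f + \<tau> g) \<and> (\<forall>f g. \<tau> (f * g) = \<tau> f * \<tau> g) \<and>
     (\<forall>c. \<tau> (cst E c) = cst E c)"

text \<open>\<open>\<tau>\<close> is pullback along \<open>\<alpha> \<mapsto> \<alpha> \<oplus> s\<close>, i.e. \<open>(\<tau> f)(\<alpha>) = f(\<alpha> \<oplus> s)\<close> wherever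
  \<open>f\<close> is regular at \<open>\<alpha> \<oplus> s\<close>.  This determines \<open>\<tau>\<close>.\<close>

definition translation_automorphism ::
  "('c::field, 'k::field) curve \<Rightarrow> 'c point \<Rightarrow> ('k \<Rightarrow> 'k) \<Rightarrow> bool" where
  "translation_automorphism E s \<tau> \<longleftrightarrow>
     automorphism_over_constants E \<tau> \<and>
     (\<forall>\<alpha>\<in>carrier (points E). \<forall>f\<in>local_ring E (\<alpha> \<otimes>\<^bsub>points E\<^esub> s).
        \<tau> f \<in> local_ring E \<alpha> \<and> value_at E \<alpha> (\<tau> f) = value_at E (\<alpha> \<otimes>\<^bsub>points E\<^esub> s) f)"

definition summable_wrt :: "('k::field \<Rightarrow> 'k) \<Rightarrow> 'k \<Rightarrow> bool" where
  "summable_wrt \<tau> f \<longleftrightarrow> (\<exists>g. f = \<tau> g - g)"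


section \<open>Differential forms\<close>

text \<open>
  Kaehler differentials of \<open>'k\<close> over \<open>'c\<close>: the quotient of the free \<open>'k\<close>-module on symbols
  \<open>d f\<close>, for \<open>f :: 'k\<close>, by the usual relations.  Elements are represented by formal sums
  in \<open>'k \<Rightarrow>\<^sub>0 'k\<close>, where \<open>Poly_Mapping.single f g\<close> stands for \<open>g * d f\<close>, and
  \<open>form_eq\<close> is equality in the quotient.
\<close>

definition dd :: "'k::field \<Rightarrow> 'k \<Rightarrow>\<^sub>0 'k" where
  "dd f = Poly_Mapping.single f 1"

definition form_scale :: "'k::field \<Rightarrow> ('k \<Rightarrow>\<^sub>0 'k) \<Rightarrow> 'k \<Rightarrow>\<^sub>0 'k" where
  "form_scale g w = Poly_Mapping.map ((*) g) w"

lemma lookup_form_scale: "Poly_Mapping.lookup (form_scale g w) f = g * Poly_Mapping.lookup w f"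
  by (simp add: form_scale_def Poly_Mapping.map.rep_eq when_def)

lemma module_form_scale: "module form_scale"
  by unfold_locales
    (auto intro!: poly_mapping_eqI simp: lookup_form_scale lookup_add algebra_simps)

definition form_relations :: "('c, 'k::field) curve \<Rightarrow> ('k \<Rightarrow>\<^sub>0 'k) set" where
  "form_relations E = module.span form_scale
     ({dd (f + g) - dd f - dd g | f g. True} \<union>
      {dd (f * g) - form_scale f (dd g) - form_scale g (dd f) | f g. True} \<union>
      {dd (cst E c) | c. True})"

definition form_eq :: "('c, 'k::field) curve \<Rightarrow> ('k \<Rightarrow>\<^sub>0 'k) \<Rightarrow> ('k \<Rightarrow>\<^sub>0 'k) \<Rightarrow> bool" where
  "form_eq E w w' \<longleftrightarrow> w - w' \<in> form_relations E"

text \<open>The stalk at \<open>\<alpha>\<close> of the sheaf of differentials consists of the forms that can be written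
  as a sum of terms \<open>g * d f\<close> with \<open>f\<close> and \<open>g\<close> in the local ring at \<open>\<alpha>\<close>; a global section is
  an element of all stalks.\<close>

definition regular_form_at :: "('c::field, 'k::field) curve \<Rightarrow> 'c point \<Rightarrow> ('k \<Rightarrow>\<^sub>0 'k) \<Rightarrow> bool" where
  "regular_form_at E \<alpha> w \<longleftrightarrow>
     (\<exists>w'. form_eq E w w' \<and>
        (\<forall>f\<in>Poly_Mapping.keys w'. f \<in> local_ring E \<alpha> \<and> Poly_Mapping.lookup w' f \<in> local_ring E \<alpha>))"

definition global_form :: "('c::field, 'k::field) curve \<Rightarrow> ('k \<Rightarrow>\<^sub>0 'k) \<Rightarrow> bool" where
  "global_form E w \<longleftrightarrow> (\<forall>\<alpha>\<in>carrier (points E). regular_form_at E \<alpha> w)"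

definition derivation_over_constants :: "('c, 'k::field) curve \<Rightarrow> ('k \<Rightarrow> 'k) \<Rightarrow> bool" where
  "derivation_over_constants E \<delta> \<longleftrightarrow>
     (\<forall>f g. \<delta> (f + g) = \<delta> f + \<delta> g) \<and> (\<forall>f g. \<delta> (f * g) = f * \<delta> g + g * \<delta> f) \<and>
     (\<forall>c. \<delta> (cst E c) = 0)"


section \<open>Absolute values\<close>

definition nonarchimedean_absolute_value :: "('c::field \<Rightarrow> real) \<Rightarrow> bool" where
  "nonarchimedean_absolute_value v \<longleftrightarrow>
     (\<forall>x. v x \<ge> 0) \<and> (\<forall>x. v x = 0 \<longleftrightarrow> x = 0) \<and>
     (\<forall>x y. v (x * y) = v x * v y) \<and> (\<forall>x y. v (x + y) \<le> max (v x) (v y))"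

end

theory Submission
  imports Defs
begin

text \<open>
  For a point \<open>P\<close> let \<open>\<zeta>\<^sub>P\<close> be the slope of the line through the generic point and \<open>- P\<close>. If
  \<open>c\<^sub>P\<^sub>,\<^sub>Q\<close> is the quotient of the chord through \<open>P\<close>, \<open>Q\<close> by the vertical line through \<open>P + Q\<close>,
  then its divisor is \<open>[P] + [Q] - [P + Q] - [o]\<close>, and its logarithmic derivative is
  \<open>\<zeta>\<^sub>P + \<zeta>\<^sub>Q - \<zeta>\<^sub>P\<^sub>+\<^sub>Q\<close> plus a constant \<open>k(P, Q)\<close>. A function with at most one simple pole is
  constant, so the products \<open>c\<^sub>P\<^sub>,\<^sub>Q c\<^sub>P\<^sub>+\<^sub>Q\<^sub>,\<^sub>R\<close> and \<open>c\<^sub>Q\<^sub>,\<^sub>R c\<^sub>P\<^sub>,\<^sub>Q\<^sub>+\<^sub>R\<close> are proportional; this gives both the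
  associativity of the group law and the cocycle identity for \<open>k\<close>. By the cocycle identity at a
  generic point, the logarithmic derivative of \<open>c\<^sub>P\<^sub>,\<^sub>s\<close> is \<open>\<tau>(g) - g\<close> with
  \<open>g = \<zeta>\<^sub>P\<^sub>+\<^sub>s - \<zeta>\<^sub>s\<close>. The two vanishing conditions say that the divisor of \<open>a\<close> is an integral
  combination of divisors \<open>[P] + [s] - [P + s] - [o]\<close>, so \<open>a\<close> is a constant times a product of
  powers of functions \<open>c\<^sub>P\<^sub>,\<^sub>s\<close>. Finally, \<open>\<delta>\<close> is a constant multiple of the derivation dual to
  \<open>dx / (2 y + a1 x + a3)\<close>, because the ratio of the two is regular everywhere.
\<close>


section \<open>Evaluation of polynomials\<close>

text \<open>In positive characteristic the residues of \<delta>(a)/a know the orders of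
  \<open>a\<close> only modulo the characteristic, so the poles of \<delta>(a)/a are not enough to
  start from; the decomposition is carried out on integral divisors. For a non-vertical chord, k(P,
  Q) is its slope plus a1, while the function \<zeta>(P) takes at a general point R the value k(R,
  -P) - a1. The same constants thus govern logarithmic derivatives and values, and the identity
  needed for \<tau>(\<zeta>(P + s)) becomes the cocycle identity for R + s, -s and -P. Only the
  effect of \<tau> on values is given, so that identity is tested at all points R outside a finite
  set. The derivation dual to dx / (2 y + a1 x + a3) is obtained from \<delta> by dividing by a
  function, which is afterwards seen to be constant.\<close>

locale hom_map =
  fixes h :: "'a::comm_ring_1 \<Rightarrow> 'b::comm_ring_1"
  assumes hom_one: "h 1 = 1"
    and hom_add: "h (a + b) = h a + h b"
    and hom_mult: "h (a * b) = h a * h b"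
begin

lemma hom_zero [simp]: "h 0 = 0"
  using hom_add[of 0 0] by simp

lemma hom_minus: "h (- a) = - h a"
  using hom_add[of a "- a"] by (simp add: eq_neg_iff_add_eq_0 add.commute)

lemma hom_diff: "h (a - b) = h a - h b"
  using hom_add[of a "- b"] by (simp add: hom_minus)

lemma hom_power: "h (a ^ n) = h a ^ n"
  by (induction n) (simp_all add: hom_one hom_mult)

lemma hom_numeral: "h (numeral n) = numeral n"
  by (induction n) (simp_all only: numeral.simps hom_one hom_add)

lemmas hom_simps = hom_zero hom_one hom_add hom_mult hom_minus hom_diff hom_power hom_numeral

definition ev :: "'b \<Rightarrow> 'a poly \<Rightarrow> 'b" where
  "ev u p = poly (map_poly h p) u"

lemma ev_0 [simp]: "ev u 0 = 0"
  by (simp add: ev_def)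

lemma ev_pCons [simp]: "ev u (pCons a p) = h a + u * ev u p"
  by (simp add: ev_def map_poly_pCons)

lemma ev_1 [simp]: "ev u 1 = 1"
  by (simp add: one_pCons hom_one)

lemma ev_add: "ev u (p + q) = ev u p + ev u q"
proof (induction p arbitrary: q)
  case (pCons a p)
  then show ?case by (cases q) (simp add: hom_add algebra_simps)
qed simp

lemma ev_smult: "ev u (smult a p) = h a * ev u p"
  by (induction p) (simp_all add: hom_mult algebra_simps)

lemma ev_mult: "ev u (p * q) = ev u p * ev u q"
  by (induction p) (simp_all add: ev_add ev_smult algebra_simps)

lemma ev_minus: "ev u (- p) = - ev u p"
  using ev_smult[of u "- 1" p] by (simp add: hom_minus hom_one)

lemma ev_diff: "ev u (p - q) = ev u p - ev u q"
  using ev_add[of u p "- q"] by (simp add: ev_minus)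

lemma ev_power: "ev u (p ^ n) = ev u p ^ n"
  by (induction n) (simp_all add: ev_mult)

lemma eval2_0 [simp]: "eval2 h u v 0 = 0"
  by (simp add: eval2_def)

lemma eval2_pCons [simp]: "eval2 h u v (pCons p q) = ev u p + v * eval2 h u v q"
  by (simp add: eval2_def map_poly_pCons ev_def)

lemma eval2_1 [simp]: "eval2 h u v 1 = 1"
  by (simp add: one_pCons hom_one)

lemma eval2_add: "eval2 h u v (p + q) = eval2 h u v p + eval2 h u v q"
proof (induction p arbitrary: q)
  case (pCons a p)
  then show ?case by (cases q) (simp add: ev_add algebra_simps)
qed simp

lemma eval2_smult: "eval2 h u v (smult a p) = ev u a * eval2 h u v p"
  by (induction p) (simp_all add: ev_mult algebra_simps)

lemma eval2_mult: "eval2 h u v (p * q) = eval2 h u v p * eval2 h u v q"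
  by (induction p) (simp_all add: eval2_add eval2_smult algebra_simps)

lemma eval2_minus: "eval2 h u v (- p) = - eval2 h u v p"
  using eval2_smult[of u v "- 1" p] by (simp add: ev_minus)

lemma eval2_diff: "eval2 h u v (p - q) = eval2 h u v p - eval2 h u v q"
  using eval2_add[of u v p "- q"] by (simp add: eval2_minus)

lemmas eval2_simps = eval2_add eval2_mult eval2_minus eval2_diff

end

text \<open>Evaluation at actual points of the curve; the other instance is the inclusion of the
  constants. Both evaluations share one calculus.\<close>

interpretation id_hom: hom_map "id :: 'a::comm_ring_1 \<Rightarrow> 'a"
  by unfold_locales simp_all

lemma id_hom_ev [simp]: "id_hom.ev u p = poly p u"
  by (simp add: id_hom.ev_def)


section \<open>Discrete valuation rings\<close>

text \<open>The ring is a subset of a given field and \<open>factorization\<close> speaks of every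
  nonzero element of the field, so \<open>ord\<close> is defined on quotients at once. Since
  \<open>inverse t\<close> is not in R, the exponent is unique.\<close>

locale dvr =
  fixes R :: "'k::field set" and t :: 'k
  assumes one_mem: "1 \<in> R"
    and add_mem: "f \<in> R \<Longrightarrow> g \<in> R \<Longrightarrow> f + g \<in> R"
    and mult_mem: "f \<in> R \<Longrightarrow> g \<in> R \<Longrightarrow> f * g \<in> R"
    and t_mem: "t \<in> R"
    and t_nonzero: "t \<noteq> 0"
    and inverse_t_notin: "inverse t \<notin> R"
    and factorization: "f \<noteq> 0 \<Longrightarrow>
      \<exists>n::int. \<exists>u\<in>R. u \<noteq> 0 \<and> inverse u \<in> R \<and> f = u * t powi n"
begin

definition ord :: "'k \<Rightarrow> int" where
  "ord f = (THE n. \<exists>u\<in>R. u \<noteq> 0 \<and> inverse u \<in> R \<and> f = u * t powi n)"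

lemma power_mem: "f \<in> R \<Longrightarrow> f ^ n \<in> R"
  by (induction n) (simp_all add: one_mem mult_mem)

lemma neg_power_notin:
  assumes "n < (0::int)" shows "t powi n \<notin> R"
proof
  assume n: "t powi n \<in> R"
  obtain k where k: "n + int k = -1"
    using assms that[of "nat (- n - 1)"] by simp
  from n have "t powi n * t ^ k \<in> R"
    by (intro mult_mem power_mem t_mem)
  also have "t powi n * t ^ k = t powi (n + int k)"
    using t_nonzero by (simp add: power_int_add)
  finally show False
    using inverse_t_notin k by (simp add: power_int_minus)
qed

lemma factorization_unique_le:
  fixes n m :: int
  assumes "u \<in> R" "u \<noteq> 0" "inverse u \<in> R" "u' \<in> R" "u' \<noteq> 0" "inverse u' \<in> R"
    and eq: "u * t powi n = u' * t powi m"
  shows "m \<le> n"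
proof (rule ccontr)
  assume "\<not> m \<le> n"
  then have "t powi (n - m) \<notin> R"
    by (intro neg_power_notin) simp
  moreover have "t powi (n - m) = u' * inverse u"
    using eq assms(2,5) t_nonzero by (simp add: power_int_diff field_simps)
  ultimately show False
    using assms mult_mem by simp
qed

lemma ordI:
  assumes "u \<in> R" "u \<noteq> 0" "inverse u \<in> R" "f = u * t powi n"
  shows "ord f = n"
  unfolding ord_def
proof (rule the_equality)
  show "\<exists>u\<in>R. u \<noteq> 0 \<and> inverse u \<in> R \<and> f = u * t powi n"
    using assms by blast
next
  fix m assume "\<exists>u\<in>R. u \<noteq> 0 \<and> inverse u \<in> R \<and> f = u * t powi m"
  then obtain u' where "u' \<in> R" "u' \<noteq> 0" "inverse u' \<in> R" "f = u' * t powi m"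
    by blast
  with assms show "m = n"
    using factorization_unique_le[of u u' n m] factorization_unique_le[of u' u m n]
    by (metis order_antisym)
qed

lemma ordE:
  assumes "f \<noteq> 0"
  obtains u where "u \<in> R" "u \<noteq> 0" "inverse u \<in> R" "f = u * t powi ord f"
proof -
  obtain n u where "u \<in> R" "u \<noteq> 0" "inverse u \<in> R" "f = u * t powi n"
    using factorization[OF assms] by blast
  with ordI that show ?thesis by metis
qed

lemma ord_mult:
  assumes "f \<noteq> 0" "g \<noteq> 0" shows "ord (f * g) = ord f + ord g"
proof -
  obtain u where u: "u \<in> R" "u \<noteq> 0" "inverse u \<in> R" "f = u * t powi ord f"
    using ordE[OF assms(1)] .
  obtain w where w: "w \<in> R" "w \<noteq> 0" "inverse w \<in> R" "g = w * t powi ord g"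
    using ordE[OF assms(2)] .
  have "f * g = (u * t powi ord f) * (w * t powi ord g)"
    using u(4) w(4) by simp
  also have "\<dots> = (u * w) * t powi (ord f + ord g)"
    using t_nonzero by (simp add: power_int_add)
  finally show ?thesis
    using u(1-3) w(1-3) by (intro ordI[of "u * w"]) (simp_all add: mult_mem)
qed

lemma ord_one: "ord 1 = 0"
  by (rule ordI[of 1]) (simp_all add: one_mem)

lemma ord_inverse: "f \<noteq> 0 \<Longrightarrow> ord (inverse f) = - ord f"
  using ord_mult[of f "inverse f"] ord_one by simp

lemma ord_divide: "f \<noteq> 0 \<Longrightarrow> g \<noteq> 0 \<Longrightarrow> ord (f / g) = ord f - ord g"
  using ord_mult[of f "inverse g"] ord_inverse[of g] by (simp add: field_simps)

lemma ord_t: "ord t = 1"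
  by (rule ordI[of 1]) (simp_all add: one_mem)

lemma mem_iff:
  assumes "f \<noteq> 0" shows "f \<in> R \<longleftrightarrow> ord f \<ge> 0"
proof -
  obtain u where u: "u \<in> R" "u \<noteq> 0" "inverse u \<in> R" and f: "f = u * t powi ord f"
    using ordE[OF assms] .
  show ?thesis
  proof
    assume "f \<in> R"
    with u have "inverse u * f \<in> R" by (simp add: mult_mem)
    also have "inverse u * f = t powi ord f"
      by (subst f) (simp add: u(2))
    finally show "ord f \<ge> 0"
      using neg_power_notin by force
  next
    assume "ord f \<ge> 0"
    then have "t powi ord f = t ^ nat (ord f)"
      by (simp add: power_int_def)
    then have "t powi ord f \<in> R"
      using t_mem power_mem by simp
    with u mult_mem show "f \<in> R"
      by (subst f) simp
  qed
qed

lemma inverse_mem_iff: "f \<noteq> 0 \<Longrightarrow> inverse f \<in> R \<longleftrightarrow> ord f \<le> 0"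
  using mem_iff[of "inverse f"] ord_inverse[of f] by simp

lemma unit_iff: "f \<noteq> 0 \<Longrightarrow> f \<in> R \<and> inverse f \<in> R \<longleftrightarrow> ord f = 0"
  using mem_iff inverse_mem_iff by force

lemma uniformizer_iff:
  assumes R: "local_ring E \<alpha> = R"
  shows "uniformizer E \<alpha> f \<longleftrightarrow> f \<noteq> 0 \<and> ord f = 1"
proof -
  have max: "maximal_ideal_at E \<alpha> = {g. g = 0 \<or> ord g \<ge> 1} \<inter> R"
    using unit_iff mem_iff by (force simp: maximal_ideal_at_def local_units_def R)
  \<comment> \<open>-1 is a unit: its square is 1, so twice its order is 0.\<close>
  have zero: "0 \<in> R"
    using add_mem[of 1 "- 1"] one_mem unit_iff[of "- 1"] ord_mult[of "- 1" "- 1"] ord_one by simp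
  show ?thesis
  proof
    assume "uniformizer E \<alpha> f"
    then have f: "f \<noteq> 0" and eq: "{g. g = 0 \<or> ord g \<ge> 1} \<inter> R = {f * g | g. g \<in> R}"
      by (simp_all add: uniformizer_def max R)
    have "t \<in> {f * g | g. g \<in> R}"
      unfolding eq[symmetric] using t_mem ord_t by simp
    then obtain g where g: "g \<in> R" "t = f * g" by blast
    then have "g \<noteq> 0" using t_nonzero by auto
    then have "ord g \<ge> 0" "ord f + ord g = 1"
      using g f mem_iff ord_mult ord_t by auto
    moreover have "f * 1 \<in> {f * g | g. g \<in> R}"
      using one_mem by blast
    then have "ord f \<ge> 1"
      unfolding eq[symmetric] using f by simp
    ultimately show "f \<noteq> 0 \<and> ord f = 1" using f by simp
  next
    assume f: "f \<noteq> 0 \<and> ord f = 1"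
    have "g \<in> {f * g | g. g \<in> R} \<longleftrightarrow> (g = 0 \<or> ord g \<ge> 1) \<and> g \<in> R" for g
    proof (cases "g = 0")
      case True
      then show ?thesis using zero by force
    next
      case False
      have "g \<in> {f * g | g. g \<in> R} \<longleftrightarrow> g / f \<in> R"
      proof
        assume "g / f \<in> R"
        moreover have "g = f * (g / f)" using f by simp
        ultimately show "g \<in> {f * g | g. g \<in> R}" by blast
      qed (use f in auto)
      also have "\<dots> \<longleftrightarrow> ord g \<ge> 1"
        using mem_iff[of "g / f"] ord_divide[of g f] f False by auto
      finally show ?thesis using False mem_iff[of g] by auto
    qed
    then show "uniformizer E \<alpha> f"
      using f by (auto simp: uniformizer_def max R)
  qed
qed

text \<open>\<open>valuation\<close> describes the order by an arbitrary uniformizer, so uniqueness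
  has to cover all of them; by \<open>uniformizer_iff\<close> each has order 1, and its n-th power
  has order n.\<close>

lemma valuation_eq_ord:
  assumes R: "local_ring E \<alpha> = R" and f: "f \<noteq> 0"
  shows "valuation E \<alpha> f = ord f"
proof -
  have u: "t' \<noteq> 0 \<and> ord t' = 1 \<and> u \<in> R \<and> u \<noteq> 0 \<and> inverse u \<in> R \<and> f = u * t' powi n
    \<Longrightarrow> n = ord f" for t' u n
  proof (elim conjE)
    assume *: "t' \<noteq> 0" "ord t' = 1" "u \<in> R" "u \<noteq> 0" "inverse u \<in> R" "f = u * t' powi n"
    have pow: "ord (t' ^ m) = int m" for m
      by (induction m) (use * ord_one ord_mult in auto)
    have "ord (t' powi n) = n"
      using pow[of "nat n"] pow[of "nat (- n)"] ord_inverse[of "t' ^ nat (- n)"] *(1)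
      by (auto simp: power_int_def power_inverse)
    moreover have "ord u = 0" using unit_iff * by blast
    ultimately show "n = ord f"
      using * ord_mult[of u "t' powi n"] by simp
  qed
  obtain u where u': "u \<in> R" "u \<noteq> 0" "inverse u \<in> R" "f = u * t powi ord f"
    using ordE[OF f] .
  show ?thesis
    using f unfolding valuation_def
    apply simp
    apply (rule the_equality)
    subgoal
      using u' t_nonzero ord_t
      by (intro exI[of _ t] exI[of _ u]) (auto simp: uniformizer_iff[OF R] local_units_def R)
    subgoal for n
      using u by (auto simp: uniformizer_iff[OF R] local_units_def R)
    done
qed

end

text \<open>Dividing an element by t as long as the quotient stays in R stops by
  \<open>bounded\<close>, and it can only stop at a unit, because \<open>nonunit\<close> allows one
  more division otherwise. \<open>bounded\<close> takes the place of a Noetherian argument.\<close>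

lemma dvr_intro:
  fixes R :: "'k::field set"
  assumes one_mem: "1 \<in> R"
    and add_mem: "\<And>f g. f \<in> R \<Longrightarrow> g \<in> R \<Longrightarrow> f + g \<in> R"
    and mult_mem: "\<And>f g. f \<in> R \<Longrightarrow> g \<in> R \<Longrightarrow> f * g \<in> R"
    and t: "t \<in> R" "t \<noteq> 0" "inverse t \<notin> R"
    and fractions: "\<And>f. f \<noteq> 0 \<Longrightarrow> \<exists>p\<in>R. \<exists>q\<in>R. p \<noteq> 0 \<and> q \<noteq> 0 \<and> f = p / q"
    and nonunit: "\<And>f. f \<in> R \<Longrightarrow> f \<noteq> 0 \<Longrightarrow> inverse f \<notin> R \<Longrightarrow> f / t \<in> R"
    and bounded: "\<And>f. f \<in> R \<Longrightarrow> f \<noteq> 0 \<Longrightarrow> \<exists>n::nat. f / t ^ n \<notin> R"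
  shows "dvr R t"
proof
  have R_fact: "\<exists>n::nat. \<exists>u\<in>R. u \<noteq> 0 \<and> inverse u \<in> R \<and> f = u * t ^ n"
    if f: "f \<in> R" "f \<noteq> 0" for f
  proof -
    \<comment> \<open>n is positive because f itself lies in R; the quotient by
      \<open>t ^ (n - 1)\<close> is the unit sought.\<close>
    define n where "n = (LEAST n. f / t ^ n \<notin> R)"
    have n: "f / t ^ n \<notin> R" and least: "\<And>m. m < n \<Longrightarrow> f / t ^ m \<in> R"
      using LeastI_ex[OF bounded[OF f]] not_less_Least unfolding n_def by blast+
    then obtain m where m: "n = Suc m"
      using f by (cases n) auto
    let ?u = "f / t ^ m"
    have "?u \<in> R" "?u / t \<notin> R"
      using least[of m] n m by (simp_all add: field_simps)
    with nonunit[of ?u] f t have "inverse ?u \<in> R" by auto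
    with \<open>?u \<in> R\<close> show ?thesis
      using f t by (intro exI[of _ m] bexI[of _ ?u]) auto
  qed
  fix f :: 'k assume "f \<noteq> 0"
  then obtain p q where pq: "p \<in> R" "q \<in> R" "p \<noteq> 0" "q \<noteq> 0" "f = p / q"
    using fractions by blast
  obtain n u where u: "u \<in> R" "u \<noteq> 0" "inverse u \<in> R" "p = u * t ^ n"
    using R_fact pq by blast
  obtain m w where w: "w \<in> R" "w \<noteq> 0" "inverse w \<in> R" "q = w * t ^ m"
    using R_fact pq by blast
  have "f = (u * inverse w) * t powi (int n - int m)"
    using pq u w t by (simp add: power_int_diff field_simps)
  moreover have "u * inverse w \<in> R" "inverse (u * inverse w) \<in> R" "u * inverse w \<noteq> 0"
    using u w by (simp_all add: mult_mem)
  ultimately show "\<exists>n::int. \<exists>u\<in>R. u \<noteq> 0 \<and> inverse u \<in> R \<and> f = u * t powi n"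
    by blast
qed (use assms in auto)


section \<open>Local rings of a plane chart\<close>

text \<open>The functions \<open>u\<close>, \<open>v\<close> are the coordinates of a chart, and \<open>(x0, y0)\<close> is a point of the curve
  in it. The assumption says that every polynomial relation between \<open>u\<close> and \<open>v\<close> holds at the
  point.\<close>

locale chart = hom_map h for h :: "'c::field \<Rightarrow> 'k::field" +
  fixes u v :: 'k and x0 y0 :: 'c
  assumes kernel: "eval2 h u v p = 0 \<Longrightarrow> eval2 id x0 y0 p = 0"
begin

definition R :: "'k set" where
  "R = {eval2 h u v p / eval2 h u v q | p q. eval2 id x0 y0 q \<noteq> 0}"

text \<open>Described by a numerator that vanishes at the point, not as the set of nonunits, so that
  closure under sums is a computation; \<open>maximal_ideal_at_eq\<close> identifies the
  two.\<close>

definition M :: "'k set" where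
  "M = {eval2 h u v p / eval2 h u v q | p q. eval2 id x0 y0 q \<noteq> 0 \<and> eval2 id x0 y0 p = 0}"

lemma R_I: "eval2 id x0 y0 q \<noteq> 0 \<Longrightarrow> eval2 h u v p / eval2 h u v q \<in> R"
  unfolding R_def by blast

lemma R_E:
  assumes "f \<in> R"
  obtains p q where "eval2 id x0 y0 q \<noteq> 0" "eval2 h u v q \<noteq> 0" "f = eval2 h u v p / eval2 h u v q"
  using assms kernel unfolding R_def by blast

lemma M_I: "eval2 id x0 y0 q \<noteq> 0 \<Longrightarrow> eval2 id x0 y0 p = 0 \<Longrightarrow> eval2 h u v p / eval2 h u v q \<in> M"
  unfolding M_def by blast

lemma M_E:
  assumes "f \<in> M"
  obtains p q where "eval2 id x0 y0 q \<noteq> 0" "eval2 h u v q \<noteq> 0" "eval2 id x0 y0 p = 0"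
    "f = eval2 h u v p / eval2 h u v q"
  using assms kernel unfolding M_def by blast

lemma M_subset: "f \<in> M \<Longrightarrow> f \<in> R"
  unfolding M_def R_def by blast

lemma poly_mem: "eval2 h u v p \<in> R"
  using R_I[of 1 p] by simp

lemma poly_M: "eval2 id x0 y0 p = 0 \<Longrightarrow> eval2 h u v p \<in> M"
  using M_I[of 1 p] by simp

lemma const_mem: "h c \<in> R"
  using poly_mem[of "[:[:c:]:]"] by simp

lemma R_zero: "0 \<in> R" and R_one: "1 \<in> R"
  using const_mem[of 0] const_mem[of 1] by (simp_all add: hom_one)

lemma M_zero: "0 \<in> M"
  using poly_M[of 0] by simp

lemma coord_mem: "u \<in> R" "v \<in> R"
  using poly_mem[of "[:[:0, 1:]:]"] poly_mem[of "[:0, 1:]"] by (simp_all add: hom_one)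

lemma R_add: assumes "f \<in> R" "g \<in> R" shows "f + g \<in> R"
proof -
  obtain p q where f: "eval2 id x0 y0 q \<noteq> 0" "eval2 h u v q \<noteq> 0" "f = eval2 h u v p / eval2 h u v q"
    using R_E[OF assms(1)] .
  obtain p' q' where g: "eval2 id x0 y0 q' \<noteq> 0" "eval2 h u v q' \<noteq> 0" "g = eval2 h u v p' / eval2 h u v q'"
    using R_E[OF assms(2)] .
  have "f + g = eval2 h u v (p * q' + p' * q) / eval2 h u v (q * q')"
    unfolding f(3) g(3) using f(2) g(2) by (simp add: eval2_simps field_simps)
  then show ?thesis
    using R_I[of "q * q'"] f g by (simp add: id_hom.eval2_simps)
qed

lemma R_mult: assumes "f \<in> R" "g \<in> R" shows "f * g \<in> R"
proof -
  obtain p q where f: "eval2 id x0 y0 q \<noteq> 0" "eval2 h u v q \<noteq> 0" "f = eval2 h u v p / eval2 h u v q"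
    using R_E[OF assms(1)] .
  obtain p' q' where g: "eval2 id x0 y0 q' \<noteq> 0" "eval2 h u v q' \<noteq> 0" "g = eval2 h u v p' / eval2 h u v q'"
    using R_E[OF assms(2)] .
  have "f * g = eval2 h u v (p * p') / eval2 h u v (q * q')"
    unfolding f(3) g(3) using f(2) g(2) by (simp add: eval2_simps field_simps)
  then show ?thesis
    using R_I[of "q * q'"] f g by (simp add: id_hom.eval2_simps)
qed

lemma R_minus: "f \<in> R \<Longrightarrow> - f \<in> R"
  using R_mult[OF const_mem[of "- 1"], of f] by (simp add: hom_simps)

lemma R_diff: "f \<in> R \<Longrightarrow> g \<in> R \<Longrightarrow> f - g \<in> R"
  using R_add[of f "- g"] R_minus by simp

lemma R_power: "f \<in> R \<Longrightarrow> f ^ n \<in> R"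
  by (induction n) (simp_all add: R_one R_mult)

lemma R_sum: "(\<And>i. i \<in> A \<Longrightarrow> f i \<in> R) \<Longrightarrow> sum f A \<in> R"
  by (induction A rule: infinite_finite_induct) (simp_all add: R_zero R_add)

lemma M_add: assumes "f \<in> M" "g \<in> M" shows "f + g \<in> M"
proof -
  obtain p q where f: "eval2 id x0 y0 q \<noteq> 0" "eval2 h u v q \<noteq> 0" "eval2 id x0 y0 p = 0"
      "f = eval2 h u v p / eval2 h u v q"
    using M_E[OF assms(1)] .
  obtain p' q' where g: "eval2 id x0 y0 q' \<noteq> 0" "eval2 h u v q' \<noteq> 0" "eval2 id x0 y0 p' = 0"
      "g = eval2 h u v p' / eval2 h u v q'"
    using M_E[OF assms(2)] .
  have "f + g = eval2 h u v (p * q' + p' * q) / eval2 h u v (q * q')"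
    unfolding f(4) g(4) using f(2) g(2) by (simp add: eval2_simps field_simps)
  then show ?thesis
    using M_I[of "q * q'"] f g by (simp add: id_hom.eval2_simps)
qed

lemma M_mult: assumes "f \<in> M" "g \<in> R" shows "f * g \<in> M"
proof -
  obtain p q where f: "eval2 id x0 y0 q \<noteq> 0" "eval2 h u v q \<noteq> 0" "eval2 id x0 y0 p = 0"
      "f = eval2 h u v p / eval2 h u v q"
    using M_E[OF assms(1)] .
  obtain p' q' where g: "eval2 id x0 y0 q' \<noteq> 0" "eval2 h u v q' \<noteq> 0" "g = eval2 h u v p' / eval2 h u v q'"
    using R_E[OF assms(2)] .
  have "f * g = eval2 h u v (p * p') / eval2 h u v (q * q')"
    unfolding f(4) g(3) using f(2) g(2) by (simp add: eval2_simps field_simps)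
  then show ?thesis
    using M_I[of "q * q'"] f g by (simp add: id_hom.eval2_simps)
qed

lemma M_mult_left: "g \<in> R \<Longrightarrow> f \<in> M \<Longrightarrow> g * f \<in> M"
  using M_mult[of f g] by (simp add: mult.commute)

lemma M_minus: "f \<in> M \<Longrightarrow> - f \<in> M"
  using M_mult[OF _ const_mem[of "- 1"], of f] by (simp add: hom_simps)

lemma M_diff: "f \<in> M \<Longrightarrow> g \<in> M \<Longrightarrow> f - g \<in> M"
  using M_add[of f "- g"] M_minus by simp

text \<open>From p / q = 1 the relation p - q = 0 would hold between the coordinates but fail at the
  point, against \<open>kernel\<close>.\<close>

lemma one_notin_M: "1 \<notin> M"
proof
  assume "1 \<in> M"
  then obtain p q where *: "eval2 id x0 y0 q \<noteq> 0" "eval2 h u v q \<noteq> 0" "eval2 id x0 y0 p = 0"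
      "1 = eval2 h u v p / eval2 h u v q"
    by (rule M_E)
  then have "eval2 h u v (p - q) = 0"
    by (simp add: eval2_simps)
  from kernel[OF this] * show False
    by (simp add: id_hom.eval2_simps)
qed

lemma inverse_mem: assumes "f \<in> R" "f \<notin> M" shows "inverse f \<in> R"
proof -
  obtain p q where f: "eval2 id x0 y0 q \<noteq> 0" "f = eval2 h u v p / eval2 h u v q"
    using R_E[OF assms(1)] by metis
  with assms(2) M_I have "eval2 id x0 y0 p \<noteq> 0" by blast
  then show ?thesis using R_I[of p q] f by simp
qed

lemma inverse_notin: assumes "f \<in> M" "f \<noteq> 0" shows "inverse f \<notin> R"
  using M_mult[OF assms(1), of "inverse f"] assms(2) one_notin_M by auto

lemma const_M_iff: "h c \<in> M \<longleftrightarrow> c = 0"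
proof
  assume "h c \<in> M"
  then show "c = 0"
    using M_mult[OF _ const_mem[of "inverse c"], of "h c"] one_notin_M
    by (cases "c = 0") (simp_all add: hom_mult[symmetric] hom_one)
qed (simp add: M_zero)

lemma value_ex: assumes "f \<in> R" shows "\<exists>c. f - h c \<in> M"
proof -
  obtain p q where f: "eval2 id x0 y0 q \<noteq> 0" "eval2 h u v q \<noteq> 0" "f = eval2 h u v p / eval2 h u v q"
    using R_E[OF assms] .
  let ?c = "eval2 id x0 y0 p / eval2 id x0 y0 q"
  have "f - h ?c = eval2 h u v (p - smult [:?c:] q) / eval2 h u v q"
    unfolding f(3) using f(2) by (simp add: eval2_diff eval2_smult field_simps)
  moreover have "eval2 id x0 y0 (p - smult [:?c:] q) = 0"
    using f(1) by (simp add: id_hom.eval2_diff id_hom.eval2_smult)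
  ultimately show ?thesis using M_I[of q "p - smult [:?c:] q"] f(1) by metis
qed

lemma value_unique: "f - h c \<in> M \<Longrightarrow> f - h d \<in> M \<Longrightarrow> c = d"
  using M_diff[of "f - h c" "f - h d"] const_M_iff[of "d - c"] by (simp add: hom_diff)

lemma mem_R_if_value: "f - h c \<in> M \<Longrightarrow> f \<in> R"
  using R_add[OF M_subset const_mem, of "f - h c" c] by simp

lemma value_add: "f - h c \<in> M \<Longrightarrow> g - h d \<in> M \<Longrightarrow> (f + g) - h (c + d) \<in> M"
  using M_add[of "f - h c" "g - h d"] by (simp add: hom_add algebra_simps)

lemma value_diff: "f - h c \<in> M \<Longrightarrow> g - h d \<in> M \<Longrightarrow> (f - g) - h (c - d) \<in> M"
  using M_diff[of "f - h c" "g - h d"] by (simp add: hom_diff algebra_simps)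

lemma value_mult:
  assumes "f - h c \<in> M" "g - h d \<in> M" shows "f * g - h (c * d) \<in> M"
proof -
  have "(f - h c) * g + (g - h d) * h c \<in> M"
    using assms mem_R_if_value const_mem by (intro M_add M_mult)
  then show ?thesis by (simp add: hom_mult algebra_simps)
qed

lemma value_divide:
  assumes f: "f - h c \<in> M" and g: "g - h d \<in> M" and d: "d \<noteq> 0"
  shows "f / g - h (c / d) \<in> M"
proof -
  have "g \<notin> M"
    using value_unique[of g d 0] g d by auto
  moreover have "g \<in> R" using g by (rule mem_R_if_value)
  ultimately have "g \<noteq> 0" "inverse g \<in> R"
    using M_zero inverse_mem by auto
  have "f - h (c / d) * g - 0 \<in> M"
    using value_diff[OF f value_mult[of "h (c / d)" "c / d", OF _ g]] M_zero d by simp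
  then have "(f - h (c / d) * g) * inverse g \<in> M"
    using \<open>inverse g \<in> R\<close> by (intro M_mult) simp_all
  then show ?thesis using \<open>g \<noteq> 0\<close> by (simp add: field_simps)
qed

lemma value_const: "h c - h c \<in> M"
  by (simp add: M_zero)

lemma coord_value: "u - h x0 \<in> M" "v - h y0 \<in> M"
  using poly_M[of "[:[:- x0, 1:]:]"] poly_M[of "[:[:- y0:], 1:]"] by (simp_all add: hom_simps)

text \<open>Horner's scheme with u = x0 + (u - x0) and v = y0 + (v - y0) in each step. It follows
  that the two coordinate differences generate the maximal ideal.\<close>

lemma taylor:
  obtains f g where "f \<in> R" "g \<in> R"
    "eval2 h u v p = h (eval2 id x0 y0 p) + (u - h x0) * f + (v - h y0) * g"
proof -
  have "\<exists>f\<in>R. ev u a = h (poly a x0) + (u - h x0) * f" for a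
  proof (induction a)
    case 0
    then show ?case using R_zero by force
  next
    case (pCons c a)
    then obtain f where f: "f \<in> R" "ev u a = h (poly a x0) + (u - h x0) * f" by blast
    show ?case
      by (intro bexI[of _ "u * f + h (poly a x0)"])
        (use f(1) in \<open>auto simp: f(2) hom_simps algebra_simps intro!: R_add R_mult coord_mem const_mem\<close>)
  qed note univariate = this
  have "\<exists>f\<in>R. \<exists>g\<in>R. eval2 h u v p = h (eval2 id x0 y0 p) + (u - h x0) * f + (v - h y0) * g"
  proof (induction p)
    case 0
    have "eval2 h u v 0 = h (eval2 id x0 y0 0) + (u - h x0) * 0 + (v - h y0) * 0"
      by simp
    with R_zero show ?case by blast
  next
    case (pCons a p)
    then obtain f g where fg: "f \<in> R" "g \<in> R"
      "eval2 h u v p = h (eval2 id x0 y0 p) + (u - h x0) * f + (v - h y0) * g" by blast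
    obtain e where e: "e \<in> R" "ev u a = h (poly a x0) + (u - h x0) * e"
      using univariate by blast
    have "eval2 h u v (pCons a p) = h (eval2 id x0 y0 (pCons a p)) + (u - h x0) * (e + v * f)
        + (v - h y0) * (v * g + h (eval2 id x0 y0 p))"
      by (simp add: fg(3) e(2) hom_simps algebra_simps)
    moreover have "e + v * f \<in> R" "v * g + h (eval2 id x0 y0 p) \<in> R"
      using fg(1,2) e(1) by (auto intro!: R_add R_mult coord_mem const_mem)
    ultimately show ?case by blast
  qed
  with that show thesis by blast
qed

lemma maximal_ideal_principal:
  assumes "f \<in> M" and t: "t \<noteq> 0" "(u - h x0) / t \<in> R" "(v - h y0) / t \<in> R"
  shows "f / t \<in> R"
proof -
  obtain p q where f: "eval2 id x0 y0 q \<noteq> 0" "eval2 h u v q \<noteq> 0" "eval2 id x0 y0 p = 0"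
      "f = eval2 h u v p / eval2 h u v q"
    using M_E[OF assms(1)] .
  obtain g1 g2 where g: "g1 \<in> R" "g2 \<in> R"
    "eval2 h u v p = h (eval2 id x0 y0 p) + (u - h x0) * g1 + (v - h y0) * g2"
    by (rule taylor)
  have "f / t = ((u - h x0) / t * g1 + (v - h y0) / t * g2) * (eval2 h u v 1 / eval2 h u v q)"
    unfolding f(4) g(3) f(3) using f(2) t(1) by (simp add: field_simps)
  also have "\<dots> \<in> R"
    using t g f by (intro R_mult R_add R_I) simp_all
  finally show ?thesis .
qed

lemma dvrI:
  assumes t: "t \<in> M" "t \<noteq> 0" "(u - h x0) / t \<in> R" "(v - h y0) / t \<in> R"
    and fractions: "\<And>f. f \<noteq> 0 \<Longrightarrow> \<exists>p\<in>R. \<exists>q\<in>R. p \<noteq> 0 \<and> q \<noteq> 0 \<and> f = p / q"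
    and bounded: "\<And>f. f \<in> R \<Longrightarrow> f \<noteq> 0 \<Longrightarrow> \<exists>n::nat. f / t ^ n \<notin> R"
  shows "dvr R t"
  by (rule dvr_intro)
    (use assms in \<open>auto intro: R_one R_add R_mult M_subset dest: inverse_notin inverse_mem
      maximal_ideal_principal\<close>)

lemma maximal_ideal_at_eq:
  assumes "local_ring E \<alpha> = R"
  shows "maximal_ideal_at E \<alpha> = M"
  using inverse_mem inverse_notin M_zero M_subset
  by (auto simp: maximal_ideal_at_def local_units_def assms)

lemma value_at_eq:
  assumes "local_ring E \<alpha> = R" "cst E = h" "f - h c \<in> M"
  shows "value_at E \<alpha> f = c"
  unfolding value_at_def maximal_ideal_at_eq[OF assms(1)] assms(2)
  using assms(3) value_unique by blast

text \<open>The Leibniz rule passes from the two coordinates to all polynomials, and the quotient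
  rule in the form D f = (D p - f D q) / q divides only by a q that does not vanish at the
  point.\<close>

lemma derivation_mem:
  assumes add: "\<And>f g. D (f + g) = D f + D g"
    and mult: "\<And>f g. D (f * g) = f * D g + g * D f"
    and const: "\<And>c. D (h c) = 0"
    and coord: "D u \<in> R" "D v \<in> R"
    and f: "f \<in> R"
  shows "D f \<in> R"
proof -
  have "D (ev u a) \<in> R" for a
    by (induction a)
      (use poly_mem[of "[:_:]"] const[of 0] in \<open>auto simp: add mult const coord coord_mem R_zero intro!: R_add R_mult\<close>)
  then have D_poly: "D (eval2 h u v p) \<in> R" for p
    by (induction p)
      (use const[of 0] in \<open>auto simp: add mult coord coord_mem R_zero intro!: R_add R_mult poly_mem\<close>)
  obtain p q where pq: "eval2 id x0 y0 q \<noteq> 0" "eval2 h u v q \<noteq> 0" "f = eval2 h u v p / eval2 h u v q"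
    using R_E[OF f] .
  have "f * D (eval2 h u v q) + eval2 h u v q * D f = D (eval2 h u v p)"
    using mult[of f "eval2 h u v q"] pq by simp
  then have "D f = (D (eval2 h u v p) - f * D (eval2 h u v q)) * (eval2 h u v 1 / eval2 h u v q)"
    using pq(2) by (simp add: field_simps)
  also have "\<dots> \<in> R"
    using f pq(1) by (intro R_mult R_diff D_poly R_I)
  finally show ?thesis .
qed

end


section \<open>The function field\<close>

locale elliptic =
  fixes E :: "('c::alg_closed_field, 'k::field) curve"
  assumes elliptic: "elliptic_curve E"

sublocale elliptic \<subseteq> hom_map "cst E"
  using elliptic by unfold_locales (auto simp: elliptic_curve_def is_function_field_def)

context elliptic
begin

abbreviation "X \<equiv> xfun E"
abbreviation "Y \<equiv> yfun E"
abbreviation "con \<equiv> cst E"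

lemma cst_eq_0_iff [simp]: "con c = 0 \<longleftrightarrow> c = 0"
proof
  assume "con c = 0"
  then show "c = 0"
    using hom_mult[of c "inverse c"] hom_one by (cases "c = 0") simp_all
qed simp

lemma cst_eq_iff [simp]: "con c = con d \<longleftrightarrow> c = d"
  using cst_eq_0_iff[of "c - d"] by (simp only: hom_diff eq_iff_diff_eq_0[symmetric])

lemma cst_inverse: "con (inverse c) = inverse (con c)"
  using hom_mult[of c "inverse c"] hom_one
  by (cases "c = 0") (simp_all add: inverse_unique)

lemma cst_divide: "con (c / d) = con c / con d"
  by (simp add: divide_inverse hom_mult cst_inverse)

lemmas cst_simps = hom_simps cst_inverse cst_divide

lemma eval2_eq_0_iff: "eval2 con X Y p = 0 \<longleftrightarrow> weierstrass_poly E dvd p"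
  using elliptic by (auto simp: elliptic_curve_def is_function_field_def)

lemma fraction:
  obtains p q where "eval2 con X Y q \<noteq> 0" "f = eval2 con X Y p / eval2 con X Y q"
  using elliptic unfolding elliptic_curve_def is_function_field_def by metis

lemma weierstrass: "Y\<^sup>2 + con (a1 E) * X * Y + con (a3 E) * Y
    = X ^ 3 + con (a2 E) * X\<^sup>2 + con (a4 E) * X + con (a6 E)"
proof -
  have "eval2 con X Y (weierstrass_poly E) = 0"
    by (simp add: eval2_eq_0_iff)
  then show ?thesis
    by (simp add: weierstrass_poly_def hom_simps) algebra
qed

lemma on_curve_Affine: "on_curve E (Affine x y) \<longleftrightarrow>
    y\<^sup>2 + a1 E * x * y + a3 E * y = x ^ 3 + a2 E * x\<^sup>2 + a4 E * x + a6 E"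
proof -
  have "eval2 id x y (weierstrass_poly E) =
    y\<^sup>2 + a1 E * x * y + a3 E * y - (x ^ 3 + a2 E * x\<^sup>2 + a4 E * x + a6 E)"
    by (simp add: weierstrass_poly_def algebra_simps power2_eq_square power3_eq_cube)
  then show ?thesis by simp
qed

text \<open>The Weierstrass polynomial is monic of degree 2 in y, so its only multiple of degree at
  most 1 in y is 0.\<close>

lemma linear_in_Y_eq_0:
  assumes "ev X A + Y * ev X B = 0" shows "A = 0" "B = 0"
proof -
  have "eval2 con X Y [:A, B:] = 0"
    using assms by simp
  then have dvd: "weierstrass_poly E dvd [:A, B:]"
    by (simp only: eval2_eq_0_iff)
  have "[:A, B:] = 0"
  proof (rule ccontr)
    assume "[:A, B:] \<noteq> 0"
    with dvd have "degree (weierstrass_poly E) \<le> degree [:A, B:]"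
      by (rule dvd_imp_degree_le)
    then show False
      by (simp add: weierstrass_poly_def split: if_splits)
  qed
  then show "A = 0" "B = 0" by simp_all
qed

lemma ev_X_eq_0_iff [simp]: "ev X A = 0 \<longleftrightarrow> A = 0"
  using linear_in_Y_eq_0[of A 0] by auto

lemma reduce_mod_weierstrass: "\<exists>A B. weierstrass_poly E dvd p - [:A, B:]"
proof (induction p)
  case 0
  show ?case by (intro exI[of _ 0]) simp
next
  case (pCons c p)
  then obtain A B where "weierstrass_poly E dvd p - [:A, B:]" by blast
  \<comment> \<open>Multiplying by y turns B y into B y^2, which B times the Weierstrass polynomial
    removes.\<close>
  then have "weierstrass_poly E dvd [:0, 1:] * (p - [:A, B:]) + smult B (weierstrass_poly E)"
    by (intro dvd_add dvd_mult dvd_smult) simp_all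
  also have "[:0, 1:] * (p - [:A, B:]) + smult B (weierstrass_poly E)
      = pCons c p - [:c + B * [:a6 E, a4 E, a2 E, 1:], A - B * [:a3 E, a1 E:]:]"
  proof -
    have "[:- a6 E, - a4 E, - a2 E, - 1:] = - [:a6 E, a4 E, a2 E, 1:]" by simp
    then show ?thesis
      by (simp add: weierstrass_poly_def algebra_simps diff_pCons)
  qed
  finally show ?case by blast
qed

lemma reduce:
  obtains A B where "eval2 con X Y p = ev X A + Y * ev X B"
    "\<And>x y. on_curve E (Affine x y) \<Longrightarrow> eval2 id x y p = poly A x + y * poly B x"
proof -
  obtain A B q where q: "p - [:A, B:] = weierstrass_poly E * q"
    using reduce_mod_weierstrass[of p] by (auto elim!: dvdE)
  have "eval2 con X Y (p - [:A, B:]) = 0"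
    by (simp add: eval2_eq_0_iff q)
  moreover have "eval2 id x y (p - [:A, B:]) = 0" if "on_curve E (Affine x y)" for x y
    using that by (simp add: q id_hom.eval2_mult)
  ultimately show thesis
    by (intro that[of A B]) (simp_all add: eval2_diff id_hom.eval2_diff)
qed

text \<open>The norm of \<open>A(x) + B(x) y\<close> down to the field of rational functions in \<open>x\<close>.\<close>

definition norm_poly :: "'c poly \<Rightarrow> 'c poly \<Rightarrow> 'c poly" where
  "norm_poly A B = A\<^sup>2 - A * B * [:a3 E, a1 E:] - B\<^sup>2 * [:a6 E, a4 E, a2 E, 1:]"

text \<open>The second factor is the conjugate of the first, with y replaced by the other root -y -
  a1 x - a3 of the Weierstrass equation.\<close>

lemma ev_norm_poly: "ev X (norm_poly A B) =
    (ev X A + Y * ev X B) * (ev X A - ev X B * (con (a1 E) * X + con (a3 E)) - Y * ev X B)"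
proof -
  have "ev X (norm_poly A B) = (ev X A)\<^sup>2 - ev X A * ev X B * (con (a1 E) * X + con (a3 E))
      - (ev X B)\<^sup>2 * (X ^ 3 + con (a2 E) * X\<^sup>2 + con (a4 E) * X + con (a6 E))"
    by (simp add: norm_poly_def ev_diff ev_mult ev_power hom_one del: mult_pCons_left mult_pCons_right)
      (simp add: algebra_simps power2_eq_square power3_eq_cube)
  also have "\<dots> = (ev X A + Y * ev X B) * (ev X A - ev X B * (con (a1 E) * X + con (a3 E)) - Y * ev X B)"
    using weierstrass by algebra
  finally show ?thesis .
qed

lemma poly_norm_poly:
  assumes "on_curve E (Affine x y)"
  shows "poly (norm_poly A B) x = (poly A x + y * poly B x)
    * (poly A x - poly B x * (a1 E * x + a3 E) - y * poly B x)"
proof -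
  have "poly (norm_poly A B) x = (poly A x)\<^sup>2 - poly A x * poly B x * (a1 E * x + a3 E)
      - (poly B x)\<^sup>2 * (x ^ 3 + a2 E * x\<^sup>2 + a4 E * x + a6 E)"
    by (simp add: norm_poly_def del: mult_pCons_left mult_pCons_right) (simp add: algebra_simps power2_eq_square power3_eq_cube)
  then show ?thesis
    using assms unfolding on_curve_Affine by algebra
qed

lemma norm_poly_eq_0_iff: "norm_poly A B = 0 \<longleftrightarrow> A = 0 \<and> B = 0"
proof
  assume "norm_poly A B = 0"
  moreover have "ev X (A - B * [:a3 E, a1 E:]) + Y * ev X (- B)
      = ev X A - ev X B * (con (a1 E) * X + con (a3 E)) - Y * ev X B"
    by (simp add: ev_diff ev_mult ev_minus algebra_simps del: mult_pCons_left mult_pCons_right)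
  ultimately have "ev X A + Y * ev X B = 0 \<or> ev X (A - B * [:a3 E, a1 E:]) + Y * ev X (- B) = 0"
    using ev_norm_poly[of A B] by auto
  then show "A = 0 \<and> B = 0"
    using linear_in_Y_eq_0 by fastforce
qed (simp add: norm_poly_def)

lemma field_element:
  obtains A B D where "D \<noteq> 0" "f = (ev X A + Y * ev X B) / ev X D"
proof -
  obtain p q where pq: "eval2 con X Y q \<noteq> 0" "f = eval2 con X Y p / eval2 con X Y q"
    by (rule fraction)
  obtain A B where q: "eval2 con X Y q = ev X A + Y * ev X B"
    using reduce[of q] by metis
  \<comment> \<open>The conjugate of the denominator; their product is the norm, which involves x
    alone.\<close>
  let ?c = "[:A - B * [:a3 E, a1 E:], - B:]"
  have c: "eval2 con X Y ?c = ev X A - ev X B * (con (a1 E) * X + con (a3 E)) - Y * ev X B"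
    by (simp add: ev_diff ev_mult ev_minus algebra_simps del: mult_pCons_left mult_pCons_right)
  obtain A' B' where p: "eval2 con X Y (p * ?c) = ev X A' + Y * ev X B'"
    using reduce[of "p * ?c"] by metis
  have AB: "\<not> (A = 0 \<and> B = 0)" using pq(1) q by auto
  then have "norm_poly A B \<noteq> 0" by (simp add: norm_poly_eq_0_iff)
  moreover have "f = (ev X A' + Y * ev X B') / ev X (norm_poly A B)"
  proof -
    have "eval2 con X Y ?c \<noteq> 0"
      using calculation ev_norm_poly[of A B] unfolding c by auto
    then show ?thesis
      unfolding p[symmetric] ev_norm_poly c[symmetric] eval2_mult pq(2) q by simp
  qed
  ultimately show thesis using that by blast
qed

lemma root_exists:
  assumes "degree (p :: 'c poly) > 0" obtains x where "poly p x = 0"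
  using alg_closed_imp_poly_has_root[OF assms] by blast

lemma point_over:
  obtains y where "on_curve E (Affine x y)"
proof -
  let ?p = "[:- (x ^ 3 + a2 E * x\<^sup>2 + a4 E * x + a6 E), a1 E * x + a3 E, 1:]"
  obtain y where "poly ?p y = 0"
    using root_exists[of ?p] by auto
  then show thesis
    by (intro that[of y], unfold on_curve_Affine) (simp, algebra)
qed

text \<open>Over a finite field the product of all x - a, plus 1, would have no root. Points outside
  any finite set are obtained from this.\<close>

lemma infinite_constants: "infinite (UNIV :: 'c set)"
proof
  assume fin: "finite (UNIV :: 'c set)"
  let ?p = "(\<Prod>a\<in>(UNIV :: 'c set). [:- a, 1:])"
  have deg: "degree ?p = card (UNIV :: 'c set)"
    by (subst degree_prod_sum_eq) (simp_all add: fin)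
  have "card (UNIV :: 'c set) > 0"
    using fin by (simp add: card_gt_0_iff)
  then have "degree (?p + 1) > 0"
    by (subst degree_add_eq_left) (simp_all add: deg)
  then obtain x where "poly (?p + 1) x = 0"
    by (rule root_exists)
  then have "(\<Prod>a\<in>(UNIV :: 'c set). x - a) + 1 = 0"
    by (simp add: poly_prod algebra_simps)
  moreover have "(\<Prod>a\<in>(UNIV :: 'c set). x - a) = 0"
    using fin by (subst prod_zero_iff) auto
  ultimately show False by simp
qed

end


declare local_ring.simps [simp del] on_curve.simps(2) [simp del]

context elliptic
begin

section \<open>Valuations\<close>

text \<open>Moving a singular point to the origin would make \<open>b4\<close>, \<open>b6\<close> and \<open>b8\<close> vanish; their values
  in the original coordinates, computed below, therefore make the discriminant zero.\<close>

lemma nonsingular: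
  assumes P: "on_curve E (Affine x y)" and Fy: "2 * y + a1 E * x + a3 E = 0"
  shows "3 * x\<^sup>2 + 2 * a2 E * x + a4 E - a1 E * y \<noteq> 0"
proof
  assume Fx: "3 * x\<^sup>2 + 2 * a2 E * x + a4 E - a1 E * y = 0"
  have F: "y\<^sup>2 + a1 E * x * y + a3 E * y = x ^ 3 + a2 E * x\<^sup>2 + a4 E * x + a6 E"
    using P by (simp only: on_curve_Affine)
  have a3: "a3 E = - 2 * y - a1 E * x" using Fy by algebra
  have a4: "a4 E = - 3 * x\<^sup>2 - 2 * a2 E * x + a1 E * y" using Fx by algebra
  have a6: "a6 E = y\<^sup>2 + a1 E * x * y + a3 E * y - x ^ 3 - a2 E * x\<^sup>2 - a4 E * x" using F by algebra
  have b4: "b4 E = - x * b2 E - 6 * x\<^sup>2"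
    unfolding b4_def b2_def a4 a3 by algebra
  have b6: "b6 E = x\<^sup>2 * b2 E + 8 * x ^ 3"
    unfolding b6_def b2_def a6 a4 a3 by algebra
  have b8: "b8 E = - (x ^ 3) * b2 E - 9 * x ^ 4"
    unfolding b8_def b2_def a6 a4 a3 by algebra
  have "discriminant E = 0"
    unfolding discriminant_def b4 b6 b8 by algebra
  then show False
    using elliptic by (simp add: elliptic_curve_def)
qed

lemma chart_Affine:
  assumes "on_curve E (Affine x y)" shows "chart con X Y x y"
  by unfold_locales (use assms in \<open>auto simp: on_curve.simps eval2_eq_0_iff id_hom.eval2_mult elim!: dvdE\<close>)

lemma local_ring_Affine:
  assumes "on_curve E (Affine x y)" shows "local_ring E (Affine x y) = chart.R con X Y x y"
  unfolding local_ring.simps chart.R_def[OF chart_Affine[OF assms]] ..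

text \<open>The expression 2 y + a1 x + a3 is the derivative of the Weierstrass equation in y. It
  vanishes where the vertical line is tangent, that is at the affine points equal to their own
  negative. There x - x0 has order 2, recorded by \<open>ramification\<close>, and y - y0 takes over
  as uniformizer.\<close>

definition chart_uniformizer :: "'c \<Rightarrow> 'c \<Rightarrow> 'k" where
  "chart_uniformizer x y = (if 2 * y + a1 E * x + a3 E = 0 then Y - con y else X - con x)"

definition ramification :: "'c \<Rightarrow> 'c \<Rightarrow> nat" where
  "ramification x y = (if 2 * y + a1 E * x + a3 E = 0 then 2 else 1)"

lemma X_minus_nonzero: "X - con x \<noteq> 0"
  using ev_X_eq_0_iff[of "[:- x, 1:]"] by (simp add: hom_simps del: ev_X_eq_0_iff)

lemma Y_minus_line_nonzero: "Y - con l * X - con m \<noteq> 0"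
  using linear_in_Y_eq_0(2)[of "[:- m, - l:]" 1] by (auto simp: hom_simps algebra_simps)

lemma Y_minus_nonzero: "Y - con y \<noteq> 0"
  using Y_minus_line_nonzero[of 0 y] by simp

lemma uniformizer_coordinates:
  assumes P: "on_curve E (Affine x y)"
  defines "R \<equiv> local_ring E (Affine x y)" and "t \<equiv> chart_uniformizer x y"
  shows "t \<in> chart.M con X Y x y" "t \<noteq> 0" "(Y - con y) / t \<in> R"
    and "\<exists>g\<in>R. inverse g \<in> R \<and> g \<noteq> 0 \<and> X - con x = g * t ^ ramification x y"
proof -
  interpret C: chart con X Y x y by (rule chart_Affine[OF P])
  have R: "R = C.R" unfolding R_def by (rule local_ring_Affine[OF P])
  show "t \<in> C.M" "t \<noteq> 0"
    using C.coord_value X_minus_nonzero Y_minus_nonzero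
    by (auto simp: t_def chart_uniformizer_def)
  let ?U = "X - con x" and ?V = "Y - con y"
  \<comment> \<open>\<open>?Fy\<close> and, up to sign, \<open>?Fx\<close> are the partial
    derivatives of the Weierstrass equation; \<open>eq\<close> below is its Taylor expansion at the
    point.\<close>
  let ?Fy = "2 * y + a1 E * x + a3 E" and ?Fx = "3 * x\<^sup>2 + 2 * a2 E * x + a4 E - a1 E * y"
  have "con (y\<^sup>2 + a1 E * x * y + a3 E * y) = con (x ^ 3 + a2 E * x\<^sup>2 + a4 E * x + a6 E)"
    using P unfolding on_curve_Affine by simp
  then have eq: "?V * (?V + con (a1 E) * ?U + con ?Fy)
      = ?U * (con ?Fx + con (3 * x + a2 E) * ?U + ?U\<^sup>2)"
    using weierstrass unfolding hom_simps by algebra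
  show "(Y - con y) / t \<in> R"
  proof (cases "?Fy = 0")
    case True
    then show ?thesis using C.R_one Y_minus_nonzero by (simp add: t_def chart_uniformizer_def R)
  next
    case False
    \<comment> \<open>The cofactor of \<open>?V\<close> in \<open>eq\<close> has the nonzero value
      \<open>?Fy\<close>, hence is a unit.\<close>
    let ?g = "?V + con (a1 E) * ?U + con ?Fy"
    have g: "?g - con (0 + 0 + ?Fy) \<in> C.M"
      by (intro C.value_add C.value_const)
        (use C.coord_value C.M_mult_left[OF C.const_mem] in \<open>simp_all\<close>)
    then have "?g \<notin> C.M"
      using C.value_unique[of ?g 0 ?Fy] False by auto
    moreover have "?g \<in> C.R"
      using g C.mem_R_if_value by blast
    ultimately have "?g \<noteq> 0" "inverse ?g \<in> C.R"
      using C.M_zero C.inverse_mem by auto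
    then have "(con ?Fx + con (3 * x + a2 E) * ?U + ?U\<^sup>2) * inverse ?g \<in> C.R"
      by (intro C.R_mult C.R_add C.R_power C.const_mem C.M_subset[OF C.coord_value(1)])
    moreover have frac: "d * inverse b = a / c" if "b \<noteq> 0" "c \<noteq> 0" "a * b = c * d" for a b c d :: 'k
      using that by (simp add: field_simps)
    have "(con ?Fx + con (3 * x + a2 E) * ?U + ?U\<^sup>2) * inverse ?g = ?V / ?U"
      by (rule frac[OF \<open>?g \<noteq> 0\<close> X_minus_nonzero eq])
    ultimately show ?thesis using False by (simp add: t_def chart_uniformizer_def R)
  qed
  show "\<exists>g\<in>R. inverse g \<in> R \<and> g \<noteq> 0 \<and> X - con x = g * t ^ ramification x y"
  proof (cases "?Fy = 0")
    case False
    then show ?thesis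
      using C.R_one by (intro bexI[of _ 1]) (simp_all add: t_def chart_uniformizer_def ramification_def R)
  next
    case True
    \<comment> \<open>With \<open>?Fy\<close> = 0 the term a1 U V can be moved to the other side,
      and \<open>eq\<close> reads V^2 = U g, where g has the value \<open>?Fx\<close>, nonzero by
      nonsingularity.\<close>
    let ?g = "con ?Fx + con (3 * x + a2 E) * ?U + ?U\<^sup>2 - con (a1 E) * ?V"
    have "?g - con (?Fx + 0 + 0 - 0) \<in> C.M"
      by (intro C.value_add C.value_diff C.value_const)
        (use C.coord_value C.M_mult_left[OF C.const_mem] C.M_mult[OF _ C.M_subset]
          in \<open>simp_all add: power2_eq_square\<close>)
    then have g: "?g - con ?Fx \<in> C.M"
      by (simp only: add_0_right diff_0_right)
    then have "?g \<notin> C.M"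
      using C.value_unique[of ?g 0 ?Fx] nonsingular[OF P True] by auto
    moreover have "?g \<in> C.R"
      using g C.mem_R_if_value by blast
    ultimately have g': "?g \<noteq> 0" "inverse ?g \<in> C.R"
      using C.M_zero C.inverse_mem by auto
    have "?U * ?g = ?V\<^sup>2"
      using eq unfolding True by (simp add: algebra_simps power2_eq_square)
    then have "?U = inverse ?g * ?V ^ 2"
      using g'(1) by (simp add: nonzero_eq_divide_eq divide_inverse[symmetric] mult.commute)
    then show ?thesis
      using True g' \<open>?g \<in> C.R\<close>
      by (intro bexI[of _ "inverse ?g"]) (simp_all add: t_def chart_uniformizer_def ramification_def R)
  qed
qed

lemma dvr_Affine:
  assumes P: "on_curve E (Affine x y)"
  shows "dvr (local_ring E (Affine x y)) (chart_uniformizer x y)"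
proof -
  interpret C: chart con X Y x y by (rule chart_Affine[OF P])
  have R: "local_ring E (Affine x y) = C.R" by (rule local_ring_Affine[OF P])
  define t where "t = chart_uniformizer x y"
  have t: "t \<in> C.M" "t \<noteq> 0" "(Y - con y) / t \<in> C.R"
    unfolding t_def R[symmetric] by (rule uniformizer_coordinates[OF P])+
  obtain g where g: "g \<in> C.R" "inverse g \<in> C.R" "g \<noteq> 0" "X - con x = g * t ^ ramification x y"
    unfolding t_def R[symmetric] using uniformizer_coordinates(4)[OF P] by blast
  have inv_t: "inverse t \<notin> C.R"
    using t C.inverse_notin by blast
  have "dvr C.R t"
  proof (rule C.dvrI)
    have "(X - con x) / t = g * t ^ (ramification x y - 1)"
      using t(2) unfolding g(4) by (simp add: ramification_def power2_eq_square)
    then show "(X - con x) / t \<in> C.R"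
      using g(1) t(1) by (simp add: C.R_mult C.R_power C.M_subset)
  next
    fix f :: 'k assume "f \<noteq> 0"
    obtain p q where "eval2 con X Y q \<noteq> 0" "f = eval2 con X Y p / eval2 con X Y q"
      by (rule fraction)
    then show "\<exists>p\<in>C.R. \<exists>q\<in>C.R. p \<noteq> 0 \<and> q \<noteq> 0 \<and> f = p / q"
      using \<open>f \<noteq> 0\<close> C.poly_mem by (metis divide_eq_0_iff)
  next
    fix f assume f: "f \<in> C.R" "f \<noteq> 0"
    obtain p q where pq: "eval2 id x y q \<noteq> 0" "eval2 con X Y q \<noteq> 0" "f = eval2 con X Y p / eval2 con X Y q"
      using C.R_E[OF f(1)] .
    obtain A B where AB: "eval2 con X Y p = ev X A + Y * ev X B"
      using reduce[of p] by metis
    have "norm_poly A B \<noteq> 0"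
      using f(2) pq AB by (auto simp: norm_poly_eq_0_iff)
    then obtain k N where N: "norm_poly A B = [:- x, 1:] ^ k * N" "\<not> [:- x, 1:] dvd N"
      using order_decomp[of "norm_poly A B" x] by blast
    define c where "c = ev X A - ev X B * (con (a1 E) * X + con (a3 E)) - Y * ev X B"
    have ev_mem: "ev X p \<in> C.R" for p
      using C.poly_mem[of "[:p:]"] by simp
    have "c \<in> C.R"
      unfolding c_def by (intro C.R_diff C.R_mult C.R_add C.const_mem C.coord_mem ev_mem)
    have N': "ev X N - con (poly N x) \<in> C.M"
      using C.poly_M[of "[:N - [:poly N x:]:]"] by (simp add: ev_diff id_hom.hom_simps)
    moreover have "poly N x \<noteq> 0"
      using N(2) by (simp add: poly_eq_0_iff_dvd)
    ultimately have "ev X N \<notin> C.M"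
      using C.value_unique[of "ev X N" 0 "poly N x"] by auto
    then have invN: "inverse (ev X N) \<in> C.R" "ev X N \<noteq> 0"
      using ev_mem C.inverse_mem C.M_zero by auto
    \<comment> \<open>The norm of the numerator contains x - x0 exactly k times, and x - x0 is a
      unit times \<open>t ^ ramification x y\<close>; hence f is divisible by at most e factors
      t.\<close>
    define e where "e = ramification x y * k"
    have key: "f * (eval2 con X Y q * c) = g ^ k * t ^ e * ev X N"
    proof -
      have "f * (eval2 con X Y q * c) = ev X (norm_poly A B)"
        unfolding ev_norm_poly pq(3) AB c_def using pq(2) by simp
      also have "\<dots> = (X - con x) ^ k * ev X N"
        unfolding N(1) by (simp add: ev_mult ev_power hom_simps)
      finally show ?thesis unfolding g(4) by (simp add: e_def power_mult_distrib power_mult)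
    qed
    have "f / t ^ Suc e \<notin> C.R"
    proof
      assume "f / t ^ Suc e \<in> C.R"
      then have "f / t ^ Suc e * (eval2 con X Y q * c) * inverse (ev X N) * inverse g ^ k \<in> C.R"
        using invN g \<open>c \<in> C.R\<close> by (intro C.R_mult C.R_power C.poly_mem) auto
      also have "f / t ^ Suc e * (eval2 con X Y q * c) * inverse (ev X N) * inverse g ^ k
        = (f * (eval2 con X Y q * c)) / t ^ Suc e * inverse (ev X N) * inverse g ^ k"
        by simp
      also have "\<dots> = inverse t"
        unfolding key using t(2) g(3) invN(2) by (simp add: field_simps)
      finally show False using inv_t by simp
    qed
    then show "\<exists>n. f / t ^ n \<notin> C.R" by blast
  qed (use t in auto)
  then show ?thesis by (simp add: R t_def)
qed


subsection \<open>The point at infinity\<close>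

text \<open>Twice the degree, because x has a double pole at infinity. The clause p = 0 gives the
  zero polynomial order minus infinity, in spite of \<open>degree 0 = 0\<close>.\<close>

definition twice_degree_le :: "'c poly \<Rightarrow> int \<Rightarrow> bool" where
  "twice_degree_le p n \<longleftrightarrow> p = 0 \<or> 2 * int (degree p) \<le> n"

lemma twice_degree_le_mono: "twice_degree_le p n \<Longrightarrow> n \<le> m \<Longrightarrow> twice_degree_le p m"
  by (auto simp: twice_degree_le_def)

lemma twice_degree_le_add:
  assumes "twice_degree_le p n" "twice_degree_le q n" shows "twice_degree_le (p + q) n"
  using assms degree_add_le_max[of p q] by (auto simp: twice_degree_le_def)

lemma twice_degree_le_mult:
  assumes "twice_degree_le p n" "twice_degree_le q m" shows "twice_degree_le (p * q) (n + m)"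
proof (cases "p = 0 \<or> q = 0")
  case False
  then show ?thesis using assms by (simp add: twice_degree_le_def degree_mult_eq)
qed (auto simp: twice_degree_le_def)

lemma twice_degree_le_minus: "twice_degree_le (- p) n \<longleftrightarrow> twice_degree_le p n"
  by (simp add: twice_degree_le_def)

text \<open>\<open>A(x) + B(x) y\<close> has a pole of order \<open>max (2 deg A) (2 deg B + 3)\<close> at infinity.\<close>

definition pole_le :: "'k \<Rightarrow> int \<Rightarrow> bool" where
  "pole_le f n \<longleftrightarrow> (\<exists>A B D. D \<noteq> 0 \<and> f = (ev X A + Y * ev X B) / ev X D \<and>
     twice_degree_le A (n + 2 * int (degree D)) \<and> twice_degree_le B (n - 3 + 2 * int (degree D)))"

lemma pole_leI:
  assumes "D \<noteq> 0" "f = (ev X A + Y * ev X B) / ev X D"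
    "twice_degree_le A (n + 2 * int (degree D))" "twice_degree_le B (n - 3 + 2 * int (degree D))"
  shows "pole_le f n"
  using assms unfolding pole_le_def by blast

lemma pole_leE:
  assumes "pole_le f n"
  obtains A B D where "D \<noteq> 0" "f = (ev X A + Y * ev X B) / ev X D"
    "twice_degree_le A (n + 2 * int (degree D))" "twice_degree_le B (n - 3 + 2 * int (degree D))"
  using assms unfolding pole_le_def by blast

lemma pole_le_mono: assumes "pole_le f n" "n \<le> m" shows "pole_le f m"
  using assms(1)
proof (rule pole_leE)
  fix A B D
  assume "D \<noteq> 0" "f = (ev X A + Y * ev X B) / ev X D"
    "twice_degree_le A (n + 2 * int (degree D))" "twice_degree_le B (n - 3 + 2 * int (degree D))"
  then show ?thesis
    using assms(2) by (intro pole_leI[of D f A B]) (auto elim: twice_degree_le_mono)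
qed

lemma pole_le_const: "pole_le (con c) 0"
  by (rule pole_leI[of 1 _ "[:c:]" 0]) (simp_all add: twice_degree_le_def)

lemma pole_le_ex: "\<exists>n. pole_le f (int n)"
proof -
  obtain A B D where "D \<noteq> 0" "f = (ev X A + Y * ev X B) / ev X D"
    by (rule field_element)
  then have "pole_le f (int (2 * degree A + 2 * degree B + 3))"
    by (rule pole_leI) (auto simp: twice_degree_le_def)
  then show ?thesis ..
qed

lemma pole_le_add:
  assumes "pole_le f n" "pole_le g n" shows "pole_le (f + g) n"
proof -
  obtain A B D where f: "D \<noteq> 0" "f = (ev X A + Y * ev X B) / ev X D"
    "twice_degree_le A (n + 2 * int (degree D))" "twice_degree_le B (n - 3 + 2 * int (degree D))"
    using assms(1) by (rule pole_leE)
  obtain A' B' D' where g: "D' \<noteq> 0" "g = (ev X A' + Y * ev X B') / ev X D'"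
    "twice_degree_le A' (n + 2 * int (degree D'))" "twice_degree_le B' (n - 3 + 2 * int (degree D'))"
    using assms(2) by (rule pole_leE)
  have deg: "int (degree (D * D')) = int (degree D) + int (degree D')"
    using f(1) g(1) by (simp add: degree_mult_eq)
  have bound: "twice_degree_le (p * D' + p' * D) (c + 2 * int (degree (D * D')))"
    if "twice_degree_le p (c + 2 * int (degree D))" "twice_degree_le p' (c + 2 * int (degree D'))" for p p' c
  proof (rule twice_degree_le_add)
    have D: "twice_degree_le D (2 * int (degree D))" "twice_degree_le D' (2 * int (degree D'))"
      by (simp_all add: twice_degree_le_def)
    show "twice_degree_le (p * D') (c + 2 * int (degree (D * D')))"
      using twice_degree_le_mult[OF that(1) D(2)] unfolding deg by (simp add: add_ac)
    show "twice_degree_le (p' * D) (c + 2 * int (degree (D * D')))"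
      using twice_degree_le_mult[OF that(2) D(1)] unfolding deg by (simp add: add_ac)
  qed
  show ?thesis
  proof (rule pole_leI)
    show "D * D' \<noteq> 0" using f g by simp
    show "f + g = (ev X (A * D' + A' * D) + Y * ev X (B * D' + B' * D)) / ev X (D * D')"
      unfolding f(2) g(2) using f(1) g(1) by (simp add: ev_add ev_mult field_simps)
  qed (use bound f g in auto)
qed

lemma pole_le_mult:
  assumes "pole_le f n" "pole_le g m" shows "pole_le (f * g) (n + m)"
proof -
  obtain A B D where f: "D \<noteq> 0" "f = (ev X A + Y * ev X B) / ev X D"
    "twice_degree_le A (n + 2 * int (degree D))" "twice_degree_le B (n - 3 + 2 * int (degree D))"
    using assms(1) by (rule pole_leE)
  obtain A' B' D' where g: "D' \<noteq> 0" "g = (ev X A' + Y * ev X B') / ev X D'"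
    "twice_degree_le A' (m + 2 * int (degree D'))" "twice_degree_le B' (m - 3 + 2 * int (degree D'))"
    using assms(2) by (rule pole_leE)
  have deg: "int (degree (D * D')) = int (degree D) + int (degree D')"
    using f(1) g(1) by (simp add: degree_mult_eq)
  \<comment> \<open>Products are reduced by Y^2 = w - v Y. The pole orders 6 of w and 2 of v are
    absorbed by the 3 that is deducted in the bounds for both B and B'.\<close>
  define w where "w = [:a6 E, a4 E, a2 E, 1:]"
  define v where "v = [:a3 E, a1 E:]"
  have w: "twice_degree_le w 6" "ev X w = con (a6 E) + con (a4 E) * X + con (a2 E) * X\<^sup>2 + X ^ 3"
    and v: "twice_degree_le v 2" "ev X v = con (a3 E) + con (a1 E) * X"
    by (simp_all add: w_def v_def twice_degree_le_def hom_one algebra_simps power2_eq_square power3_eq_cube)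
  show ?thesis
  proof (rule pole_leI)
    show "D * D' \<noteq> 0" using f g by simp
    have "(ev X A + Y * ev X B) * (ev X A' + Y * ev X B') = ev X (A * A' + B * B' * w)
        + Y * ev X (A * B' + A' * B + - (B * B' * v))"
      unfolding ev_add ev_mult ev_minus w(2) v(2) using weierstrass by algebra
    then show "f * g = (ev X (A * A' + B * B' * w) + Y * ev X (A * B' + A' * B + - (B * B' * v)))
        / ev X (D * D')"
      unfolding f(2) g(2) by (simp add: ev_mult)
    show "twice_degree_le (A * A' + B * B' * w) (n + m + 2 * int (degree (D * D')))"
      unfolding deg
      by (rule twice_degree_le_add;
          rule twice_degree_le_mono[OF twice_degree_le_mult[OF f(3) g(3)]]
            twice_degree_le_mono[OF twice_degree_le_mult[OF twice_degree_le_mult[OF f(4) g(4)] w(1)]])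
        simp_all
    show "twice_degree_le (A * B' + A' * B + - (B * B' * v)) (n + m - 3 + 2 * int (degree (D * D')))"
      unfolding deg
    proof (intro twice_degree_le_add)
      show "twice_degree_le (A * B') (n + m - 3 + 2 * (int (degree D) + int (degree D')))"
        by (rule twice_degree_le_mono[OF twice_degree_le_mult[OF f(3) g(4)]]) simp
      show "twice_degree_le (A' * B) (n + m - 3 + 2 * (int (degree D) + int (degree D')))"
        by (rule twice_degree_le_mono[OF twice_degree_le_mult[OF g(3) f(4)]]) simp
      show "twice_degree_le (- (B * B' * v)) (n + m - 3 + 2 * (int (degree D) + int (degree D')))"
        unfolding twice_degree_le_minus
        by (rule twice_degree_le_mono[OF twice_degree_le_mult[OF twice_degree_le_mult[OF f(4) g(4)] v(1)]]) simp
    qed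
  qed
qed

text \<open>Coordinates with respect to 1 and y are unique, so the degree bounds known for one
  representation as a fraction pass to the polynomial one.\<close>

lemma pole_le_linear:
  assumes "pole_le (ev X A + Y * ev X B) n"
  shows "twice_degree_le A n" "twice_degree_le B (n - 3)"
  using assms
proof (atomize(full), rule pole_leE)
  fix A' B' D
  assume f: "D \<noteq> 0" "ev X A + Y * ev X B = (ev X A' + Y * ev X B') / ev X D"
    "twice_degree_le A' (n + 2 * int (degree D))" "twice_degree_le B' (n - 3 + 2 * int (degree D))"
  have "ev X (A * D - A') + Y * ev X (B * D - B') = 0"
    using f(1,2) by (simp add: ev_diff ev_mult field_simps)
  from linear_in_Y_eq_0[OF this] have AB: "A' = A * D" "B' = B * D"
    by simp_all
  have "twice_degree_le p k" if "twice_degree_le (p * D) (k + 2 * int (degree D))" for p k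
    using that f(1) by (cases "p = 0") (simp_all add: twice_degree_le_def degree_mult_eq)
  then show "twice_degree_le A n \<and> twice_degree_le B (n - 3)"
    using f(3,4) unfolding AB by blast
qed

lemma not_pole_le_neg_const: "c \<noteq> 0 \<Longrightarrow> n < 0 \<Longrightarrow> \<not> pole_le (con c) n"
  using pole_le_linear(1)[of "[:c:]" 0 n] by (auto simp: twice_degree_le_def)

text \<open>Since g - c vanishes at infinity, the identity 1/g = 1/c - (g - c)/(c g) improves a
  bound n + 1 for the pole of 1/g to n. Some bound exists, and it descends to 0.\<close>

lemma pole_le_inverse_unit:
  assumes "pole_le (g - con c) (- 1)" "c \<noteq> 0"
  shows "pole_le (inverse g) 0"
proof -
  have "g \<noteq> 0"
    using assms not_pole_le_neg_const[of "- c" "- 1"] by (auto simp: hom_minus)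
  then have g: "inverse g = con (inverse c) + con (- inverse c) * ((g - con c) * inverse g)"
    using assms(2) by (simp add: cst_simps field_simps)
  have "pole_le (inverse g) (int n) \<Longrightarrow> pole_le (inverse g) 0" for n
  proof (induction n)
    case (Suc n)
    have "pole_le ((g - con c) * inverse g) (int n)"
      using pole_le_mult[OF assms(1) Suc.prems] by simp
    then have "pole_le (con (- inverse c) * ((g - con c) * inverse g)) (int n)"
      using pole_le_mult[OF pole_le_const] by force
    then have "pole_le (inverse g) (int n)"
      by (subst g) (intro pole_le_add pole_le_mono[OF pole_le_const], simp_all)
    then show ?case by (rule Suc.IH)
  qed simp
  then show ?thesis using pole_le_ex by blast
qed

lemma X_nonzero: "X \<noteq> 0" and Y_nonzero: "Y \<noteq> 0"
  using X_minus_nonzero[of 0] Y_minus_nonzero[of 0] by simp_all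

text \<open>By the equation of the curve, y (y + a1 x + a3) is the cubic in x, so 1/y has the
  numerator y + a1 x + a3, of pole order 3, over a denominator of pole order 6.\<close>

lemma pole_le_Y_inverse: "pole_le (1 / Y) (- 3)" and pole_le_X_Y: "pole_le (X / Y) (- 1)"
proof -
  let ?w = "[:a6 E, a4 E, a2 E, 1:]"
  have w: "ev X ?w = Y * (con (a3 E) + con (a1 E) * X + Y)"
    using weierstrass by (simp add: hom_one) algebra
  have "ev X ?w \<noteq> 0" by (simp del: ev_pCons)
  then have 1: "1 / Y = (ev X [:a3 E, a1 E:] + Y * ev X 1) / ev X ?w"
    using Y_nonzero unfolding w by (simp add: hom_one field_simps)
  show "pole_le (1 / Y) (- 3)"
    by (rule pole_leI[OF _ 1]) (simp_all add: twice_degree_le_def)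
  have 2: "X / Y = (ev X ([:0, 1:] * [:a3 E, a1 E:]) + Y * ev X [:0, 1:]) / ev X ?w"
  proof -
    have "X / Y = X * ((ev X [:a3 E, a1 E:] + Y * ev X 1) / ev X ?w)"
      unfolding 1[symmetric] by simp
    then show ?thesis
      by (simp only: ev_mult) (simp add: hom_one algebra_simps)
  qed
  show "pole_le (X / Y) (- 1)"
    by (rule pole_leI[OF _ 2]) (simp_all add: twice_degree_le_def)
qed


lemma pole_le_if_value: assumes "pole_le (f - con c) (- 1)" shows "pole_le f 0"
proof -
  have "pole_le (f - con c) 0"
    using assms by (rule pole_le_mono) simp
  from pole_le_add[OF this pole_le_const[of c]] show ?thesis by simp
qed

lemma pole_le_eval2_infinity:
  "pole_le (eval2 con (X / Y) (1 / Y) p - con (eval2 id 0 0 p)) (- 1)"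
proof -
  have zero: "pole_le 0 (- 1)"
    using pole_leI[of 1 0 0 0 "- 1"] by (simp add: twice_degree_le_def)
  have univariate: "pole_le (ev (X / Y) a - con (poly a 0)) (- 1)" for a
  proof (induction a)
    case (pCons c a)
    have "pole_le (ev (X / Y) a) 0"
      by (rule pole_le_if_value[OF pCons.IH])
    from pole_le_mult[OF pole_le_X_Y this] show ?case by simp
  qed (simp add: zero)
  show ?thesis
  proof (induction p)
    case 0
    have "pole_le (eval2 con (X / Y) (1 / Y) 0 - con (eval2 id 0 0 0)) (- 1)"
      by (simp add: zero)
    then show ?case .
  next
    case (pCons a p)
    have "pole_le (eval2 con (X / Y) (1 / Y) p) 0"
      by (rule pole_le_if_value[OF pCons.IH])
    from pole_le_mult[OF pole_le_Y_inverse this]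
    have "pole_le (1 / Y * eval2 con (X / Y) (1 / Y) p) (- 1)"
      by (rule pole_le_mono) simp_all
    from pole_le_add[OF univariate this, of a]
    have "pole_le (eval2 con (X / Y) (1 / Y) (pCons a p) - con (eval2 id 0 0 (pCons a p))) (- 1)"
      by (simp add: algebra_simps)
    then show ?case .
  qed
qed

text \<open>A polynomial in x/y and 1/y differs from its value at the origin by a function vanishing
  at infinity, and a nonzero constant does not vanish there. So the relations between the two
  coordinates need not be determined.\<close>

lemma chart_Infinity: "chart con (X / Y) (1 / Y) 0 0"
proof
  fix p assume "eval2 con (X / Y) (1 / Y) p = 0"
  then have "pole_le (con (- eval2 id 0 0 p)) (- 1)"
    using pole_le_eval2_infinity[of p] by (simp add: hom_minus)
  then show "eval2 id 0 0 p = 0"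
    using not_pole_le_neg_const[of "- eval2 id 0 0 p" "- 1"] by auto
qed

lemma local_ring_Infinity: "local_ring E Infinity = chart.R con (X / Y) (1 / Y) 0 0"
  unfolding local_ring.simps chart.R_def[OF chart_Infinity] ..

lemma pole_le_local_ring_Infinity:
  assumes "f \<in> local_ring E Infinity" shows "pole_le f 0"
proof -
  interpret C: chart con "X / Y" "1 / Y" 0 0 by (rule chart_Infinity)
  obtain p q where pq: "eval2 id 0 0 q \<noteq> 0" "eval2 con (X / Y) (1 / Y) q \<noteq> 0"
    "f = eval2 con (X / Y) (1 / Y) p / eval2 con (X / Y) (1 / Y) q"
    using assms C.R_E unfolding local_ring_Infinity by metis
  have "pole_le (eval2 con (X / Y) (1 / Y) p) 0"
    by (rule pole_le_if_value[OF pole_le_eval2_infinity])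
  moreover have "pole_le (inverse (eval2 con (X / Y) (1 / Y) q)) 0"
    by (rule pole_le_inverse_unit[OF pole_le_eval2_infinity pq(1)])
  ultimately show ?thesis
    using pole_le_mult by (fastforce simp: pq(3) divide_inverse)
qed

text \<open>In the coordinates \<open>z = x / y\<close>, \<open>w = 1 / y\<close> the curve is \<open>w u = z^3\<close> with the following
  \<open>u\<close>, which takes the value \<open>1\<close> at infinity.\<close>

definition infinity_unit :: 'k where
  "infinity_unit = 1 + con (a1 E) * (X / Y) + con (a3 E) * (1 / Y) - con (a2 E) * (X / Y)\<^sup>2
     - con (a4 E) * ((X / Y) * (1 / Y)) - con (a6 E) * (1 / Y)\<^sup>2"

lemma infinity_equation: "1 / Y * infinity_unit = (X / Y) ^ 3"
proof -
  have "Y ^ 3 * (1 / Y * infinity_unit) = X ^ 3"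
    using weierstrass Y_nonzero unfolding infinity_unit_def
    by (simp add: field_simps power2_eq_square power3_eq_cube)
  then show ?thesis
    using Y_nonzero by (simp add: field_simps power_divide)
qed

lemma infinity_unit_mem: "infinity_unit \<in> local_ring E Infinity" 
  and infinity_unit_inverse_mem: "inverse infinity_unit \<in> local_ring E Infinity"
  and infinity_unit_nonzero: "infinity_unit \<noteq> 0"
proof -
  interpret C: chart con "X / Y" "1 / Y" 0 0 by (rule chart_Infinity)
  have z: "X / Y \<in> C.M" and w: "1 / Y \<in> C.M"
    using C.coord_value by simp_all
  have "infinity_unit - con (1 + 0 + 0 - 0 - 0 - 0) \<in> C.M"
    unfolding infinity_unit_def
    by (subst (1) hom_one[symmetric], intro C.value_add C.value_diff C.value_const)
      (simp_all only: hom_zero diff_0_right power2_eq_square,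
        (intro C.M_mult_left[OF C.const_mem] C.M_mult[OF _ C.M_subset] z w)+)
  then have u: "infinity_unit - con 1 \<in> C.M"
    by (simp only: add_0_right diff_0_right)
  then have "infinity_unit \<notin> C.M"
    using C.value_unique[of infinity_unit 0 1] by auto
  then show "infinity_unit \<in> local_ring E Infinity"
    "inverse infinity_unit \<in> local_ring E Infinity" "infinity_unit \<noteq> 0"
    using C.mem_R_if_value[OF u] C.inverse_mem C.M_zero unfolding local_ring_Infinity by auto
qed

lemma Y_inverse_eq: "1 / Y = inverse infinity_unit * (X / Y) ^ 3"
  unfolding infinity_equation[symmetric] using infinity_unit_nonzero by (simp add: field_simps)

lemma dvr_Infinity: "dvr (local_ring E Infinity) (X / Y)"
proof -
  interpret C: chart con "X / Y" "1 / Y" 0 0 by (rule chart_Infinity)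
  have mem: "inverse infinity_unit \<in> C.R"
    using infinity_unit_inverse_mem by (simp add: local_ring_Infinity)
  have nz: "X / Y \<noteq> 0" using X_nonzero Y_nonzero by simp
  have "dvr C.R (X / Y)"
  proof (rule C.dvrI)
    show "X / Y \<in> C.M" using C.coord_value(1) by simp
    show "X / Y \<noteq> 0" by (rule nz)
    show "(X / Y - con 0) / (X / Y) \<in> C.R" using nz C.R_one by simp
    have "(1 / Y) / (X / Y) = inverse infinity_unit * (X / Y)\<^sup>2"
      unfolding Y_inverse_eq using nz by
        (simp add: power3_eq_cube power2_eq_square del: divide_divide_eq_left
          divide_divide_eq_right times_divide_eq_right times_divide_eq_left)
    also have "\<dots> \<in> C.R"
      by (intro C.R_mult C.R_power mem C.coord_mem)
    finally show "(1 / Y - con 0) / (X / Y) \<in> C.R" by simp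
  next
    \<comment> \<open>The fraction field of the local ring inside the function field; it contains X
      = (x/y) / (1/y) and Y = 1 / (1/y), hence everything.\<close>
    define Q where "Q = {p / q | p q. p \<in> C.R \<and> q \<in> C.R \<and> q \<noteq> 0}"
    have Q_add: "f + g \<in> Q" and Q_mult: "f * g \<in> Q" if "f \<in> Q" "g \<in> Q" for f g
    proof -
      obtain p q p' q' where "p \<in> C.R" "q \<in> C.R" "q \<noteq> 0" "p' \<in> C.R" "q' \<in> C.R" "q' \<noteq> 0"
        "f = p / q" "g = p' / q'"
        using \<open>f \<in> Q\<close> \<open>g \<in> Q\<close> unfolding Q_def by blast
      then have "p * q' + p' * q \<in> C.R" "q * q' \<in> C.R" "p * p' \<in> C.R" "q * q' \<noteq> 0"
        "f + g = (p * q' + p' * q) / (q * q')" "f * g = (p * p') / (q * q')"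
        by (simp_all add: C.R_add C.R_mult add_frac_eq)
      then show "f + g \<in> Q" "f * g \<in> Q" unfolding Q_def by blast+
    qed
    have Q_R: "f \<in> Q" if "f \<in> C.R" for f
      unfolding Q_def using that C.R_one by force
    have w: "1 / Y \<in> C.R" "1 / Y \<noteq> 0" using C.coord_mem Y_nonzero by auto
    have "1 / (1 / Y) \<in> Q" "(X / Y) / (1 / Y) \<in> Q"
      unfolding Q_def using w C.R_one C.coord_mem(1) by blast+
    then have XY: "X \<in> Q" "Y \<in> Q" using Y_nonzero by simp_all
    have "ev X a \<in> Q" for a
      by (induction a) (use Q_R[OF C.const_mem] Q_R[OF C.R_zero] XY in \<open>auto intro: Q_add Q_mult\<close>)
    then have Q_poly: "eval2 con X Y p \<in> Q" for p
      by (induction p) (use Q_R[OF C.R_zero] XY in \<open>auto intro: Q_add Q_mult\<close>)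
    fix f :: 'k assume "f \<noteq> 0"
    obtain p q where pq: "eval2 con X Y q \<noteq> 0" "f = eval2 con X Y p / eval2 con X Y q"
      by (rule fraction)
    obtain r s r' s' where "r \<in> C.R" "s \<in> C.R" "s \<noteq> 0" "r' \<in> C.R" "s' \<in> C.R" "s' \<noteq> 0"
      "eval2 con X Y p = r / s" "eval2 con X Y q = r' / s'"
      using Q_poly[of p] Q_poly[of q] unfolding Q_def by blast
    then have "r * s' \<in> C.R" "s * r' \<in> C.R" "f = (r * s') / (s * r')" "s * r' \<noteq> 0"
      using pq by (auto simp: C.R_mult)
    then show "\<exists>p\<in>C.R. \<exists>q\<in>C.R. p \<noteq> 0 \<and> q \<noteq> 0 \<and> f = p / q"
      using \<open>f \<noteq> 0\<close> by (metis divide_eq_0_iff)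
  next
    fix f assume f: "f \<in> C.R" "f \<noteq> 0"
    \<comment> \<open>A pole bound for 1/f limits the zero of f: if f were divisible by the power m
      + 1 of x/y, the product of f and 1/f would vanish at infinity.\<close>
    obtain m where m: "pole_le (inverse f) (int m)"
      using pole_le_ex by blast
    have "f / (X / Y) ^ Suc m \<notin> C.R"
    proof
      assume "f / (X / Y) ^ Suc m \<in> C.R"
      then have 1: "pole_le (f / (X / Y) ^ Suc m) 0"
        by (intro pole_le_local_ring_Infinity) (simp add: local_ring_Infinity)
      have "pole_le ((X / Y) ^ k) (- int k)" for k
      proof (induction k)
        case 0
        show ?case using pole_le_const[of 1] by (simp add: hom_one)
      next
        case (Suc k)
        from pole_le_mult[OF pole_le_X_Y this] show ?case by simp
      qed
      from pole_le_mult[OF pole_le_mult[OF 1 this[of "Suc m"]] m]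
      have "pole_le (f / (X / Y) ^ Suc m * (X / Y) ^ Suc m * inverse f) (- 1)"
        by simp
      also have "f / (X / Y) ^ Suc m * (X / Y) ^ Suc m * inverse f = con 1"
        using f(2) nz by (simp only: hom_one nonzero_eq_divide_eq power_not_zero) simp
      finally have "pole_le (con 1) (- 1)" .
      then show False using not_pole_le_neg_const[of 1 "- 1"] by simp
    qed
    then show "\<exists>n. f / (X / Y) ^ n \<notin> C.R" by blast
  qed
  then show ?thesis by (simp add: local_ring_Infinity)
qed


subsection \<open>Divisors of lines\<close>

text \<open>Hides which chart is used, so that facts about values are proved once for affine points
  and for infinity.\<close>

lemma chart_ex:
  assumes "on_curve E P"
  obtains u v x y where "chart con u v x y" "local_ring E P = chart.R con u v x y"
proof (cases P)
  case Infinity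
  show ?thesis
    using that[OF chart_Infinity] by (simp add: Infinity local_ring_Infinity)
next
  case (Affine x y)
  show ?thesis
    using that[of X Y x y] assms unfolding Affine by (simp add: chart_Affine local_ring_Affine)
qed

lemma dvr_ex: assumes "on_curve E P" obtains t where "dvr (local_ring E P) t"
  using assms by (cases P) (auto intro: that dvr_Infinity dest: dvr_Affine)

section \<open>Arithmetic of the valuations\<close>

lemma valuation_mult:
  assumes "on_curve E P" "f \<noteq> 0" "g \<noteq> 0"
  shows "valuation E P (f * g) = valuation E P f + valuation E P g"
proof -
  obtain t where "dvr (local_ring E P) t" using dvr_ex[OF assms(1)] .
  then interpret dvr "local_ring E P" t .
  show ?thesis using assms by (simp add: valuation_eq_ord[OF refl] ord_mult)
qed

lemma valuation_inverse:
  assumes "on_curve E P" shows "valuation E P (inverse f) = - valuation E P f"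
proof (cases "f = 0")
  case False
  obtain t where "dvr (local_ring E P) t" using dvr_ex[OF assms(1)] .
  then interpret dvr "local_ring E P" t .
  show ?thesis using assms False by (simp add: valuation_eq_ord[OF refl] ord_inverse)
qed (simp add: valuation_def)

lemma valuation_divide:
  assumes "on_curve E P" "f \<noteq> 0" "g \<noteq> 0"
  shows "valuation E P (f / g) = valuation E P f - valuation E P g"
  using valuation_mult[OF assms(1,2), of "inverse g"] valuation_inverse[OF assms(1), of g] assms(3)
  by (simp add: divide_inverse)

lemma mem_local_ring_iff:
  assumes "on_curve E P" "f \<noteq> 0" shows "f \<in> local_ring E P \<longleftrightarrow> valuation E P f \<ge> 0"
proof -
  obtain t where "dvr (local_ring E P) t" using dvr_ex[OF assms(1)] .
  then interpret dvr "local_ring E P" t .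
  show ?thesis using assms by (simp add: valuation_eq_ord[OF refl] mem_iff)
qed

lemma valuation_eq_0_iff:
  assumes "on_curve E P" "f \<noteq> 0"
  shows "valuation E P f = 0 \<longleftrightarrow> f \<in> local_ring E P \<and> inverse f \<in> local_ring E P"
  using mem_local_ring_iff[OF assms] mem_local_ring_iff[OF assms(1), of "inverse f"]
    valuation_inverse[OF assms(1), of f] assms(2) by auto

lemma valuation_const:
  assumes "on_curve E P" shows "valuation E P (con c) = 0"
proof (cases "c = 0")
  case False
  obtain u v x y where C: "chart con u v x y" "local_ring E P = chart.R con u v x y"
    using chart_ex[OF assms] .
  then show ?thesis
    using valuation_eq_0_iff[OF assms, of "con c"] False chart.const_mem[OF C(1)]
    by (simp add: cst_inverse[symmetric])
qed (simp add: valuation_def)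

lemma valuation_pos_iff:
  assumes "chart con u v x y" "local_ring E P = chart.R con u v x y" "on_curve E P" "f \<noteq> 0"
  shows "valuation E P f > 0 \<longleftrightarrow> f \<in> chart.M con u v x y"
proof -
  interpret C: chart con u v x y by fact
  show ?thesis
    using mem_local_ring_iff[OF assms(3,4)] valuation_eq_0_iff[OF assms(3,4)]
      C.inverse_mem[of f] C.inverse_notin[of f] C.M_subset[of f] assms(4)
    unfolding assms(2) by force
qed

lemma valuation_unit_value:
  assumes "chart con u v x y" "local_ring E P = chart.R con u v x y" "on_curve E P"
    "f - con c \<in> chart.M con u v x y" "c \<noteq> 0"
  shows "valuation E P f = 0" "f \<noteq> 0"
proof -
  interpret C: chart con u v x y by fact
  have notin: "f \<notin> C.M"
    using C.value_unique[of f c 0] assms by auto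
  then show nz: "f \<noteq> 0" using C.M_zero by auto
  show "valuation E P f = 0"
    using valuation_pos_iff[OF assms(1-3) nz] mem_local_ring_iff[OF assms(3) nz]
      C.mem_R_if_value[OF assms(4)] notin unfolding assms(2) by simp
qed

lemma valuation_uniformizer:
  assumes "dvr (local_ring E P) t" shows "valuation E P t = 1"
proof -
  interpret dvr "local_ring E P" t by fact
  show ?thesis using valuation_eq_ord[OF refl t_nonzero] ord_t by simp
qed

lemma valuation_power:
  assumes "on_curve E P" "f \<noteq> 0" shows "valuation E P (f ^ n) = int n * valuation E P f"
proof (induction n)
  case 0
  show ?case using valuation_const[OF assms(1), of 1] by (simp add: hom_one)
next
  case (Suc n)
  then show ?case using valuation_mult[OF assms(1,2), of "f ^ n"] assms(2) by (simp add: algebra_simps)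
qed

lemma valuation_powi:
  assumes "on_curve E P" "f \<noteq> 0" shows "valuation E P (f powi n) = n * valuation E P f"
  using valuation_power[OF assms] valuation_inverse[OF assms(1)]
  by (auto simp: power_int_def power_inverse)

lemma valuation_prod:
  assumes "on_curve E P" "\<And>i. i \<in> A \<Longrightarrow> f i \<noteq> 0"
  shows "valuation E P (prod f A) = (\<Sum>i\<in>A. valuation E P (f i))"
  using assms(2)
proof (induction A rule: infinite_finite_induct)
  case (insert i A)
  then show ?case using valuation_mult[OF assms(1), of "f i" "prod f A"] by simp
qed (use valuation_const[OF assms(1), of 1] in \<open>simp_all add: hom_one\<close>)


section \<open>Zeros and poles of vertical and other lines\<close>

fun neg_point :: "'c point \<Rightarrow> 'c point" where
  "neg_point Infinity = Infinity"
| "neg_point (Affine x y) = Affine x (- y - a1 E * x - a3 E)"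

lemma on_curve_neg_point: "on_curve E P \<Longrightarrow> on_curve E (neg_point P)"
proof (cases P)
  case (Affine x y)
  assume "on_curve E P"
  then show ?thesis
    unfolding Affine neg_point.simps on_curve_Affine by algebra
qed simp

lemma neg_point_neg_point [simp]: "neg_point (neg_point P) = P"
  by (cases P) simp_all

lemma same_x:
  assumes "on_curve E (Affine x y)" "on_curve E (Affine x y')"
  shows "y' = y \<or> y' = - y - a1 E * x - a3 E"
proof -
  have "(y' - y) * (y' - (- y - a1 E * x - a3 E)) = 0"
    using assms unfolding on_curve_Affine by algebra
  then show ?thesis by simp
qed

lemma on_curve_cases:
  assumes "on_curve E R"
  obtains "R = Infinity" | x y where "R = Affine x y" "on_curve E (Affine x y)"
  using assms by (cases R) auto

text \<open>The uniformizer is x/y, and \<open>infinity_equation\<close> gives 1/y the order 3;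
  hence y has order -3 and x has order -2. The lower terms do not matter: X - c is X times 1 - c/X,
  a function with value 1, and likewise for lines.\<close>

lemma valuation_coordinates_Infinity:
  "valuation E Infinity (X - con c) = - 2" "valuation E Infinity (Y - con l * X - con m) = - 3"
proof -
  interpret C: chart con "X / Y" "1 / Y" 0 0 by (rule chart_Infinity)
  have on: "on_curve E Infinity" by simp
  note unit = valuation_unit_value[OF chart_Infinity local_ring_Infinity on]
  have z: "valuation E Infinity (X / Y) = 1"
    by (rule valuation_uniformizer[OF dvr_Infinity])
  have znz: "X / Y \<noteq> 0" using X_nonzero Y_nonzero by simp
  have "valuation E Infinity infinity_unit = 0"
    using valuation_eq_0_iff[OF on infinity_unit_nonzero] infinity_unit_mem infinity_unit_inverse_mem by simp
  then have "valuation E Infinity ((X / Y) ^ 3) = valuation E Infinity (1 / Y)"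
    unfolding infinity_equation[symmetric]
    using valuation_mult[OF on, of "1 / Y" infinity_unit] infinity_unit_nonzero Y_nonzero by simp
  then have w: "valuation E Infinity (1 / Y) = 3"
    using valuation_power[OF on znz, of 3] z by simp
  then have vY: "valuation E Infinity Y = - 3"
    using valuation_inverse[OF on, of Y] by (simp add: divide_inverse)
  have vX: "valuation E Infinity X = - 2"
    using z vY valuation_divide[OF on X_nonzero Y_nonzero] by simp
  have zM: "X / Y \<in> C.M" and wM: "1 / Y \<in> C.M"
    using C.coord_value by simp_all
  have "1 / X \<in> C.M"
    using valuation_pos_iff[OF chart_Infinity local_ring_Infinity on, of "1 / X"] X_nonzero vX
      valuation_inverse[OF on, of X] by (simp add: divide_inverse)
  then have "(1 - con c * (1 / X)) - con (1 - 0) \<in> C.M"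
    unfolding hom_diff hom_one hom_zero using C.M_minus[OF C.M_mult_left[OF C.const_mem, of "1 / X" c]] by simp
  then have "valuation E Infinity (1 - con c * (1 / X)) = 0" "1 - con c * (1 / X) \<noteq> 0"
    by (rule unit; simp)+
  then have "valuation E Infinity (X * (1 - con c * (1 / X))) = - 2"
    using valuation_mult[OF on X_nonzero] vX by simp
  also have "X * (1 - con c * (1 / X)) = X - con c"
    using X_nonzero by (simp add: field_simps)
  finally show "valuation E Infinity (X - con c) = - 2" .
  have "(1 - con l * (X / Y) - con m * (1 / Y)) - con (1 - 0 - 0) \<in> C.M"
    unfolding hom_diff hom_one hom_zero
    using C.M_minus[OF C.M_add[OF C.M_mult_left[OF C.const_mem zM] C.M_mult_left[OF C.const_mem wM]]]
    by simp
  then have "valuation E Infinity (1 - con l * (X / Y) - con m * (1 / Y)) = 0"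
    "1 - con l * (X / Y) - con m * (1 / Y) \<noteq> 0"
    by (rule unit; simp)+
  then have "valuation E Infinity (Y * (1 - con l * (X / Y) - con m * (1 / Y))) = - 3"
    using valuation_mult[OF on Y_nonzero] vY by simp
  also have "Y * (1 - con l * (X / Y) - con m * (1 / Y)) = Y - con l * X - con m"
    using Y_nonzero by (simp add: field_simps)
  finally show "valuation E Infinity (Y - con l * X - con m) = - 3" .
qed

lemma valuation_X_minus_Affine:
  assumes P: "on_curve E (Affine x y)"
  shows "valuation E (Affine x y) (X - con c) = (if c = x then int (ramification x y) else 0)"
proof -
  interpret C: chart con X Y x y by (rule chart_Affine[OF P])
  interpret D: dvr "local_ring E (Affine x y)" "chart_uniformizer x y" by (rule dvr_Affine[OF P])
  show ?thesis
  proof (cases "c = x")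
    case True
    obtain g where g: "g \<in> local_ring E (Affine x y)" "inverse g \<in> local_ring E (Affine x y)" "g \<noteq> 0"
      "X - con x = g * chart_uniformizer x y ^ ramification x y"
      using uniformizer_coordinates(4)[OF P] by blast
    then show ?thesis
      using True D.valuation_eq_ord[OF refl X_minus_nonzero[of x]]
        D.ordI[of g "X - con x" "int (ramification x y)"] by simp
  next
    case False
    have "X - con c - con (x - c) \<in> C.M"
      using C.coord_value by (simp add: hom_diff)
    from valuation_unit_value(1)[OF chart_Affine[OF P] local_ring_Affine[OF P] P this] False
    show ?thesis by simp
  qed
qed

text \<open>Where the affine point is its own negative, the first two indicators coincide and add up
  to the ramification index 2.\<close>

lemma valuation_X_minus:
  assumes R: "on_curve E R" and P: "on_curve E (Affine x y)"
  shows "valuation E R (X - con x) = of_bool (R = Affine x y) + of_bool (R = neg_point (Affine x y))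
    - 2 * of_bool (R = Infinity)"
  using R
proof (cases R rule: on_curve_cases)
  case 1
  then show ?thesis by (simp add: valuation_coordinates_Infinity)
next
  case (2 x0 y0)
  show ?thesis
  proof (cases "x = x0")
    case True
    have y0: "y0 = y \<or> y0 = - y - a1 E * x - a3 E"
      using same_x[OF P] 2(2) True by blast
    have "2 * y0 + a1 E * x0 + a3 E = 0 \<longleftrightarrow> y = - y - a1 E * x - a3 E"
    proof -
      from y0 have "2 * y0 + a1 E * x + a3 E = 2 * y + a1 E * x + a3 E
          \<or> 2 * y0 + a1 E * x + a3 E = - (2 * y + a1 E * x + a3 E)"
        by (elim disjE) (simp, algebra)
      moreover have "y = - y - a1 E * x - a3 E \<longleftrightarrow> 2 * y + a1 E * x + a3 E = 0"
        by (intro iffI; algebra)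
      ultimately show ?thesis
        unfolding True by (metis neg_equal_0_iff_equal)
    qed
    then show ?thesis
      using y0 True by (auto simp: 2(1) valuation_X_minus_Affine[OF 2(2)] ramification_def)
  next
    case False
    then show ?thesis by (auto simp: 2(1) valuation_X_minus_Affine[OF 2(2)])
  qed
qed

text \<open>Here t = y - y0 is a uniformizer and x - x0 = g t^2, so the line is t (1 + k g t), and
  the second factor has value 1.\<close>

lemma valuation_line_ramified:
  assumes P: "on_curve E (Affine x y)" and ram: "2 * y + a1 E * x + a3 E = 0"
  shows "valuation E (Affine x y) ((Y - con y) + con k * (X - con x)) = 1"
proof -
  interpret C: chart con X Y x y by (rule chart_Affine[OF P])
  let ?t = "Y - con y"
  have t: "chart_uniformizer x y = ?t" "ramification x y = 2"
    using ram by (simp_all add: chart_uniformizer_def ramification_def)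
  obtain g where g: "g \<in> C.R" "X - con x = g * ?t ^ 2"
    using uniformizer_coordinates(4)[OF P] unfolding t local_ring_Affine[OF P] by blast
  have "con k * g * ?t \<in> C.M"
    using g(1) C.coord_value by (intro C.M_mult_left C.R_mult C.const_mem) simp_all
  then have "1 + con k * g * ?t - con 1 \<in> C.M"
    by (simp add: hom_one)
  from valuation_unit_value[OF chart_Affine[OF P] local_ring_Affine[OF P] P this]
  have u: "valuation E (Affine x y) (1 + con k * g * ?t) = 0" "1 + con k * g * ?t \<noteq> 0"
    by simp_all
  have "?t + con k * (X - con x) = ?t * (1 + con k * g * ?t)"
    unfolding g(2) by (simp add: algebra_simps power2_eq_square)
  then show ?thesis
    using valuation_mult[OF P Y_minus_nonzero u(2)] u(1)
      valuation_uniformizer[OF dvr_Affine[OF P]] unfolding t by simp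
qed

text \<open>The second factor in \<open>eq\<close> is the line reflected by negation of points. At
  an unramified point of the line the reflected line is a unit, so the whole order of the product
  belongs to the line. At a ramified point both lines have order 1, and comparing orders shows that
  exactly one root is there.\<close>

lemma valuation_line:
  assumes R: "on_curve E R"
    and on: "on_curve E (Affine x1 (l * x1 + m))" "on_curve E (Affine x2 (l * x2 + m))"
      "on_curve E (Affine x3 (l * x3 + m))"
    and eq: "(X - con x1) * (X - con x2) * (X - con x3)
      = (Y - con l * X - con m) * (Y - con (- l - a1 E) * X - con (- m - a3 E))"
  shows "valuation E R (Y - con l * X - con m) = of_bool (R = Affine x1 (l * x1 + m))
    + of_bool (R = Affine x2 (l * x2 + m)) + of_bool (R = Affine x3 (l * x3 + m)) - 3 * of_bool (R = Infinity)"
  using R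
proof (cases R rule: on_curve_cases)
  case 1
  then show ?thesis by (simp add: valuation_coordinates_Infinity)
next
  case (2 x y)
  interpret C: chart con X Y x y by (rule chart_Affine[OF 2(2)])
  have unit: "valuation E R (Y - con l * X - con m) = 0" if "y - l * x - m \<noteq> 0" for l m
  proof -
    have "Y - con l * X - con m - con (y - l * x - m) \<in> C.M"
      by (intro C.value_diff C.value_mult C.value_const C.coord_value)
    from valuation_unit_value(1)[OF chart_Affine[OF 2(2)] local_ring_Affine[OF 2(2)] 2(2) this that]
    show ?thesis by (simp add: 2(1))
  qed
  show ?thesis
  proof (cases "y = l * x + m")
    case False
    then show ?thesis using unit[of l m] 2(1) by (auto simp: algebra_simps)
  next
    case True
    let ?n = "of_bool (x1 = x) + of_bool (x2 = x) + of_bool (x3 = x) :: int"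
    have "valuation E R (X - con x1) + valuation E R (X - con x2) + valuation E R (X - con x3)
        = valuation E R (Y - con l * X - con m)
          + valuation E R (Y - con (- l - a1 E) * X - con (- m - a3 E))"
      using arg_cong[OF eq, of "valuation E R"] X_minus_nonzero Y_minus_line_nonzero
      by (simp add: valuation_mult[OF R])
    then have sum: "int (ramification x y) * ?n = valuation E R (Y - con l * X - con m)
          + valuation E R (Y - con (- l - a1 E) * X - con (- m - a3 E))"
      by (auto simp: 2(1) valuation_X_minus_Affine[OF 2(2)])
    have "valuation E R (Y - con l * X - con m) = ?n"
    proof (cases "2 * y + a1 E * x + a3 E = 0")
      case False
      have "y - (- l - a1 E) * x - (- m - a3 E) = 2 * y + a1 E * x + a3 E"
        using True by algebra
      with False have "y - (- l - a1 E) * x - (- m - a3 E) \<noteq> 0"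
        by metis
      from sum unit[OF this] False show ?thesis
        by (simp add: ramification_def)
    next
      case ram: True
      have 1: "Y - con l * X - con m = (Y - con y) + con (- l) * (X - con x)"
        unfolding True hom_simps by algebra
      have "m + a3 E = - y - (l + a1 E) * x"
        using True ram by algebra
      then have m: "- m - a3 E = y + (l + a1 E) * x"
        by algebra
      have 2: "Y - con (- l - a1 E) * X - con (- m - a3 E) = (Y - con y) + con (l + a1 E) * (X - con x)"
        unfolding m hom_simps by algebra
      from sum show ?thesis
        unfolding 1 2 \<open>R = Affine x y\<close> valuation_line_ramified[OF \<open>on_curve E (Affine x y)\<close> ram]
        using ram by (simp add: ramification_def)
    qed
    then show ?thesis using True 2(1) by auto
  qed
qed


section \<open>Functions without poles\<close>

text \<open>Induction on the degree of the denominator D. Above a root x of D the numerator A + y B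
  vanishes at every point; once A(x) = B(x) = 0 is known, a linear factor cancels.\<close>

lemma regular_affine:
  assumes "\<And>x y. on_curve E (Affine x y) \<Longrightarrow> f \<in> local_ring E (Affine x y)"
  obtains A B where "f = ev X A + Y * ev X B"
proof -
  have "\<exists>A B. f = ev X A + Y * ev X B"
    if "D \<noteq> 0" "f = (ev X A + Y * ev X B) / ev X D" for A B D
    using that
  proof (induction "degree D" arbitrary: A B D)
    case 0
    then obtain d where d: "D = [:d:]" "d \<noteq> 0"
      by (metis degree_eq_zeroE pCons_eq_0_iff)
    have "f = ev X (smult (inverse d) A) + Y * ev X (smult (inverse d) B)"
      unfolding 0(3) d(1) using d(2) by (simp add: ev_smult cst_inverse add_divide_distrib divide_inverse algebra_simps)
    then show ?case by blast
  next
    case (Suc n)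
    obtain x where "poly D x = 0"
      using root_exists[of D] Suc(2) by auto
    then obtain D' where D: "D = [:- x, 1:] * D'"
      by (auto simp: poly_eq_0_iff_dvd elim: dvdE)
    have D': "D' \<noteq> 0" "degree D' = n"
      using Suc(2,3) unfolding D by (auto simp: degree_mult_eq simp del: mult_pCons_left)
    have evD: "ev X D = (X - con x) * ev X D'"
      unfolding D by (simp add: ev_mult hom_simps del: mult_pCons_left)
    have f: "f * ev X D' = (ev X A + Y * ev X B) / (X - con x)"
      unfolding Suc(4) evD using D' by simp
    obtain y where P: "on_curve E (Affine x y)"
      by (rule point_over)
    let ?y = "- y - a1 E * x - a3 E"
    have P': "on_curve E (Affine x ?y)"
      using on_curve_neg_point[OF P] by simp
    have reg: "(ev X A + Y * ev X B) / (X - con x) \<in> chart.R con X Y x y"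
      and zero: "poly A x + y * poly B x = 0" if P: "on_curve E (Affine x y)" for y
    proof -
      interpret C: chart con X Y x y by (rule chart_Affine[OF P])
      have "ev X D' \<in> C.R" using C.poly_mem[of "[:D':]"] by simp
      then show "(ev X A + Y * ev X B) / (X - con x) \<in> C.R"
        unfolding f[symmetric] using assms[OF P] unfolding local_ring_Affine[OF P] by (simp add: C.R_mult)
      then have "(X - con x) * ((ev X A + Y * ev X B) / (X - con x)) \<in> C.M"
        using C.coord_value by (intro C.M_mult) simp_all
      then have "eval2 con X Y [:A, B:] \<in> C.M"
        using X_minus_nonzero by simp
      moreover have "eval2 con X Y [:A, B:] - con (eval2 id x y [:A, B:]) \<in> C.M"
        using C.poly_M[of "[:A, B:] - [:[:eval2 id x y [:A, B:]:]:]"]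
        by (simp add: hom_simps ev_diff ev_minus id_hom.hom_simps algebra_simps)
      ultimately have "eval2 id x y [:A, B:] = 0"
        using C.value_unique[of "eval2 con X Y [:A, B:]" 0] by (metis diff_zero hom_zero)
      then show "poly A x + y * poly B x = 0" by simp
    qed
    \<comment> \<open>Two distinct points above x give two independent linear equations for A(x) and
      B(x).\<close>
    have "poly B x = 0"
    proof (cases "y = ?y")
      case False
      have "(y - ?y) * poly B x = 0"
        using zero[OF P] zero[OF P'] by algebra
      with False show ?thesis
        by (metis mult_eq_0_iff eq_iff_diff_eq_0)
    next
      \<comment> \<open>Only one point lies above x. If B(x) were nonzero, (y - y0) / (x - x0) would
        be regular there, but its order is 1 - 2.\<close>
      case True
      interpret C: chart con X Y x y by (rule chart_Affine[OF P])
      show ?thesis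
      proof (rule ccontr)
        assume B: "poly B x \<noteq> 0"
        obtain A' where A': "A - [:poly A x:] = [:- x, 1:] * A'"
          using poly_eq_0_iff_dvd[of "A - [:poly A x:]" x] by (auto elim: dvdE)
        obtain B' where B': "B - [:poly B x:] = [:- x, 1:] * B'"
          using poly_eq_0_iff_dvd[of "B - [:poly B x:]" x] by (auto elim: dvdE)
        have A: "ev X A = con (poly A x) + (X - con x) * ev X A'"
          using arg_cong[OF A', of "ev X"] unfolding ev_diff ev_mult
          by (simp add: hom_simps diff_eq_eq add.commute)
        have B2: "ev X B = con (poly B x) + (X - con x) * ev X B'"
          using arg_cong[OF B', of "ev X"] unfolding ev_diff ev_mult
          by (simp add: hom_simps diff_eq_eq add.commute)
        have pA: "con (poly A x) = - (con y * con (poly B x))"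
          using zero[OF P] by (metis hom_minus hom_mult eq_neg_iff_add_eq_0)
        have "ev X A + Y * ev X B = (X - con x) * (ev X A' + Y * ev X B') + con (poly B x) * (Y - con y)"
          unfolding A B2 pA by (simp add: algebra_simps)
        then have "(ev X A + Y * ev X B) / (X - con x)
            = (ev X A' + Y * ev X B') + con (poly B x) * ((Y - con y) / (X - con x))"
          using X_minus_nonzero[of x] by (simp add: field_simps)
        with reg[OF P] have "(ev X A' + Y * ev X B') + con (poly B x) * ((Y - con y) / (X - con x)) \<in> C.R"
          by simp
        moreover have "ev X A' + Y * ev X B' \<in> C.R"
          using C.poly_mem[of "[:A', B':]"] by simp
        ultimately have "con (poly B x) * ((Y - con y) / (X - con x)) \<in> C.R"
          using C.R_diff by fastforce
        then have "con (inverse (poly B x)) * (con (poly B x) * ((Y - con y) / (X - con x))) \<in> C.R"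
          by (rule C.R_mult[OF C.const_mem])
        also have "con (inverse (poly B x)) * (con (poly B x) * ((Y - con y) / (X - con x)))
            = (Y - con y) / (X - con x)"
          using B by (simp add: cst_inverse)
        finally have "(Y - con y) / (X - con x) \<in> local_ring E (Affine x y)"
          by (simp add: local_ring_Affine[OF P])
        moreover have ram: "2 * y + a1 E * x + a3 E = 0"
          using True by algebra
        ultimately show False
          using mem_local_ring_iff[OF P, of "(Y - con y) / (X - con x)"] Y_minus_nonzero[of y] X_minus_nonzero[of x]
            valuation_divide[OF P Y_minus_nonzero X_minus_nonzero, of y x]
            valuation_line_ramified[OF P ram, of 0] valuation_X_minus_Affine[OF P, of x]
          by (simp add: ramification_def)
      qed
    qed
    moreover from this have "poly A x = 0"
      using zero[OF P] by simp
    ultimately obtain A' B' where AB: "A = [:- x, 1:] * A'" "B = [:- x, 1:] * B'"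
      by (auto simp: poly_eq_0_iff_dvd elim!: dvdE)
    have evAB: "ev X A = (X - con x) * ev X A'" "ev X B = (X - con x) * ev X B'"
      unfolding AB by (simp_all add: ev_mult hom_simps del: mult_pCons_left)
    have "f = (X - con x) * (ev X A' + Y * ev X B') / ((X - con x) * ev X D')"
      unfolding Suc(4) evD evAB by (rule arg_cong[of _ _ "\<lambda>g. g / _"]) (simp add: algebra_simps)
    then have "f = (ev X A' + Y * ev X B') / ev X D'"
      using X_minus_nonzero by simp
    with Suc(1) D' show ?case by blast
  qed
  moreover obtain A B D where "D \<noteq> 0" "f = (ev X A + Y * ev X B) / ev X D"
    by (rule field_element)
  ultimately show thesis using that by blast
qed

text \<open>Multiplying by the n-th power of x/y makes f regular at infinity, where the bound 0 is
  known; y/x, whose pole is at most simple, restores f.\<close>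

lemma pole_le_valuation:
  assumes f: "f \<noteq> 0" and v: "valuation E Infinity f \<ge> - int n"
  shows "pole_le f (int n)"
proof -
  have on: "on_curve E Infinity" by simp
  have z: "X / Y \<noteq> 0" using X_nonzero Y_nonzero by simp
  have w: "valuation E Infinity (inverse (X / Y) ^ k) = - int k" for k
    using valuation_power[OF on, of "inverse (X / Y)" k] z valuation_inverse[OF on, of "X / Y"]
      valuation_uniformizer[OF dvr_Infinity] by simp
  have "valuation E Infinity (f / inverse (X / Y) ^ n) \<ge> 0"
    using valuation_divide[OF on f, of "inverse (X / Y) ^ n"] z w[of n] v by simp
  then have 1: "pole_le (f / inverse (X / Y) ^ n) 0"
    using mem_local_ring_iff[OF on, of "f / inverse (X / Y) ^ n"] f z
    by (intro pole_le_local_ring_Infinity) simp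
  have inv: "pole_le (inverse (X / Y)) 1"
    by (rule pole_leI[of "[:0, 1:]" _ 0 1]) (simp_all add: hom_one twice_degree_le_def)
  have "pole_le (inverse (X / Y) ^ k) (int k)" for k
  proof (induction k)
    case 0
    show ?case using pole_le_const[of 1] by (simp add: hom_one)
  next
    case (Suc k)
    from pole_le_mult[OF inv this] show ?case by simp
  qed
  from pole_le_mult[OF 1 this[of n]] show ?thesis
    using z by simp
qed

lemma regular_constant:
  assumes "\<And>P. on_curve E P \<Longrightarrow> f \<in> local_ring E P"
  obtains c where "f = con c"
proof -
  obtain A B where f: "f = ev X A + Y * ev X B"
    using regular_affine[of f] assms by blast
  have "pole_le f 0"
    using assms[of Infinity] by (intro pole_le_local_ring_Infinity) simp
  then have "degree A = 0" "B = 0"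
    using pole_le_linear[of A B 0] unfolding f by (auto simp: twice_degree_le_def)
  then obtain c where "A = [:c:]" by (auto elim: degree_eq_zeroE)
  with \<open>B = 0\<close> f that[of c] show thesis by simp
qed

text \<open>For functions regular elsewhere, the possible pole orders 2 deg A and 2 deg B + 3 at
  infinity skip 1; this is where genus one enters. A pole at an affine point is reduced to poles at
  infinity.\<close>

lemma no_simple_pole:
  assumes f: "f \<noteq> 0" and A: "on_curve E A" and B: "on_curve E B"
    and v: "\<And>R. on_curve E R \<Longrightarrow> valuation E R f = of_bool (R = A) - of_bool (R = B)"
  shows "A = B" and "\<exists>c. c \<noteq> 0 \<and> f = con c"
proof -
  have "\<exists>c. f = con c"
    using B
  proof (cases B rule: on_curve_cases)
    case 1
    have "f \<in> local_ring E (Affine x y)" if "on_curve E (Affine x y)" for x y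
      using mem_local_ring_iff[OF that f] v[OF that] 1 by simp
    then obtain A' B' where f': "f = ev X A' + Y * ev X B'"
      by (rule regular_affine) blast
    have "pole_le f (int 1)"
      using v[of Infinity] 1 by (intro pole_le_valuation f) simp
    then have "degree A' = 0" "B' = 0"
      using pole_le_linear[of A' B' 1] unfolding f' by (auto simp: twice_degree_le_def)
    then obtain c where "A' = [:c:]" by (auto elim: degree_eq_zeroE)
    with \<open>B' = 0\<close> f' show ?thesis by auto
  next
    case (2 x y)
    \<comment> \<open>Multiplying by x - x(B) trades the pole at B for a zero at -B and a double
      pole at infinity. The product is then a polynomial in x of degree at most 1 that vanishes at
      x(B), so it is a multiple of x - x(B).\<close>
    let ?g = "f * (X - con x)" and ?N = "Affine x (- y - a1 E * x - a3 E)"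
    have g: "?g \<noteq> 0" using f X_minus_nonzero by simp
    have vg: "valuation E R ?g = of_bool (R = A) + of_bool (R = ?N) - 2 * of_bool (R = Infinity)"
      if "on_curve E R" for R
      using valuation_mult[OF that f X_minus_nonzero] v[OF that] valuation_X_minus[OF that 2(2)] 2(1)
      by simp
    have "?g \<in> local_ring E (Affine x' y')" if "on_curve E (Affine x' y')" for x' y'
      using mem_local_ring_iff[OF that g] vg[OF that] by simp
    then obtain A' B' where g': "?g = ev X A' + Y * ev X B'"
      by (rule regular_affine) blast
    have "pole_le ?g (int 2)"
      using vg[of Infinity] by (intro pole_le_valuation g) simp
    then have deg: "degree A' \<le> 1" "B' = 0"
      using pole_le_linear[of A' B' 2] unfolding g' by (auto simp: twice_degree_le_def)
    have N: "on_curve E ?N" using on_curve_neg_point[OF 2(2)] by simp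
    interpret C: chart con X Y x "- y - a1 E * x - a3 E" by (rule chart_Affine[OF N])
    have "?g \<in> C.M"
      using valuation_pos_iff[OF chart_Affine[OF N] local_ring_Affine[OF N] N g] vg[OF N] by simp
    moreover have "ev X A' - con (poly A' x) \<in> C.M"
      using C.poly_M[of "[:A' - [:poly A' x:]:]"] by (simp add: ev_diff)
    ultimately have "poly A' x = 0"
      using C.value_unique[of "?g" 0 "poly A' x"] g' deg(2) by simp
    then obtain q where q: "A' = [:- x, 1:] * q"
      by (auto simp: poly_eq_0_iff_dvd elim: dvdE)
    then have "q = 0 \<or> degree q = 0"
      using deg(1) by (cases "q = 0") (simp_all add: degree_mult_eq del: mult_pCons_left)
    then obtain c where "q = [:c:]" by (auto elim: degree_eq_zeroE)
    then have "?g = (X - con x) * con c"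
      using g' deg(2) q by (simp add: ev_mult hom_simps algebra_simps del: mult_pCons_left)
    then have "f = con c" using X_minus_nonzero[of x] by simp
    then show ?thesis ..
  qed
  then obtain c where c: "f = con c" ..
  with f show "\<exists>c. c \<noteq> 0 \<and> f = con c" by auto
  show "A = B"
    using v[OF A] valuation_const[OF A, of c] c by (auto split: if_splits)
qed


section \<open>The group law\<close>

definition slope :: "'c \<Rightarrow> 'c \<Rightarrow> 'c \<Rightarrow> 'c \<Rightarrow> 'c" where
  "slope x1 y1 x2 y2 = (if x1 = x2
     then (3 * x1\<^sup>2 + 2 * a2 E * x1 + a4 E - a1 E * y1) / (2 * y1 + a1 E * x1 + a3 E)
     else (y2 - y1) / (x2 - x1))"

text \<open>Vieta's formulas for the cubic obtained by putting y = l x + m into the equation: x3 is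
  defined by the sum of the roots, and the other two symmetric functions have to be checked.\<close>

lemma line_through:
  assumes P: "on_curve E (Affine x1 y1)" and Q: "on_curve E (Affine x2 y2)"
    and nvert: "\<not> (x1 = x2 \<and> y1 + y2 + a1 E * x2 + a3 E = 0)"
  defines "l \<equiv> slope x1 y1 x2 y2"
  defines "m \<equiv> y1 - l * x1" and "x3 \<equiv> l\<^sup>2 + a1 E * l - a2 E - x1 - x2"
  shows "y1 = l * x1 + m" "y2 = l * x2 + m"
    and "point_add E (Affine x1 y1) (Affine x2 y2) = neg_point (Affine x3 (l * x3 + m))"
    and "on_curve E (Affine x3 (l * x3 + m))"
    and "(X - con x1) * (X - con x2) * (X - con x3)
      = (Y - con l * X - con m) * (Y - con (- l - a1 E) * X - con (- m - a3 E))"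
proof -
  show y1: "y1 = l * x1 + m" by (simp add: m_def)
  have "y2 = l * x2 + m \<and> x1 * x2 + x1 * x3 + x2 * x3 = a4 E - 2 * l * m - a1 E * m - a3 E * l
    \<and> x1 * x2 * x3 = m\<^sup>2 + a3 E * m - a6 E"
  proof (cases "x1 = x2")
    case True
    then have y2: "y2 = y1"
      using same_x[of x1 y1 y2] P Q nvert by (auto simp: algebra_simps)
    have "2 * y1 + a1 E * x1 + a3 E = y1 + y2 + a1 E * x2 + a3 E"
      unfolding y2 True by simp
    then have Fy: "2 * y1 + a1 E * x1 + a3 E \<noteq> 0"
      using nvert True by metis
    then have l: "l * (2 * y1 + a1 E * x1 + a3 E) = 3 * x1\<^sup>2 + 2 * a2 E * x1 + a4 E - a1 E * y1"
      using True by (simp add: l_def slope_def)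
    have e2: "x1 * x1 + x1 * x3 + x1 * x3 = a4 E - 2 * l * m - a1 E * m - a3 E * l"
      using l unfolding x3_def True[symmetric] y1 by algebra
    have "x1 * x1 * x3 = m\<^sup>2 + a3 E * m - a6 E"
      using P e2 unfolding on_curve_Affine x3_def True[symmetric] y1 by algebra
    with e2 y1 y2 True show ?thesis by simp
  next
    case False
    then have "l * (x2 - x1) = y2 - y1" by (simp add: l_def slope_def)
    then have y2: "y2 = l * x2 + m" by (simp add: m_def algebra_simps)
    \<comment> \<open>The difference of the curve equations at the two points; in the tangent case
      the formula for l supplies this coefficient.\<close>
    have "(x1 - x2) * (x1 * x2 + x1 * x3 + x2 * x3) = (x1 - x2) * (a4 E - 2 * l * m - a1 E * m - a3 E * l)"
      using P Q unfolding on_curve_Affine x3_def y1 y2 by algebra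
    then have e2: "x1 * x2 + x1 * x3 + x2 * x3 = a4 E - 2 * l * m - a1 E * m - a3 E * l"
      using False by simp
    have "x1 * x2 * x3 = m\<^sup>2 + a3 E * m - a6 E"
      using P e2 unfolding on_curve_Affine x3_def y1 by algebra
    with e2 y2 show ?thesis by simp
  qed
  then have y2: "y2 = l * x2 + m"
    and e2: "x1 * x2 + x1 * x3 + x2 * x3 = a4 E - 2 * l * m - a1 E * m - a3 E * l"
    and e3: "x1 * x2 * x3 = m\<^sup>2 + a3 E * m - a6 E" by blast+
  show "y2 = l * x2 + m" by (rule y2)
  have e1: "x1 + x2 + x3 = l\<^sup>2 + a1 E * l - a2 E" by (simp add: x3_def)
  have "(x3 - x1) * (x3 - x2) * (x3 - x3) = x3 ^ 3 + a2 E * x3\<^sup>2 + a4 E * x3 + a6 E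
      - ((l * x3 + m)\<^sup>2 + a1 E * x3 * (l * x3 + m) + a3 E * (l * x3 + m))"
    using e1 e2 e3 by algebra
  then show "on_curve E (Affine x3 (l * x3 + m))"
    unfolding on_curve_Affine by algebra
  have "con (x1 + x2 + x3) = con (l\<^sup>2 + a1 E * l - a2 E)"
    "con (x1 * x2 + x1 * x3 + x2 * x3) = con (a4 E - 2 * l * m - a1 E * m - a3 E * l)"
    "con (x1 * x2 * x3) = con (m\<^sup>2 + a3 E * m - a6 E)"
    using e1 e2 e3 by simp_all
  then show "(X - con x1) * (X - con x2) * (X - con x3)
      = (Y - con l * X - con m) * (Y - con (- l - a1 E) * X - con (- m - a3 E))"
    using weierstrass unfolding hom_simps by algebra
  show "point_add E (Affine x1 y1) (Affine x2 y2) = neg_point (Affine x3 (l * x3 + m))"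
    using nvert by (auto simp: Let_def x3_def l_def m_def slope_def algebra_simps)
qed

lemma point_add_closed:
  assumes "on_curve E P" "on_curve E Q" shows "on_curve E (point_add E P Q)"
proof (cases P)
  case (Affine x1 y1)
  show ?thesis
  proof (cases Q)
    case Q: (Affine x2 y2)
    show ?thesis
    proof (cases "x1 = x2 \<and> y1 + y2 + a1 E * x2 + a3 E = 0")
      case False
      from line_through(3,4)[OF _ _ this] assms show ?thesis
        unfolding Affine Q by (metis on_curve_neg_point)
    qed (simp add: Affine Q)
  qed (use assms Affine in simp)
qed (use assms in simp)

text \<open>The function with divisor \<open>[P] + [Q] - [P + Q] - [o]\<close>.\<close>

fun chord :: "'c point \<Rightarrow> 'c point \<Rightarrow> 'k" where
  "chord Infinity Q = 1"
| "chord (Affine x1 y1) Infinity = 1"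
| "chord (Affine x1 y1) (Affine x2 y2) =
     (if x1 = x2 \<and> y1 + y2 + a1 E * x2 + a3 E = 0 then X - con x1
      else let l = slope x1 y1 x2 y2
        in (Y - con l * X - con (y1 - l * x1)) / (X - con (l\<^sup>2 + a1 E * l - a2 E - x1 - x2)))"

lemma chord_nonzero: "chord P Q \<noteq> 0"
  by (cases "(P, Q)" rule: chord.cases)
    (simp_all add: Let_def X_minus_nonzero Y_minus_line_nonzero del: right_minus_eq)

text \<open>The line has a third zero at -(P + Q) and a triple pole at o. Division by the vertical
  line through P + Q cancels that zero, adds a pole at P + Q and leaves a simple pole at o.\<close>

lemma valuation_chord:
  assumes P: "on_curve E P" and Q: "on_curve E Q" and R: "on_curve E R"
  shows "valuation E R (chord P Q)
    = of_bool (R = P) + of_bool (R = Q) - of_bool (R = point_add E P Q) - of_bool (R = Infinity)"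
proof (cases P)
  case Infinity
  then show ?thesis using valuation_const[OF R, of 1] by (simp add: hom_one)
next
  case P1: (Affine x1 y1)
  show ?thesis
  proof (cases Q)
    case Infinity
    then show ?thesis using valuation_const[OF R, of 1] by (simp add: hom_one P1)
  next
    case Q1: (Affine x2 y2)
    show ?thesis
    proof (cases "x1 = x2 \<and> y1 + y2 + a1 E * x2 + a3 E = 0")
      case True
      then have "(y1 + a1 E * x1 + a3 E) + y2 = 0" by (simp add: algebra_simps)
      from minus_unique[OF this] have "y2 = - y1 - a1 E * x1 - a3 E" by (simp add: algebra_simps)
      with True have "Q = neg_point P" by (simp add: P1 Q1)
      then show ?thesis
        using True valuation_X_minus[OF R, of x1 y1] P by (simp add: P1 Q1)
    next
      case False
      define l where "l = slope x1 y1 x2 y2"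
      define m where "m = y1 - l * x1"
      define x3 where "x3 = l\<^sup>2 + a1 E * l - a2 E - x1 - x2"
      note line = line_through[OF P[unfolded P1] Q[unfolded Q1] False, folded l_def,
        folded m_def x3_def]
      have chord: "chord P Q = (Y - con l * X - con m) / (X - con x3)"
        unfolding P1 Q1 chord.simps if_not_P[OF False] by (simp add: Let_def l_def m_def x3_def)
      have "valuation E R (Y - con l * X - con m) = of_bool (R = Affine x1 (l * x1 + m))
        + of_bool (R = Affine x2 (l * x2 + m)) + of_bool (R = Affine x3 (l * x3 + m)) - 3 * of_bool (R = Infinity)"
        by (rule valuation_line[OF R _ _ line(4,5)])
          (use P Q P1 Q1 line(1,2) in simp_all)
      moreover have "P = Affine x1 (l * x1 + m)" "Q = Affine x2 (l * x2 + m)"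
        using line(1,2) by (simp_all add: P1 Q1)
      moreover have "point_add E P Q = neg_point (Affine x3 (l * x3 + m))"
        unfolding P1 Q1 by (rule line(3))
      ultimately show ?thesis
        unfolding chord valuation_divide[OF R Y_minus_line_nonzero X_minus_nonzero]
          valuation_X_minus[OF R line(4)] by (simp only:)
    qed
  qed
qed

text \<open>The quotient of the two products has divisor [P + (Q + R)] - [(P + Q) + R], computed
  without associativity. \<open>no_simple_pole\<close> then yields the equality of the two points
  and the constant together.\<close>

lemma
  assumes P: "on_curve E P" and Q: "on_curve E Q" and R: "on_curve E R"
  shows point_add_assoc: "point_add E (point_add E P Q) R = point_add E P (point_add E Q R)"
    and chord_cocycle: "\<exists>c. c \<noteq> 0 \<and> chord P Q * chord (point_add E P Q) R
      = con c * (chord Q R * chord P (point_add E Q R))"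
proof -
  let ?f = "(chord P Q * chord (point_add E P Q) R) / (chord Q R * chord P (point_add E Q R))"
  have f: "?f \<noteq> 0" by (simp add: chord_nonzero)
  have v: "valuation E S ?f = of_bool (S = point_add E P (point_add E Q R))
      - of_bool (S = point_add E (point_add E P Q) R)" if "on_curve E S" for S
    using that P Q R by (simp add: valuation_divide valuation_mult chord_nonzero valuation_chord point_add_closed)
  note s = no_simple_pole[OF f _ _ v]
  show "point_add E (point_add E P Q) R = point_add E P (point_add E Q R)"
    using s(1) P Q R by (simp add: point_add_closed)
  obtain c where "c \<noteq> 0" "?f = con c"
    using s(2) P Q R by (auto simp: point_add_closed)
  then show "\<exists>c. c \<noteq> 0 \<and> chord P Q * chord (point_add E P Q) R
      = con c * (chord Q R * chord P (point_add E Q R))"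
    using chord_nonzero by (auto simp: divide_eq_eq)
qed

lemma point_add_commute:
  assumes P: "on_curve E P" and Q: "on_curve E Q"
  shows "point_add E P Q = point_add E Q P"
proof -
  let ?f = "chord P Q / chord Q P"
  have f: "?f \<noteq> 0" by (simp add: chord_nonzero)
  have "valuation E S ?f = of_bool (S = point_add E Q P) - of_bool (S = point_add E P Q)"
    if "on_curve E S" for S
    using that P Q by (simp add: valuation_divide chord_nonzero valuation_chord)
  from no_simple_pole(1)[OF f _ _ this] P Q show ?thesis
    by (simp add: point_add_closed)
qed

lemma point_add_Infinity_right: "point_add E P Infinity = P"
  by (cases P) simp_all

lemma point_add_neg_point: "point_add E (neg_point P) P = Infinity"
  by (cases P) simp_all

lemma points_simps [simp]:
  "carrier (points E) = {P. on_curve E P}" "P \<otimes>\<^bsub>points E\<^esub> Q = point_add E P Q"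
  "\<one>\<^bsub>points E\<^esub> = Infinity"
  by (simp_all add: points_def)

end

sublocale elliptic \<subseteq> points: comm_group "points E"
  by (rule comm_groupI)
    (auto simp: point_add_closed point_add_assoc point_add_Infinity_right
      intro: point_add_commute point_add_neg_point on_curve_neg_point)

lemma (in elliptic) inv_eq_neg_point: "on_curve E P \<Longrightarrow> inv\<^bsub>points E\<^esub> P = neg_point P"
  by (rule points.inv_equality) (simp_all add: point_add_neg_point on_curve_neg_point)


section \<open>Logarithmic derivatives\<close>

text \<open>The derivation belonging to the invariant differential \<open>dx / (2 y + a1 x + a3)\<close>.\<close>

locale elliptic_derivation = elliptic E
  for E :: "('c::alg_closed_field, 'k::field) curve" +
  fixes D :: "'k \<Rightarrow> 'k"
  assumes D_add: "D (f + g) = D f + D g"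
    and D_mult: "D (f * g) = f * D g + g * D f"
    and D_const [simp]: "D (cst E c) = 0"
    and D_X: "D (xfun E) = 2 * yfun E + cst E (a1 E) * xfun E + cst E (a3 E)"
    and D_Y: "D (yfun E) = 3 * (xfun E)\<^sup>2 + 2 * cst E (a2 E) * xfun E + cst E (a4 E) - cst E (a1 E) * yfun E"

text \<open>It could vanish only in characteristic 2 with a1 = a3 = 0; then b2, b4 and b6 are 0, and
  so is the discriminant.\<close>

lemma (in elliptic) invariant_denominator_nonzero: "2 * Y + con (a1 E) * X + con (a3 E) \<noteq> 0"
proof
  assume *: "2 * Y + con (a1 E) * X + con (a3 E) = 0"
  have "ev X [:a3 E, a1 E:] + Y * ev X [:2:] = 0"
    using * by (simp add: hom_simps algebra_simps)
  from linear_in_Y_eq_0[OF this] have "a1 E = 0" "a3 E = 0" "(2 :: 'c) = 0"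
    by simp_all
  moreover from this have "(4 :: 'c) = 0" "(8 :: 'c) = 0"
    by (metis mult_2 numeral_Bit0 mult_zero_left)+
  ultimately have "discriminant E = 0"
    by (simp add: discriminant_def b2_def b4_def b6_def)
  then show False using elliptic by (simp add: elliptic_curve_def)
qed

context elliptic_derivation
begin

lemma D_zero [simp]: "D 0 = 0"
  using D_const[of 0] by simp

lemma D_one [simp]: "D 1 = 0"
  using D_const[of 1] by (simp add: hom_one)

lemma D_minus: "D (- f) = - D f"
  using D_add[of f "- f"] by (simp add: add_eq_0_iff)

lemma D_diff: "D (f - g) = D f - D g"
  using D_add[of f "- g"] by (simp add: D_minus)

definition dlog :: "'k \<Rightarrow> 'k" where
  "dlog f = D f / f"

lemma dlog_mult: "f \<noteq> 0 \<Longrightarrow> g \<noteq> 0 \<Longrightarrow> dlog (f * g) = dlog f + dlog g"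
  by (simp add: dlog_def D_mult field_simps)

lemma dlog_const [simp]: "dlog (con c) = 0"
  by (simp add: dlog_def)

lemma dlog_inverse: "f \<noteq> 0 \<Longrightarrow> dlog (inverse f) = - dlog f"
  using dlog_mult[of f "inverse f"] dlog_const[of 1] by (simp add: hom_one add_eq_0_iff)

lemma dlog_divide: "f \<noteq> 0 \<Longrightarrow> g \<noteq> 0 \<Longrightarrow> dlog (f / g) = dlog f - dlog g"
  using dlog_mult[of f "inverse g"] by (simp add: dlog_inverse divide_inverse)

text \<open>An algebraic substitute for \<open>\<zeta>(z - P) - \<zeta>(z) + \<zeta>(P)\<close>, where \<open>\<zeta>\<close> is the Weierstrass zeta
  function: the slope of the line through \<open>z\<close> and \<open>- P\<close>. It satisfies the addition theorem of
  \<open>\<zeta>\<close> with the constants below.\<close>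

fun zeta :: "'c point \<Rightarrow> 'k" where
  "zeta Infinity = 0"
| "zeta (Affine x y) = (Y - con (- y - a1 E * x - a3 E)) / (X - con x)"

fun zeta_const :: "'c point \<Rightarrow> 'c point \<Rightarrow> 'c" where
  "zeta_const Infinity Q = 0"
| "zeta_const (Affine x1 y1) Infinity = 0"
| "zeta_const (Affine x1 y1) (Affine x2 y2) =
     (if x1 = x2 \<and> y1 + y2 + a1 E * x2 + a3 E = 0 then a1 E else slope x1 y1 x2 y2 + a1 E)"

text \<open>The two numerators add up to 2 y + a1 x0 + a3 with x0 the coordinate of the point; the
  summand a1 completes this to D x = 2 y + a1 x + a3.\<close>

lemma dlog_vertical:
  "dlog (X - con x) = zeta (Affine x y) + zeta (neg_point (Affine x y)) + con (a1 E)"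
proof -
  have u: "X - con x \<noteq> 0" by (rule X_minus_nonzero)
  have frac: "a / u + b / u + c = (a + b + c * u) / u" if "u \<noteq> 0" for a b c u :: 'k
    using that by (simp add: add_divide_distrib)
  have neg: "- (- y - a1 E * x - a3 E) - a1 E * x - a3 E = y" by simp
  have "zeta (Affine x y) + zeta (neg_point (Affine x y)) + con (a1 E)
      = ((Y - con (- y - a1 E * x - a3 E)) + (Y - con y) + con (a1 E) * (X - con x)) / (X - con x)"
    unfolding zeta.simps neg_point.simps neg by (rule frac[OF u])
  also have "(Y - con (- y - a1 E * x - a3 E)) + (Y - con y) + con (a1 E) * (X - con x) = D (X - con x)"
    unfolding D_diff D_X D_const hom_simps by algebra
  finally show ?thesis by (simp add: dlog_def)
qed

text \<open>With f the line and g its reflection, f + g = D x. Differentiating u1 u2 u3 = f g, this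
  nonzero factor cancels in every characteristic, and what is left expresses \<open>dlog f\<close>
  by the quotients g / u. Each slope is g / u minus l + a1, so the constant is 3 (l + a1) - (2 l +
  a1) = l + 2 a1.\<close>

lemma dlog_line:
  assumes eq: "(X - con x1) * (X - con x2) * (X - con x3)
      = (Y - con l * X - con m) * (Y - con (- l - a1 E) * X - con (- m - a3 E))"
  shows "dlog (Y - con l * X - con m) = zeta (Affine x1 (l * x1 + m)) + zeta (Affine x2 (l * x2 + m))
    + zeta (Affine x3 (l * x3 + m)) + con (l + 2 * a1 E)"
proof -
  define u where "u x = X - con x" for x
  define f where "f = Y - con l * X - con m"
  define g where "g = Y - con (- l - a1 E) * X - con (- m - a3 E)"
  have u: "u x \<noteq> 0" for x unfolding u_def by (rule X_minus_nonzero)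
  have f: "f \<noteq> 0" and g: "g \<noteq> 0" unfolding f_def g_def by (rule Y_minus_line_nonzero)+
  have DX: "D X = f + g" unfolding f_def g_def D_X hom_simps by algebra
  have DX': "f + g \<noteq> 0" using invariant_denominator_nonzero unfolding DX[symmetric] D_X .
  have eq': "u x1 * u x2 * u x3 = f * g" using eq by (simp add: u_def f_def g_def)
  have Du: "D (u x) = f + g" for x by (simp add: u_def D_diff DX)
  let ?S = "u x2 * u x3 + u x1 * u x3 + u x1 * u x2"
  have Df: "D f = D Y - con l * (f + g)"
    unfolding f_def D_diff D_mult D_const by (simp add: DX f_def g_def)
  have Dg: "D g = D f + con (2 * l + a1 E) * (f + g)"
  proof -
    have "D g = D Y + con (l + a1 E) * (f + g)"
      unfolding g_def D_diff D_mult D_const by (simp add: DX f_def g_def hom_simps algebra_simps)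
    then show ?thesis unfolding Df by (simp add: hom_simps algebra_simps)
  qed
  have "(f + g) * ?S = D (u x1 * u x2 * u x3)"
    by (simp add: D_mult Du algebra_simps)
  also have "\<dots> = (f + g) * (D f + con (2 * l + a1 E) * f)"
    unfolding eq' D_mult Dg by (simp add: algebra_simps)
  finally have S: "?S = D f + con (2 * l + a1 E) * f"
    using DX' by simp
  have zeta: "zeta (Affine x (l * x + m)) = g / u x - con (l + a1 E)" for x
  proof -
    have "Y - con (- (l * x + m) - a1 E * x - a3 E) = g - con (l + a1 E) * u x"
      unfolding g_def u_def hom_simps by algebra
    then show ?thesis
      using u[of x] by (simp add: u_def[symmetric] diff_divide_distrib)
  qed
  have "g / u x1 + g / u x2 + g / u x3 = g * ?S / (u x1 * u x2 * u x3)"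
    using u by (simp add: field_simps)
  also have "\<dots> = ?S / f"
    unfolding eq' using g by simp
  also have "\<dots> = dlog f + con (2 * l + a1 E)"
    unfolding S dlog_def using f by (simp add: field_simps)
  finally show ?thesis
    unfolding zeta f_def[symmetric] by (simp add: hom_simps algebra_simps)
qed

text \<open>The slope belonging to -(P + Q) occurs for the line and for the vertical line and
  cancels; the a1 of the vertical line lowers the constant from l + 2 a1 to l + a1.\<close>

lemma dlog_chord:
  assumes P: "on_curve E P" and Q: "on_curve E Q"
  shows "dlog (chord P Q) = zeta P + zeta Q - zeta (point_add E P Q) + con (zeta_const P Q)"
proof (cases P)
  case Infinity
  then show ?thesis by (simp add: dlog_def)
next
  case P1: (Affine x1 y1)
  show ?thesis
  proof (cases Q)
    case Infinity
    then show ?thesis by (simp add: dlog_def P1)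
  next
    case Q1: (Affine x2 y2)
    show ?thesis
    proof (cases "x1 = x2 \<and> y1 + y2 + a1 E * x2 + a3 E = 0")
      case True
      then have "(y1 + a1 E * x1 + a3 E) + y2 = 0" by (simp add: algebra_simps)
      from minus_unique[OF this] have "y2 = - y1 - a1 E * x1 - a3 E" by (simp add: algebra_simps)
      with True have "Q = neg_point P" by (simp add: P1 Q1)
      moreover have "chord P Q = X - con x1" "zeta_const P Q = a1 E" "point_add E P Q = Infinity"
        using True by (simp_all add: P1 Q1)
      ultimately show ?thesis
        using dlog_vertical[of x1 y1] by (simp add: P1)
    next
      case False
      define l where "l = slope x1 y1 x2 y2"
      define m where "m = y1 - l * x1"
      define x3 where "x3 = l\<^sup>2 + a1 E * l - a2 E - x1 - x2"
      note line = line_through[OF P[unfolded P1] Q[unfolded Q1] False, folded l_def,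
        folded m_def x3_def]
      have chord: "chord P Q = (Y - con l * X - con m) / (X - con x3)"
        unfolding P1 Q1 chord.simps if_not_P[OF False] by (simp add: Let_def l_def m_def x3_def)
      have const: "zeta_const P Q = l + a1 E"
        unfolding P1 Q1 zeta_const.simps if_not_P[OF False] l_def ..
      have PQ: "P = Affine x1 (l * x1 + m)" "Q = Affine x2 (l * x2 + m)"
        using line(1,2) by (simp_all add: P1 Q1)
      have add: "point_add E P Q = neg_point (Affine x3 (l * x3 + m))"
        using line(3) by (simp add: P1 Q1)
      show ?thesis
        unfolding add const chord dlog_divide[OF Y_minus_line_nonzero X_minus_nonzero]
          dlog_line[OF line(5)] dlog_vertical[of x3 "l * x3 + m"]
        unfolding PQ
        by (simp only: hom_simps) algebra
    qed
  qed
qed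

text \<open>Logarithmic differentiation removes the constant factor in \<open>chord_cocycle\<close>,
  and by associativity all slopes cancel.\<close>

lemma zeta_const_cocycle:
  assumes P: "on_curve E P" and Q: "on_curve E Q" and R: "on_curve E R"
  shows "zeta_const P Q + zeta_const (point_add E P Q) R = zeta_const Q R + zeta_const P (point_add E Q R)"
proof -
  obtain c where c: "c \<noteq> 0" "chord P Q * chord (point_add E P Q) R
      = con c * (chord Q R * chord P (point_add E Q R))"
    using chord_cocycle[OF assms] by blast
  have "con c \<noteq> 0" using c by simp
  then have "dlog (chord P Q) + dlog (chord (point_add E P Q) R)
      = dlog (chord Q R) + dlog (chord P (point_add E Q R))"
    using arg_cong[OF c(2), of dlog] by (simp add: dlog_mult chord_nonzero)
  then have "con (zeta_const P Q + zeta_const (point_add E P Q) R)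
      = con (zeta_const Q R + zeta_const P (point_add E Q R))"
    using assms by (simp add: dlog_chord point_add_closed point_add_assoc hom_add algebra_simps)
  then show ?thesis by simp
qed

text \<open>Reflection sends a line of slope l to one of slope -l - a1, so the two constants are l +
  a1 and -l.\<close>

lemma zeta_const_neg_neg:
  assumes P: "on_curve E P" and Q: "on_curve E Q"
    and ne: "P \<noteq> Infinity" "Q \<noteq> Infinity" "Q \<noteq> neg_point P"
  shows "zeta_const P Q + zeta_const (neg_point P) (neg_point Q) = a1 E"
proof -
  obtain x1 y1 x2 y2 where PQ: "P = Affine x1 y1" "Q = Affine x2 y2"
    using ne by (meson point.exhaust)
  have nv: "\<not> (x1 = x2 \<and> y1 + y2 + a1 E * x2 + a3 E = 0)"
  proof
    assume *: "x1 = x2 \<and> y1 + y2 + a1 E * x2 + a3 E = 0"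
    then have "(y1 + a1 E * x1 + a3 E) + y2 = 0" by (simp add: algebra_simps)
    from minus_unique[OF this] have "y2 = - y1 - a1 E * x1 - a3 E" by (simp add: algebra_simps)
    with * ne(3) show False by (simp add: PQ)
  qed
  let ?n = "\<lambda>x y. - y - a1 E * x - a3 E"
  have nv': "\<not> (x1 = x2 \<and> ?n x1 y1 + ?n x2 y2 + a1 E * x2 + a3 E = 0)"
  proof
    assume *: "x1 = x2 \<and> ?n x1 y1 + ?n x2 y2 + a1 E * x2 + a3 E = 0"
    then have "- (y1 + y2 + a1 E * x2 + a3 E) = 0" by (simp add: algebra_simps)
    with * nv show False by (metis neg_equal_0_iff_equal)
  qed
  have "slope x1 (?n x1 y1) x2 (?n x2 y2) = - slope x1 y1 x2 y2 - a1 E"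
  proof (cases "x1 = x2")
    case True
    then have y2: "y2 = y1"
      using same_x[of x1 y1 y2] P Q nv by (auto simp: PQ algebra_simps)
    have "2 * y1 + a1 E * x1 + a3 E = y1 + y2 + a1 E * x2 + a3 E"
      unfolding y2 True by simp
    then have Fy: "2 * y1 + a1 E * x1 + a3 E \<noteq> 0"
      using nv True by metis
    have "2 * ?n x1 y1 + a1 E * x1 + a3 E = - (2 * y1 + a1 E * x1 + a3 E)"
      by algebra
    moreover have "3 * x1\<^sup>2 + 2 * a2 E * x1 + a4 E - a1 E * ?n x1 y1
        = (3 * x1\<^sup>2 + 2 * a2 E * x1 + a4 E - a1 E * y1) + a1 E * (2 * y1 + a1 E * x1 + a3 E)"
      by algebra
    moreover have "(n + a * d) / (- d) = - (n / d) - a" if "d \<noteq> 0" for n a d :: 'c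
      using that by (simp add: field_simps)
    ultimately show ?thesis
      using Fy True by (simp only: slope_def simp_thms if_True)
  next
    case False
    have "?n x2 y2 - ?n x1 y1 = - (y2 - y1) - a1 E * (x2 - x1)"
      by algebra
    moreover have "(- n - a * d) / d = - (n / d) - a" if "d \<noteq> 0" for n a d :: 'c
      using that by (simp add: field_simps)
    moreover have "x2 - x1 \<noteq> 0" using False by simp
    ultimately show ?thesis
      using False by (simp only: slope_def if_False)
  qed
  then show ?thesis
    unfolding PQ neg_point.simps zeta_const.simps if_not_P[OF nv] if_not_P[OF nv'] by simp
qed

end


section \<open>Translations\<close>

context elliptic
begin

text \<open>\<open>value_at\<close> is a description and carries no information outside the local
  ring; the relation joins regularity with the value.\<close>

definition has_value :: "'c point \<Rightarrow> 'k \<Rightarrow> 'c \<Rightarrow> bool" where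
  "has_value P f c \<longleftrightarrow> f \<in> local_ring E P \<and> f - con c \<in> maximal_ideal_at E P"

lemma has_value_chart:
  assumes C: "chart con u v x y" "local_ring E P = chart.R con u v x y"
  shows "has_value P f c \<longleftrightarrow> f - con c \<in> chart.M con u v x y"
  using chart.maximal_ideal_at_eq[OF C] chart.mem_R_if_value[OF C(1)]
  by (auto simp: has_value_def C(2))

lemma has_value_const: assumes "on_curve E P" shows "has_value P (con c) c"
proof -
  obtain u v x y where C: "chart con u v x y" "local_ring E P = chart.R con u v x y"
    using chart_ex[OF assms] .
  show ?thesis unfolding has_value_chart[OF C] by (rule chart.value_const[OF C(1)])
qed

lemma has_value_add:
  assumes "on_curve E P" "has_value P f c" "has_value P g d" shows "has_value P (f + g) (c + d)"
proof -
  obtain u v x y where C: "chart con u v x y" "local_ring E P = chart.R con u v x y"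
    using chart_ex[OF assms(1)] .
  show ?thesis using assms(2,3) unfolding has_value_chart[OF C] by (rule chart.value_add[OF C(1)])
qed

lemma has_value_diff:
  assumes "on_curve E P" "has_value P f c" "has_value P g d" shows "has_value P (f - g) (c - d)"
proof -
  obtain u v x y where C: "chart con u v x y" "local_ring E P = chart.R con u v x y"
    using chart_ex[OF assms(1)] .
  show ?thesis using assms(2,3) unfolding has_value_chart[OF C] by (rule chart.value_diff[OF C(1)])
qed

lemma has_value_ex:
  assumes "on_curve E P" "f \<in> local_ring E P"
  shows "has_value P f (value_at E P f)"
proof -
  obtain u v x y where C: "chart con u v x y" "local_ring E P = chart.R con u v x y"
    using chart_ex[OF assms(1)] .
  obtain c where c: "f - con c \<in> chart.M con u v x y"
    using chart.value_ex[OF C(1)] assms(2) C(2) by blast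
  then show ?thesis
    using chart.value_at_eq[OF C refl c] by (simp add: has_value_chart[OF C])
qed

lemma value_at_eq_if_has_value:
  assumes "on_curve E P" "has_value P f c" shows "value_at E P f = c"
proof -
  obtain u v x y where C: "chart con u v x y" "local_ring E P = chart.R con u v x y"
    using chart_ex[OF assms(1)] .
  show ?thesis
    using chart.value_at_eq[OF C refl] assms(2) by (simp add: has_value_chart[OF C])
qed

text \<open>A point with value 0 lies above a root of the norm of the numerator. There are finitely
  many such roots but infinitely many constants, and a point above each of them.\<close>

lemma eq_0_if_almost_all_values_0:
  assumes S: "finite S" and v: "\<And>P. on_curve E P \<Longrightarrow> P \<notin> S \<Longrightarrow> has_value P f 0"
  shows "f = 0"
proof (rule ccontr)
  assume "f \<noteq> 0"
  obtain A B D where f: "D \<noteq> 0" "f = (ev X A + Y * ev X B) / ev X D"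
    by (rule field_element)
  then have "norm_poly A B \<noteq> 0"
    using \<open>f \<noteq> 0\<close> by (auto simp: norm_poly_eq_0_iff)
  \<comment> \<open>The 0 for \<open>Infinity\<close> is a dummy: at worst one more x is
    excluded.\<close>
  then have "finite ({x. poly (norm_poly A B) x = 0} \<union> (\<lambda>P. case P of Infinity \<Rightarrow> 0 | Affine x y \<Rightarrow> x) ` S)"
    using S poly_roots_finite by auto
  then obtain x where x: "poly (norm_poly A B) x \<noteq> 0" "x \<notin> (\<lambda>P. case P of Infinity \<Rightarrow> 0 | Affine x y \<Rightarrow> x) ` S"
    using ex_new_if_finite[OF infinite_constants] by blast
  obtain y where P: "on_curve E (Affine x y)" by (rule point_over)
  have "Affine x y \<notin> S" using x(2) by force
  with v[OF P] have "has_value (Affine x y) f 0" by simp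
  then have M: "f - con 0 \<in> chart.M con X Y x y"
    using has_value_chart[OF chart_Affine[OF P] local_ring_Affine[OF P]] by simp
  interpret C: chart con X Y x y by (rule chart_Affine[OF P])
  have "f * ev X D \<in> C.M"
    using C.M_mult[of f "ev X D"] C.poly_mem[of "[:D:]"] M by simp
  moreover have "f * ev X D = eval2 con X Y [:A, B:]"
    using f by simp
  ultimately have 1: "eval2 con X Y [:A, B:] - con 0 \<in> C.M" by simp
  have "eval2 con X Y [:A, B:] - con (eval2 id x y [:A, B:]) \<in> C.M"
    using C.poly_M[of "[:A, B:] - [:[:eval2 id x y [:A, B:]:]:]"]
    by (simp add: hom_simps ev_diff ev_minus id_hom.hom_simps algebra_simps)
  from C.value_unique[OF 1 this] have "poly A x + y * poly B x = 0" by simp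
  with x(1) poly_norm_poly[OF P, of A B] show False by simp
qed

lemma neg_point_add:
  assumes "on_curve E P" "on_curve E Q"
  shows "neg_point (point_add E P Q) = point_add E (neg_point P) (neg_point Q)"
  using points.inv_mult[of P Q] assms
  by (simp add: inv_eq_neg_point[symmetric] point_add_closed)

lemma point_add_neg_cancel:
  assumes "on_curve E P" "on_curve E Q"
  shows "point_add E (point_add E P Q) (neg_point Q) = P"
  using point_add_assoc[OF assms on_curve_neg_point[OF assms(2)]]
    point_add_neg_point[of Q] point_add_commute[OF assms(2) on_curve_neg_point[OF assms(2)]]
  by (simp add: point_add_Infinity_right)

end

context elliptic_derivation
begin

lemma zeta_const_Infinity_right [simp]: "zeta_const P Infinity = 0"
  by (cases P) simp_all

lemma zeta_const_neg: "P \<noteq> Infinity \<Longrightarrow> zeta_const P (neg_point P) = a1 E"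
  by (cases P) simp_all

lemma zeta_const_commute:
  assumes P: "on_curve E P" and Q: "on_curve E Q"
  shows "zeta_const P Q = zeta_const Q P"
proof (cases "P = Infinity \<or> Q = Infinity")
  case False
  then obtain x1 y1 x2 y2 where PQ: "P = Affine x1 y1" "Q = Affine x2 y2"
    by (meson point.exhaust)
  show ?thesis
  proof (cases "x1 = x2")
    case True
    then show ?thesis
      using same_x[of x1 y1 y2] P Q unfolding PQ by (auto simp: algebra_simps)
  next
    case False
    then have "(y2 - y1) / (x2 - x1) = (y1 - y2) / (x1 - x2)"
      by (metis minus_diff_eq minus_divide_divide)
    then show ?thesis using False by (simp add: PQ slope_def)
  qed
qed auto

text \<open>The value is the slope of the line through R and -P, hence one of the constants shifted
  by a1. This turns identities between functions into identities between constants.\<close>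

lemma has_value_zeta:
  assumes P: "on_curve E P" and R: "on_curve E R"
    and ne: "P \<noteq> Infinity" "R \<noteq> Infinity" "R \<noteq> P" "R \<noteq> neg_point P"
  shows "has_value R (zeta P) (zeta_const R (neg_point P) - a1 E)"
proof -
  obtain x y x0 y0 where eq: "P = Affine x y" "R = Affine x0 y0"
    using ne by (meson point.exhaust)
  have R': "on_curve E (Affine x0 y0)" using R eq by simp
  have x: "x0 \<noteq> x"
    using same_x[of x y y0] P R ne(3,4) by (auto simp: eq)
  interpret C: chart con X Y x0 y0 by (rule chart_Affine[OF R'])
  let ?n = "- y - a1 E * x - a3 E"
  have "(Y - con ?n) / (X - con x) - con ((y0 - ?n) / (x0 - x)) \<in> C.M"
    by (intro C.value_divide C.value_diff C.coord_value C.value_const) (use x in simp)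
  moreover have "(y0 - ?n) / (x0 - x) = (?n - y0) / (x - x0)"
    by (metis minus_diff_eq minus_divide_divide)
  ultimately show ?thesis
    using x has_value_chart[OF chart_Affine[OF R'] local_ring_Affine[OF R']]
    by (simp add: eq slope_def del: diff_diff_eq2)
qed

end

locale elliptic_translation = elliptic_derivation E D
  for E :: "('c::alg_closed_field, 'k::field) curve" and D +
  fixes s :: "'c point" and \<tau> :: "'k \<Rightarrow> 'k"
  assumes s: "on_curve E s" "s \<noteq> Infinity"
    and translation: "translation_automorphism E s \<tau>"
begin

lemma tau_add: "\<tau> (f + g) = \<tau> f + \<tau> g" and tau_mult: "\<tau> (f * g) = \<tau> f * \<tau> g"
  and tau_const: "\<tau> (con c) = con c"
  using translation by (simp_all add: translation_automorphism_def automorphism_over_constants_def)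

lemma tau_zero [simp]: "\<tau> 0 = 0"
  using tau_const[of 0] by simp

lemma tau_minus: "\<tau> (- f) = - \<tau> f"
  using tau_add[of f "- f"] by (simp add: add_eq_0_iff)

lemma tau_diff: "\<tau> (f - g) = \<tau> f - \<tau> g"
  using tau_add[of f "- g"] by (simp add: tau_minus)

lemma has_value_tau:
  assumes P: "on_curve E P" and v: "has_value (point_add E P s) f c"
  shows "has_value P (\<tau> f) c"
proof -
  have "f \<in> local_ring E (point_add E P s)"
    using v by (simp add: has_value_def)
  then have "\<tau> f \<in> local_ring E P" "value_at E P (\<tau> f) = value_at E (point_add E P s) f"
    using translation P by (auto simp: translation_automorphism_def)
  then show ?thesis
    using has_value_ex[OF P, of "\<tau> f"] value_at_eq_if_has_value[OF point_add_closed[OF P s(1)] v] by simp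
qed

text \<open>Both sides are compared at a general point R. Inserting the values at R + s and at R
  leaves a combination of constants, which vanishes by the cocycle identity for R + s, -s, -P and by
  k(P, s) + k(-P, -s) = a1.\<close>

lemma tau_zeta:
  assumes P: "on_curve E P" "P \<noteq> Infinity"
  shows "\<tau> (zeta (point_add E P s)) - \<tau> (zeta s) = zeta P + con (zeta_const P s)"
proof -
  let ?Q = "point_add E P s"
  have Q: "on_curve E ?Q" by (intro point_add_closed P s)
  \<comment> \<open>T lists the points excluded by \<open>has_value_zeta\<close> for P + s and for
    s. It restricts R + s, so its translate by -s enters S.\<close>
  define T where "T = {Infinity, ?Q, neg_point ?Q, s, neg_point s}"
  define S where "S = {Infinity, P, neg_point P, neg_point s} \<union> (\<lambda>t. point_add E t (neg_point s)) ` T"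
  have "\<tau> (zeta ?Q) - \<tau> (zeta s) - (zeta P + con (zeta_const P s)) = 0"
  proof (rule eq_0_if_almost_all_values_0)
    show "finite S" by (simp add: S_def T_def)
    fix R assume R: "on_curve E R" "R \<notin> S"
    let ?R = "point_add E R s"
    have R': "on_curve E ?R" by (intro point_add_closed R s)
    have "?R \<notin> T"
    proof
      assume "?R \<in> T"
      then have "point_add E ?R (neg_point s) \<in> S" unfolding S_def by blast
      with R show False by (simp add: point_add_neg_cancel[OF R(1) s(1)])
    qed
    then have vs: "has_value R (\<tau> (zeta s)) (zeta_const ?R (neg_point s) - a1 E)"
      by (intro has_value_tau R has_value_zeta R' s) (auto simp: T_def)
    have vP: "has_value R (zeta P + con (zeta_const P s)) (zeta_const R (neg_point P) - a1 E + zeta_const P s)"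
      by (intro has_value_add R has_value_zeta has_value_const P) (use R in \<open>auto simp: S_def\<close>)
    show "has_value R (\<tau> (zeta ?Q) - \<tau> (zeta s) - (zeta P + con (zeta_const P s))) 0"
    proof (cases "?Q = Infinity")
      \<comment> \<open>Now \<open>zeta ?Q\<close> is 0 and P = -s; the cocycle identity for R, s,
        -s gives the relation between the remaining constants.\<close>
      case True
      have "P = point_add E ?Q (neg_point s)"
        using point_add_neg_cancel[OF P(1) s(1)] by simp
      then have Ps: "P = neg_point s" "neg_point P = s" using True by simp_all
      have "zeta_const R s + zeta_const ?R (neg_point s) = a1 E"
        using zeta_const_cocycle[OF R(1) s(1) on_curve_neg_point[OF s(1)]]
          zeta_const_neg[OF s(2)] point_add_commute[OF s(1) on_curve_neg_point[OF s(1)]]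
        by (simp add: point_add_neg_point)
      moreover have "zeta_const P s = a1 E"
        using zeta_const_neg[of P] P(2) by (simp add: Ps)
      ultimately have "0 - (zeta_const ?R (neg_point s) - a1 E)
          - (zeta_const R (neg_point P) - a1 E + zeta_const P s) = 0"
        unfolding Ps(2) by (simp add: algebra_simps)
      moreover have "has_value R (\<tau> (zeta ?Q)) 0"
        using has_value_const[OF R(1), of 0] by (simp add: True)
      ultimately show ?thesis
        using has_value_diff[OF R(1) has_value_diff[OF R(1) _ vs] vP] by metis
    next
      case False
      have vQ: "has_value R (\<tau> (zeta ?Q)) (zeta_const ?R (neg_point ?Q) - a1 E)"
        by (intro has_value_tau R has_value_zeta R' Q False)
          (use \<open>?R \<notin> T\<close> in \<open>auto simp: T_def\<close>)
      have ns: "on_curve E (neg_point s)" and nP: "on_curve E (neg_point P)"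
        by (intro on_curve_neg_point s P)+
      have "neg_point ?Q = point_add E (neg_point s) (neg_point P)"
        by (simp add: neg_point_add P s point_add_commute[OF ns nP])
      then have 1: "zeta_const ?R (neg_point s) + zeta_const R (neg_point P)
          = zeta_const (neg_point s) (neg_point P) + zeta_const ?R (neg_point ?Q)"
        using zeta_const_cocycle[OF R' ns nP] by (simp add: point_add_neg_cancel[OF R(1) s(1)])
      have "s \<noteq> neg_point P"
        using False point_add_commute[OF P(1) s(1)] point_add_neg_point[of P] by auto
      then have "zeta_const P s + zeta_const (neg_point s) (neg_point P) = a1 E"
        using zeta_const_neg_neg[OF P(1) s(1) P(2) s(2)] zeta_const_commute[OF ns nP] by simp
      with 1 have "zeta_const ?R (neg_point ?Q) - a1 E - (zeta_const ?R (neg_point s) - a1 E)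
          - (zeta_const R (neg_point P) - a1 E + zeta_const P s) = 0"
        by algebra
      then show ?thesis
        using has_value_diff[OF R(1) has_value_diff[OF R(1) vQ vs] vP] by simp
    qed
  qed
  then show ?thesis by simp
qed

lemma summable_dlog_chord:
  assumes P: "on_curve E P"
  shows "summable_wrt \<tau> (dlog (chord P s))"
proof (cases "P = Infinity")
  case True
  have "dlog (chord P s) = \<tau> 0 - 0" by (simp add: True dlog_def)
  then show ?thesis unfolding summable_wrt_def by blast
next
  case False
  let ?g = "zeta (point_add E P s) - zeta s"
  \<comment> \<open>By \<open>tau_zeta\<close>, \<tau>(g) is the slope for P plus k(P, s);
    subtracting g gives the right side of \<open>dlog_chord\<close>.\<close>
  have "dlog (chord P s) = \<tau> ?g - ?g"
    unfolding dlog_chord[OF P s(1)] tau_diff tau_zeta[OF P False] by simp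
  then show ?thesis unfolding summable_wrt_def by blast
qed

text \<open>These functions form a subgroup of the multiplicative group. At 0, \<open>dlog\<close>
  would be 0 by the convention on division, so 0 is excluded explicitly.\<close>

definition good :: "'k \<Rightarrow> bool" where
  "good f \<longleftrightarrow> f \<noteq> 0 \<and> summable_wrt \<tau> (dlog f)"

lemma good_const: "c \<noteq> 0 \<Longrightarrow> good (con c)"
  unfolding good_def summable_wrt_def by (auto intro!: exI[of _ 0])

lemma good_one: "good 1"
  using good_const[of 1] by (simp add: hom_one)

lemma good_mult: assumes "good f" "good g" shows "good (f * g)"
proof -
  obtain h h' where "dlog f = \<tau> h - h" "dlog g = \<tau> h' - h'"
    using assms unfolding good_def summable_wrt_def by blast
  then have "dlog (f * g) = \<tau> (h + h') - (h + h')"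
    using assms by (simp add: good_def dlog_mult tau_add)
  with assms show ?thesis unfolding good_def summable_wrt_def by auto
qed

lemma good_inverse: assumes "good f" shows "good (inverse f)"
proof -
  obtain h where "dlog f = \<tau> h - h"
    using assms unfolding good_def summable_wrt_def by blast
  then have "dlog (inverse f) = \<tau> (- h) - (- h)"
    using assms by (simp add: good_def dlog_inverse tau_minus)
  moreover have "inverse f \<noteq> 0" using assms by (simp add: good_def)
  ultimately show ?thesis unfolding good_def summable_wrt_def by blast
qed

lemma good_powi: assumes "good f" shows "good (f powi n)"
proof -
  have "good (g ^ m)" if "good g" for g m
    by (induction m) (simp_all add: good_one good_mult that)
  then show ?thesis
    using assms good_inverse by (simp add: power_int_def)
qed

lemma good_prod: "(\<And>i. i \<in> A \<Longrightarrow> good (f i)) \<Longrightarrow> good (prod f A)"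
  by (induction A rule: infinite_finite_induct) (simp_all add: good_one good_mult)

lemma good_chord: "on_curve E P \<Longrightarrow> good (chord P s)"
  by (simp add: good_def chord_nonzero summable_dlog_chord)

section \<open>Functions attached to multiples of s\<close>

lemma on_curve_translate:
  assumes "on_curve E P"
  shows "on_curve E (point_add E P (s [^]\<^bsub>points E\<^esub> (n :: int)))"
  using points.int_pow_closed[of s n] assms s by (simp add: point_add_closed)

lemma translate_Suc:
  assumes "on_curve E P"
  shows "point_add E (point_add E P (s [^]\<^bsub>points E\<^esub> (n :: int))) s
    = point_add E P (s [^]\<^bsub>points E\<^esub> (n + 1))"
  using points.int_pow_mult[of s n 1] points.int_pow_closed[of s n] assms s
  by (simp add: point_add_assoc)

text \<open>Dividing by the chord through P + n s and s replaces [P + n s] by [P + (n + 1) s] at the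
  cost of [s] - [o], and multiplying by the preceding chord goes back. The product telescopes to
  [P + n s] - [P] - n [s] + n [o].\<close>

lemma translation_function_ex:
  assumes P: "on_curve E P"
  shows "\<exists>f. good f \<and> (\<forall>R. on_curve E R \<longrightarrow> valuation E R f
    = of_bool (R = point_add E P (s [^]\<^bsub>points E\<^esub> (n :: int))) - of_bool (R = P)
      - n * of_bool (R = s) + n * of_bool (R = Infinity))"
    (is "\<exists>f. good f \<and> ?v n f")
proof (induction n rule: int_induct[where k = 0])
  case base
  have "?v 0 1"
    using valuation_const[of _ 1] P by (simp add: hom_one point_add_Infinity_right)
  then show ?case using good_one by blast
next
  case (step1 n)
  then obtain f where f: "good f" "?v n f" by blast
  let ?P = "point_add E P (s [^]\<^bsub>points E\<^esub> n)"
  have "?v (n + 1) (f * inverse (chord ?P s))"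
  proof (intro allI impI)
    fix R assume R: "on_curve E R"
    have arith: "x - y = w' - b - (n + 1) * c + (n + 1) * d"
      if "x = w - b - n * c + n * d" "y = w + c - w' - d" for x y w w' b c d :: int
      using that by (simp add: algebra_simps)
    have "f \<noteq> 0" using f(1) by (simp add: good_def)
    then have "valuation E R (f * inverse (chord ?P s)) = valuation E R f - valuation E R (chord ?P s)"
      by (simp add: valuation_mult valuation_inverse R chord_nonzero)
    also have "\<dots> = of_bool (R = point_add E P (s [^]\<^bsub>points E\<^esub> (n + 1))) - of_bool (R = P)
      - (n + 1) * of_bool (R = s) + (n + 1) * of_bool (R = Infinity)"
      unfolding translate_Suc[OF P, symmetric]
      by (rule arith[OF f(2)[rule_format, OF R] valuation_chord[OF on_curve_translate[OF P] s(1) R]])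
    finally show "valuation E R (f * inverse (chord ?P s)) = \<dots>" .
  qed
  moreover have "good (f * inverse (chord ?P s))"
    by (intro good_mult good_inverse good_chord f on_curve_translate P)
  ultimately show ?case by blast
next
  case (step2 n)
  then obtain f where f: "good f" "?v n f" by blast
  let ?P = "point_add E P (s [^]\<^bsub>points E\<^esub> (n - 1))"
  have "?v (n - 1) (f * chord ?P s)"
  proof (intro allI impI)
    fix R assume R: "on_curve E R"
    have arith: "x + y = w' - b - (n - 1) * c + (n - 1) * d"
      if "x = w - b - n * c + n * d" "y = w' + c - w - d" for x y w w' b c d :: int
      using that by (simp add: algebra_simps)
    have w: "point_add E P (s [^]\<^bsub>points E\<^esub> n) = point_add E ?P s"
      using translate_Suc[OF P, of "n - 1"] by simp
    have "f \<noteq> 0" using f(1) by (simp add: good_def)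
    then have "valuation E R (f * chord ?P s) = valuation E R f + valuation E R (chord ?P s)"
      by (simp add: valuation_mult R chord_nonzero)
    also have "\<dots> = of_bool (R = ?P) - of_bool (R = P)
      - (n - 1) * of_bool (R = s) + (n - 1) * of_bool (R = Infinity)"
      by (rule arith[OF f(2)[rule_format, OF R, unfolded w]
            valuation_chord[OF on_curve_translate[OF P] s(1) R]])
    finally show "valuation E R (f * chord ?P s) = \<dots>" .
  qed
  moreover have "good (f * chord ?P s)"
    by (intro good_mult good_chord f on_curve_translate P)
  ultimately show ?case by blast
qed

end


section \<open>Descent along orbits\<close>

text \<open>\<open>sum'\<close> adds over the support of the function; a finite set containing that
  support reduces it to an ordinary sum.\<close>

lemma sum'_eq_sum:
  assumes "finite B" "B \<subseteq> A" "\<And>x. x \<in> A - B \<Longrightarrow> f x = 0"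
  shows "sum' f A = sum f B"
proof -
  have *: "{x \<in> A. f x \<noteq> 0} = {x \<in> B. f x \<noteq> 0}"
    using assms by blast
  have "sum' f A = sum' f {x \<in> A. f x \<noteq> 0}"
    by (rule sum.non_neutral'[symmetric])
  also have "\<dots> = sum f {x \<in> B. f x \<noteq> 0}"
    unfolding * using assms(1) by simp
  also have "\<dots> = sum f B"
    using assms(1) by (intro sum.mono_neutral_left) auto
  finally show ?thesis .
qed

context elliptic
begin

section \<open>Finiteness of divisors\<close>

lemma finite_points_over:
  assumes "finite Z" shows "finite {Affine x y | x y. on_curve E (Affine x y) \<and> x \<in> Z}"
proof -
  define y0 where "y0 x = (SOME y. on_curve E (Affine x y))" for x
  have y0: "on_curve E (Affine x (y0 x))" for x
    unfolding y0_def using point_over[of x] by (metis someI_ex)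
  have "{Affine x y | x y. on_curve E (Affine x y) \<and> x \<in> Z}
      \<subseteq> (\<Union>x\<in>Z. {Affine x (y0 x), Affine x (- y0 x - a1 E * x - a3 E)})"
    using same_x[OF y0] by blast
  then show ?thesis
    by (rule finite_subset) (use assms in auto)
qed

text \<open>At an affine point above no root of the denominator and no root of the norm of the
  numerator, the function has a nonzero value and hence order 0.\<close>

lemma finite_support:
  assumes f: "f \<noteq> 0" shows "finite {P. on_curve E P \<and> valuation E P f \<noteq> 0}"
proof -
  obtain A B D where D: "D \<noteq> 0" "f = (ev X A + Y * ev X B) / ev X D"
    by (rule field_element)
  let ?N = "norm_poly A B"
  have N: "?N \<noteq> 0"
    using f D by (auto simp: norm_poly_eq_0_iff)
  let ?Z = "{x. poly (?N * D) x = 0}"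
  have "finite ?Z"
    using N D by (intro poly_roots_finite) simp
  then have "finite ({Affine x y | x y. on_curve E (Affine x y) \<and> x \<in> ?Z} \<union> {Infinity})"
    using finite_points_over by blast
  moreover have "{P. on_curve E P \<and> valuation E P f \<noteq> 0}
      \<subseteq> {Affine x y | x y. on_curve E (Affine x y) \<and> x \<in> ?Z} \<union> {Infinity}"
  proof
    fix P assume P: "P \<in> {P. on_curve E P \<and> valuation E P f \<noteq> 0}"
    show "P \<in> {Affine x y | x y. on_curve E (Affine x y) \<and> x \<in> ?Z} \<union> {Infinity}"
    proof (cases P)
      case (Affine x y)
      have on: "on_curve E (Affine x y)" using P Affine by simp
      have "poly (?N * D) x = 0"
      proof (rule ccontr)
        assume "poly (?N * D) x \<noteq> 0"
        then have 1: "poly A x + y * poly B x \<noteq> 0" "poly D x \<noteq> 0"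
          using poly_norm_poly[OF on, of A B] by auto
        interpret C: chart con X Y x y by (rule chart_Affine[OF on])
        have val: "eval2 con X Y p - con (eval2 id x y p) \<in> C.M" for p
          using C.poly_M[of "p - [:[:eval2 id x y p:]:]"]
          by (simp add: eval2_diff id_hom.eval2_diff)
        have "ev X A + Y * ev X B - con (poly A x + y * poly B x) \<in> C.M"
          "ev X D - con (poly D x) \<in> C.M"
          using val[of "[:A, B:]"] val[of "[:D:]"] by simp_all
        from C.value_divide[OF this 1(2)]
        have "f - con ((poly A x + y * poly B x) / poly D x) \<in> C.M"
          by (simp add: D(2))
        from valuation_unit_value(1)[OF chart_Affine[OF on] local_ring_Affine[OF on] on this]
        show False using 1 P Affine by simp
      qed
      then show ?thesis using on Affine by blast
    qed simp
  qed
  ultimately show ?thesis by (rule rev_finite_subset)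
qed

end

context elliptic_translation
begin

section \<open>Orbits of the translation by s\<close>

lemma translate_inj:
  assumes nt: "non_torsion E s" and P: "on_curve E P"
    and eq: "point_add E P (s [^]\<^bsub>points E\<^esub> (n :: int)) = point_add E P (s [^]\<^bsub>points E\<^esub> m)"
  shows "n = m"
proof (rule ccontr)
  assume ne: "n \<noteq> m"
  have s': "s \<in> carrier (points E)" using s by simp
  have pow: "s [^]\<^bsub>points E\<^esub> k \<in> carrier (points E)" for k :: int
    using points.int_pow_closed[OF s'] .
  have "s [^]\<^bsub>points E\<^esub> n = s [^]\<^bsub>points E\<^esub> m"
    using eq P points.Units_l_cancel[of P, OF _ pow pow] by (simp add: points.Units_eq)
  then have 1: "s [^]\<^bsub>points E\<^esub> (n - m) = \<one>\<^bsub>points E\<^esub>" "s [^]\<^bsub>points E\<^esub> (m - n) = \<one>\<^bsub>points E\<^esub>"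
    using points.int_pow_diff[OF s'] pow points.r_inv by metis+
  have "k \<le> 0" if "s [^]\<^bsub>points E\<^esub> k = \<one>\<^bsub>points E\<^esub>" for k :: int
  proof (rule ccontr)
    assume "\<not> k \<le> 0"
    then have "k = int (nat k)" "nat k > 0" by simp_all
    then show False
      using nt that int_pow_int[of "points E" s "nat k"] unfolding non_torsion_def by metis
  qed
  from this[OF 1(1)] this[OF 1(2)] ne show False by simp
qed

lemma orbit_cases:
  assumes "\<omega> \<in> orbits E s"
  obtains P where "on_curve E P" "\<omega> = {point_add E P (s [^]\<^bsub>points E\<^esub> n) | n :: int. True}"
proof -
  have pow: "on_curve E (s [^]\<^bsub>points E\<^esub> (n :: int))" for n
    using points.int_pow_closed[of s n] s by simp
  obtain P where "on_curve E P" "\<omega> = (\<Union>h\<in>range (\<lambda>n::int. s [^]\<^bsub>points E\<^esub> n). {h \<otimes>\<^bsub>points E\<^esub> P})"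
    using assms unfolding orbits_def RCOSETS_def r_coset_def by auto
  then show thesis
    using point_add_commute[OF pow, of P] by (intro that[of P]) auto
qed

lemma orbit_eq:
  assumes \<omega>: "\<omega> \<in> orbits E s" and P: "P \<in> \<omega>"
  shows "on_curve E P" "\<omega> = {point_add E P (s [^]\<^bsub>points E\<^esub> n) | n :: int. True}"
proof -
  have pow: "on_curve E (s [^]\<^bsub>points E\<^esub> (n :: int))" for n
    using points.int_pow_closed[of s n] s by simp
  have add: "point_add E (s [^]\<^bsub>points E\<^esub> n) (s [^]\<^bsub>points E\<^esub> m) = s [^]\<^bsub>points E\<^esub> (n + m)" for n m :: int
    using points.int_pow_mult[of s n m] s by simp
  obtain Q where Q: "on_curve E Q" "\<omega> = {point_add E Q (s [^]\<^bsub>points E\<^esub> n) | n :: int. True}"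
    using orbit_cases[OF \<omega>] .
  then obtain k where k: "P = point_add E Q (s [^]\<^bsub>points E\<^esub> (k :: int))" using P by blast
  then show "on_curve E P" using on_curve_translate[OF Q(1)] by simp
  have "point_add E P (s [^]\<^bsub>points E\<^esub> n) = point_add E Q (s [^]\<^bsub>points E\<^esub> (k + n))" for n :: int
    unfolding k by (simp add: point_add_assoc Q(1) pow add)
  then have eq: "point_add E P (s [^]\<^bsub>points E\<^esub> (n - k)) = point_add E Q (s [^]\<^bsub>points E\<^esub> n)"
    "point_add E P (s [^]\<^bsub>points E\<^esub> n) = point_add E Q (s [^]\<^bsub>points E\<^esub> (k + n))" for n :: int
    by simp_all
  show "\<omega> = {point_add E P (s [^]\<^bsub>points E\<^esub> n) | n :: int. True}"
    unfolding Q(2) using eq by (metis (mono_tags))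
qed

lemma orbit_ex: assumes "on_curve E P" shows "\<exists>\<omega>\<in>orbits E s. P \<in> \<omega>"
proof -
  let ?H = "range (\<lambda>n::int. s [^]\<^bsub>points E\<^esub> n)"
  have "?H #>\<^bsub>points E\<^esub> P \<in> orbits E s"
    unfolding orbits_def RCOSETS_def using assms by auto
  moreover have "P \<in> ?H #>\<^bsub>points E\<^esub> P"
    unfolding r_coset_def by (auto intro!: exI[of _ 0])
  ultimately show ?thesis by blast
qed

text \<open>In each orbit every point is connected with the representative by a function from
  \<open>translation_function_ex\<close>. Weighted by the orders of \<open>a\<close>, these
  functions produce the divisor of \<open>a\<close> together with multiples of the representatives,
  of s and of o; \<open>sum0\<close> removes the former and \<open>sum1\<close> the latter
  two.\<close>

lemma summable_if_orbit_sums_vanish: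
  assumes nt: "non_torsion E s"
    and r: "orbit_representatives E s r"
    and a: "a \<noteq> 0"
    and sum0: "\<And>\<omega>. \<omega> \<in> orbits E s \<Longrightarrow> sum' (\<lambda>\<alpha>. valuation E \<alpha> a) \<omega> = 0"
    and sum1: "sum' (\<lambda>\<omega>. sum' (\<lambda>n::int.
           n * valuation E (r \<omega> \<otimes>\<^bsub>points E\<^esub> (s [^]\<^bsub>points E\<^esub> n)) a) UNIV) (orbits E s) = 0"
  shows "summable_wrt \<tau> (dlog a)"
proof -
  define p where "p \<omega> n = point_add E (r \<omega>) (s [^]\<^bsub>points E\<^esub> (n :: int))" for \<omega> n
  define v where "v P = valuation E P a" for P
  have v_eq: "v = (\<lambda>P. valuation E P a)" by (simp add: fun_eq_iff v_def)
  define S where "S = {P. on_curve E P \<and> v P \<noteq> 0}"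
  define \<Omega> where "\<Omega> = {\<omega> \<in> orbits E s. \<omega> \<inter> S \<noteq> {}}"
  define N where "N \<omega> = {n. p \<omega> n \<in> S}" for \<omega>
  have finS: "finite S"
    unfolding S_def v_def by (rule finite_support[OF a])
  have r\<omega>: "r \<omega> \<in> \<omega>" if "\<omega> \<in> orbits E s" for \<omega>
    using r that by (simp add: orbit_representatives_def)
  have on_r: "on_curve E (r \<omega>)" and \<omega>_eq: "\<omega> = range (p \<omega>)" if "\<omega> \<in> orbits E s" for \<omega>
    using orbit_eq[OF that r\<omega>[OF that]] by (auto simp: p_def)
  have p_on: "on_curve E (p \<omega> n)" if "\<omega> \<in> orbits E s" for \<omega> n
    unfolding p_def using on_curve_translate[OF on_r[OF that]] .
  have p_inj: "inj (p \<omega>)" if "\<omega> \<in> orbits E s" for \<omega>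
    using translate_inj[OF nt on_r[OF that]] by (auto simp: inj_def p_def)
  have disjoint: "\<omega> = \<omega>'" if "\<omega> \<in> orbits E s" "\<omega>' \<in> orbits E s" "P \<in> \<omega>" "P \<in> \<omega>'" for \<omega> \<omega>' P
    using orbit_eq(2)[OF that(1,3)] orbit_eq(2)[OF that(2,4)] by simp
  have finN: "finite (N \<omega>)" if "\<omega> \<in> orbits E s" for \<omega>
    unfolding N_def using finite_vimageI[OF finS p_inj[OF that]] by (simp add: vimage_def)
  have inj: "inj_on (\<lambda>(\<omega>, n). p \<omega> n) (Sigma \<Omega> N)"
  proof (rule inj_onI, clarify)
    fix \<omega> n \<omega>' n'
    assume *: "\<omega> \<in> \<Omega>" "\<omega>' \<in> \<Omega>" "p \<omega> n = p \<omega>' n'"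
    then have o: "\<omega> \<in> orbits E s" "\<omega>' \<in> orbits E s" by (simp_all add: \<Omega>_def)
    have "p \<omega> n \<in> \<omega>" "p \<omega>' n' \<in> \<omega>'"
      using \<omega>_eq[OF o(1)] \<omega>_eq[OF o(2)] by auto
    then have "\<omega> = \<omega>'" using disjoint[OF o] *(3) by simp
    with *(3) p_inj[OF o(1)] show "\<omega> = \<omega>' \<and> n = n'" by (simp add: inj_eq)
  qed
  have image: "(\<lambda>(\<omega>, n). p \<omega> n) ` Sigma \<Omega> N = S"
  proof
    show "S \<subseteq> (\<lambda>(\<omega>, n). p \<omega> n) ` Sigma \<Omega> N"
    proof
      fix P assume P: "P \<in> S"
      then obtain \<omega> where \<omega>: "\<omega> \<in> orbits E s" "P \<in> \<omega>"
        using orbit_ex by (auto simp: S_def)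
      then obtain n where "P = p \<omega> n" using \<omega>_eq by auto
      with P \<omega> have "\<omega> \<in> \<Omega>" "n \<in> N \<omega>" by (auto simp: \<Omega>_def N_def)
      then show "P \<in> (\<lambda>(\<omega>, n). p \<omega> n) ` Sigma \<Omega> N"
        using \<open>P = p \<omega> n\<close> by force
    qed
  qed (auto simp: N_def)
  have fin\<Omega>: "finite \<Omega>"
  proof -
    define orb where "orb P = (THE \<omega>. \<omega> \<in> orbits E s \<and> P \<in> \<omega>)" for P
    have "\<Omega> \<subseteq> orb ` S"
    proof
      fix \<omega> assume "\<omega> \<in> \<Omega>"
      then obtain P where "\<omega> \<in> orbits E s" "P \<in> \<omega>" "P \<in> S" by (auto simp: \<Omega>_def)
      then have "orb P = \<omega>" unfolding orb_def by (intro the_equality conjI) (use disjoint in auto)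
      with \<open>P \<in> S\<close> show "\<omega> \<in> orb ` S" by blast
    qed
    then show ?thesis by (rule finite_surj[OF finS])
  qed
  have v0: "v (p \<omega> n) = 0" if "\<omega> \<in> orbits E s" "n \<notin> N \<omega>" for \<omega> n
    using that p_on by (auto simp: N_def S_def)
  have sum0': "(\<Sum>n\<in>N \<omega>. v (p \<omega> n)) = 0" if "\<omega> \<in> \<Omega>" for \<omega>
  proof -
    have o: "\<omega> \<in> orbits E s" using that by (simp add: \<Omega>_def)
    have "sum' v \<omega> = sum v (p \<omega> ` N \<omega>)"
    proof (rule sum'_eq_sum)
      show "finite (p \<omega> ` N \<omega>)" using finN[OF o] by simp
      show "p \<omega> ` N \<omega> \<subseteq> \<omega>" by (subst (2) \<omega>_eq[OF o]) blast
      fix P assume P: "P \<in> \<omega> - p \<omega> ` N \<omega>"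
      then obtain n where "P = p \<omega> n" by (subst (asm) \<omega>_eq[OF o]) blast
      with P show "v P = 0" using v0[OF o] by blast
    qed
    also have "\<dots> = (\<Sum>n\<in>N \<omega>. v (p \<omega> n))"
      using inj_on_subset[OF p_inj[OF o]] by (simp add: sum.reindex)
    finally show ?thesis using sum0[OF o] unfolding v_eq by simp
  qed
  have inner: "sum' (\<lambda>n. n * v (p \<omega> n)) UNIV = (\<Sum>n\<in>N \<omega>. n * v (p \<omega> n))" if "\<omega> \<in> orbits E s" for \<omega>
    using finN[OF that] v0[OF that] by (intro sum'_eq_sum) auto
  have sum1': "(\<Sum>\<omega>\<in>\<Omega>. \<Sum>n\<in>N \<omega>. n * v (p \<omega> n)) = 0"
  proof -
    have "sum' (\<lambda>\<omega>. sum' (\<lambda>n. n * v (p \<omega> n)) UNIV) (orbits E s)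
        = (\<Sum>\<omega>\<in>\<Omega>. sum' (\<lambda>n. n * v (p \<omega> n)) UNIV)"
    proof (rule sum'_eq_sum[OF fin\<Omega>])
      fix \<omega> assume "\<omega> \<in> orbits E s - \<Omega>"
      then have o: "\<omega> \<in> orbits E s" and "N \<omega> = {}"
        using \<omega>_eq[of \<omega>] by (auto simp: \<Omega>_def N_def)
      then show "sum' (\<lambda>n. n * v (p \<omega> n)) UNIV = 0" using inner[OF o] by simp
    qed (simp add: \<Omega>_def)
    also have "\<dots> = (\<Sum>\<omega>\<in>\<Omega>. \<Sum>n\<in>N \<omega>. n * v (p \<omega> n))"
      by (intro sum.cong refl inner) (simp add: \<Omega>_def)
    finally show ?thesis using sum1 by (simp add: v_def p_def)
  qed
  have "\<exists>f. \<forall>\<omega>\<in>orbits E s. \<forall>n. good (f \<omega> n) \<and> (\<forall>R. on_curve E R \<longrightarrow> valuation E R (f \<omega> n)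
    = of_bool (R = p \<omega> n) - of_bool (R = r \<omega>) - n * of_bool (R = s) + n * of_bool (R = Infinity))"
    using translation_function_ex[OF on_r] unfolding p_def by metis
  then obtain f where f: "\<And>\<omega> n. \<omega> \<in> orbits E s \<Longrightarrow> good (f \<omega> n)"
    "\<And>\<omega> n R. \<omega> \<in> orbits E s \<Longrightarrow> on_curve E R \<Longrightarrow> valuation E R (f \<omega> n)
    = of_bool (R = p \<omega> n) - of_bool (R = r \<omega>) - n * of_bool (R = s) + n * of_bool (R = Infinity)"
    by blast
  \<comment> \<open>A finite product over the support of \<open>a\<close>, one factor for each
    point, with the order of \<open>a\<close> at that point as exponent.\<close>
  define b where "b = (\<Prod>\<omega>\<in>\<Omega>. \<Prod>n\<in>N \<omega>. f \<omega> n powi v (p \<omega> n))"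
  have b: "good b"
    unfolding b_def by (intro good_prod good_powi f) (simp add: \<Omega>_def)
  then have b0: "b \<noteq> 0" by (simp add: good_def)
  have "valuation E R b = v R" if R: "on_curve E R" for R
  proof -
    have fnz: "f \<omega> n \<noteq> 0" if "\<omega> \<in> \<Omega>" for \<omega> n
      using f(1)[of \<omega> n] that by (simp add: good_def \<Omega>_def)
    have "valuation E R b = (\<Sum>\<omega>\<in>\<Omega>. \<Sum>n\<in>N \<omega>. v (p \<omega> n) * valuation E R (f \<omega> n))"
    proof -
      have pow: "f \<omega> n powi k \<noteq> 0" if "\<omega> \<in> \<Omega>" for \<omega> n k
        using fnz[OF that] by (simp add: power_int_eq_0_iff)
      have "good (\<Prod>n\<in>N \<omega>. f \<omega> n powi v (p \<omega> n))" if "\<omega> \<in> \<Omega>" for \<omega>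
        using that by (intro good_prod good_powi f) (simp add: \<Omega>_def)
      then have "valuation E R b = (\<Sum>\<omega>\<in>\<Omega>. valuation E R (\<Prod>n\<in>N \<omega>. f \<omega> n powi v (p \<omega> n)))"
        unfolding b_def by (intro valuation_prod[OF R]) (simp add: good_def)
      also have "\<dots> = (\<Sum>\<omega>\<in>\<Omega>. \<Sum>n\<in>N \<omega>. v (p \<omega> n) * valuation E R (f \<omega> n))"
        using fnz pow by (intro sum.cong refl) (simp add: valuation_prod[OF R] valuation_powi[OF R])
      finally show ?thesis .
    qed
    also have "\<dots> = (\<Sum>\<omega>\<in>\<Omega>. \<Sum>n\<in>N \<omega>. v (p \<omega> n) * of_bool (R = p \<omega> n)
        - v (p \<omega> n) * of_bool (R = r \<omega>) - n * v (p \<omega> n) * (of_bool (R = s) - of_bool (R = Infinity)))"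
    proof (intro sum.cong refl)
      fix \<omega> n assume "\<omega> \<in> \<Omega>"
      then have o: "\<omega> \<in> orbits E s" by (simp add: \<Omega>_def)
      have "w * x = w * a - w * b - n * w * (c - d)" if "x = a - b - n * c + n * d" for a b c d w x :: int
        unfolding that by (simp add: algebra_simps)
      from this[OF f(2)[OF o R]]
      show "v (p \<omega> n) * valuation E R (f \<omega> n) = v (p \<omega> n) * of_bool (R = p \<omega> n)
        - v (p \<omega> n) * of_bool (R = r \<omega>) - n * v (p \<omega> n) * (of_bool (R = s) - of_bool (R = Infinity))" .
    qed
    \<comment> \<open>The factor \<open>of_bool (R = r \<omega>)\<close> does not depend on n, so
      the middle sum contains the orbit sums of condition (1); the last sum is the weighted sum of
      condition (2).\<close>
    also have "\<dots> = (\<Sum>\<omega>\<in>\<Omega>. \<Sum>n\<in>N \<omega>. v (p \<omega> n) * of_bool (R = p \<omega> n))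
        - (\<Sum>\<omega>\<in>\<Omega>. (\<Sum>n\<in>N \<omega>. v (p \<omega> n)) * of_bool (R = r \<omega>))
        - (\<Sum>\<omega>\<in>\<Omega>. \<Sum>n\<in>N \<omega>. n * v (p \<omega> n)) * (of_bool (R = s) - of_bool (R = Infinity))"
      by (simp only: sum_subtractf sum_distrib_right)
    also have "\<dots> = (\<Sum>\<omega>\<in>\<Omega>. \<Sum>n\<in>N \<omega>. v (p \<omega> n) * of_bool (R = p \<omega> n))"
      using sum0' sum1' by simp
    also have "\<dots> = (\<Sum>(\<omega>, n)\<in>Sigma \<Omega> N. v (p \<omega> n) * of_bool (R = p \<omega> n))"
      using fin\<Omega> finN by (intro sum.Sigma) (auto simp: \<Omega>_def)
    also have "\<dots> = (\<Sum>P\<in>S. v P * of_bool (R = P))"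
      unfolding image[symmetric] sum.reindex[OF inj] by (simp add: case_prod_unfold)
    also have "\<dots> = (\<Sum>P\<in>S. if R = P then v R else 0)"
      by (intro sum.cong) auto
    also have "\<dots> = v R"
      using finS R by (simp add: S_def)
    finally show ?thesis .
  qed
  \<comment> \<open>The zero divisor is written as [o] - [o] to fit
    \<open>no_simple_pole\<close>.\<close>
  then have "valuation E R (a / b) = of_bool (R = Infinity) - of_bool (R = Infinity)" if "on_curve E R" for R
    using valuation_divide[OF that a b0] that by (simp add: v_def)
  from no_simple_pole(2)[OF _ _ _ this] a b0 obtain c where "c \<noteq> 0" "a / b = con c" by auto
  then have "a = con c * b" using b0 by (simp add: field_simps)
  then have "good a" using good_mult[OF good_const[OF \<open>c \<noteq> 0\<close>] b] by simp
  then show ?thesis by (simp add: good_def)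
qed

end


section \<open>The invariant differential\<close>

text \<open>Contraction of a form with D, the linear map that sends \<open>dd f\<close> to D f. It
  is defined on formal sums; \<open>form_eval_eq\<close> lets it pass to the quotient.\<close>

definition form_eval :: "('k::field \<Rightarrow> 'k) \<Rightarrow> ('k \<Rightarrow>\<^sub>0 'k) \<Rightarrow> 'k" where
  "form_eval D w = (\<Sum>f\<in>Poly_Mapping.keys w. Poly_Mapping.lookup w f * D f)"

lemma form_eval_superset:
  assumes "finite A" "Poly_Mapping.keys w \<subseteq> A"
  shows "form_eval D w = (\<Sum>f\<in>A. Poly_Mapping.lookup w f * D f)"
  unfolding form_eval_def using assms
  by (intro sum.mono_neutral_left) (auto simp: in_keys_iff)

lemma form_eval_add: "form_eval D (w + w') = form_eval D w + form_eval D w'"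
proof -
  let ?A = "Poly_Mapping.keys w \<union> Poly_Mapping.keys w'"
  have "Poly_Mapping.keys (w + w') \<subseteq> ?A" by (rule keys_add)
  then show ?thesis
    by (simp add: form_eval_superset[of ?A] lookup_add sum.distrib distrib_right)
qed

lemma form_eval_scale: "form_eval D (form_scale g w) = g * form_eval D w"
proof -
  have "Poly_Mapping.keys (form_scale g w) \<subseteq> Poly_Mapping.keys w"
    by (auto simp: in_keys_iff lookup_form_scale)
  then show ?thesis
    by (simp add: form_eval_superset[of "Poly_Mapping.keys w"] lookup_form_scale sum_distrib_left mult.assoc)
qed

lemma form_eval_diff: "form_eval D (w - w') = form_eval D w - form_eval D w'"
  using form_eval_add[of D "w - w'" w'] by simp

lemma form_eval_dd: "form_eval D (dd f) = D f"
  by (simp add: form_eval_def dd_def)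

text \<open>The universal property of differentials: contraction with a derivation kills the three
  kinds of generators, hence their span.\<close>

lemma form_eval_eq:
  fixes E :: "('c, 'k::field) curve"
  assumes D: "derivation_over_constants E D" and eq: "form_eq E w w'"
  shows "form_eval D w = form_eval D w'"
proof -
  have 0: "form_eval D (0 :: 'k \<Rightarrow>\<^sub>0 'k) = 0" by (simp add: form_eval_def)
  have "form_relations E \<subseteq> {w. form_eval D w = 0}"
    unfolding form_relations_def
  proof (rule module.span_minimal[OF module_form_scale])
    show "module.subspace form_scale {w. form_eval D w = 0}"
      by (rule module.subspaceI[OF module_form_scale]) (simp_all add: 0 form_eval_add form_eval_scale)
  qed (use D in \<open>auto simp: derivation_over_constants_def form_eval_diff form_eval_scale form_eval_dd\<close>)
  with eq have "form_eval D (w - w') = 0" by (auto simp: form_eq_def)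
  then show ?thesis by (simp add: form_eval_diff)
qed

context elliptic
begin

lemma derivation_eqI:
  assumes D: "derivation_over_constants E D" and coord: "D X = 0" "D Y = 0"
  shows "D f = 0"
proof -
  have add: "D (f + g) = D f + D g" and mult: "D (f * g) = f * D g + g * D f" and const: "D (con c) = 0"
    for f g c using D by (simp_all add: derivation_over_constants_def)
  have D0: "D 0 = 0" using const[of 0] by simp
  have "D (ev X a) = 0" for a
    by (induction a) (simp_all add: D0 add mult const coord)
  then have poly: "D (eval2 con X Y p) = 0" for p
    by (induction p) (simp_all add: D0 add mult coord)
  obtain p q where pq: "eval2 con X Y q \<noteq> 0" "f = eval2 con X Y p / eval2 con X Y q"
    by (rule fraction)
  then have "D (f * eval2 con X Y q) = 0" by (simp add: poly)
  then show ?thesis using pq(1) by (simp add: mult poly)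
qed

lemma derivation_Y:
  assumes D: "derivation_over_constants E D"
  shows "(2 * Y + con (a1 E) * X + con (a3 E)) * D Y
    = (3 * X\<^sup>2 + 2 * con (a2 E) * X + con (a4 E) - con (a1 E) * Y) * D X"
proof -
  have add: "D (f + g) = D f + D g" and mult: "D (f * g) = f * D g + g * D f" and const: "D (con c) = 0"
    for f g c using D by (simp_all add: derivation_over_constants_def)
  have "D (Y\<^sup>2 + con (a1 E) * X * Y + con (a3 E) * Y)
    = D (X ^ 3 + con (a2 E) * X\<^sup>2 + con (a4 E) * X + con (a6 E))"
    unfolding weierstrass ..
  then show ?thesis
    unfolding power2_eq_square power3_eq_cube add mult const by algebra
qed

end

context elliptic_derivation
begin

text \<open>D is a vector field without poles. By \<open>derivation_mem\<close> only the two
  coordinates of each chart have to be differentiated.\<close>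

lemma local_ring_closed_D:
  assumes P: "on_curve E P" and f: "f \<in> local_ring E P"
  shows "D f \<in> local_ring E P"
  using P
proof (cases P rule: on_curve_cases)
  case 1
  interpret C: chart con "X / Y" "1 / Y" 0 0 by (rule chart_Infinity)
  let ?z = "X / Y" and ?w = "1 / Y"
  have "Y * D (1 / Y) + 1 / Y * D Y = D (Y * (1 / Y))"
    by (simp only: D_mult)
  then have DY: "D (1 / Y) = - D Y / Y\<^sup>2"
    using Y_nonzero by (simp add: field_simps power2_eq_square eq_neg_iff_add_eq_0)
  have w: "D ?w = - 3 * ?z\<^sup>2 - 2 * con (a2 E) * ?z * ?w - con (a4 E) * ?w\<^sup>2 + con (a1 E) * ?w"
    unfolding DY D_Y using Y_nonzero by (simp add: field_simps power2_eq_square)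
  have "D ?z = D X * ?w + X * D ?w"
    using D_mult[of X ?w] by simp
  also have "\<dots> = con (a1 E) * ?z + con (a3 E) * ?w + 2 - 3 * infinity_unit
      - 2 * con (a2 E) * ?z\<^sup>2 - con (a4 E) * ?z * ?w + con (a1 E) * ?z"
  proof -
    \<comment> \<open>The term x^3 / y^2 in D(x/y) is not visibly a polynomial in x/y and 1/y; it
      equals \<open>infinity_unit\<close>, which is one.\<close>
    have "infinity_unit * Y\<^sup>2 = X ^ 3"
      using infinity_equation Y_nonzero by (simp add: field_simps power2_eq_square power3_eq_cube)
    then have "infinity_unit = X ^ 3 / Y\<^sup>2"
      using Y_nonzero by (simp add: field_simps)
    then show ?thesis
      unfolding w D_X using Y_nonzero by (simp add: field_simps power2_eq_square power3_eq_cube)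
  qed
  finally have z: "D ?z = \<dots>" .
  have numeral: "numeral n \<in> C.R" for n
    using C.const_mem[of "numeral n"] by (simp add: hom_numeral)
  have "infinity_unit \<in> C.R"
    using infinity_unit_mem by (simp add: local_ring_Infinity)
  then have "D ?z \<in> C.R"
    unfolding z by (intro C.R_add C.R_diff C.R_mult C.R_power C.const_mem C.coord_mem numeral)
  moreover have "D ?w \<in> C.R"
    unfolding w mult_minus_left
    by (intro C.R_add C.R_diff C.R_mult C.R_power C.R_minus C.const_mem C.coord_mem numeral)
  ultimately show ?thesis
    using C.derivation_mem[of D f] f D_add D_mult D_const by (simp add: 1 local_ring_Infinity)
next
  case (2 x y)
  interpret C: chart con X Y x y by (rule chart_Affine[OF 2(2)])
  have numeral: "numeral n \<in> C.R" for n
    using C.const_mem[of "numeral n"] by (simp add: hom_numeral)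
  have "D X \<in> C.R" "D Y \<in> C.R"
    unfolding D_X D_Y by (intro C.R_add C.R_diff C.R_mult C.R_power C.const_mem C.coord_mem numeral)+
  then show ?thesis
    using C.derivation_mem[of D f] f D_add D_mult D_const by (simp add: 2(1) local_ring_Affine[OF 2(2)])
qed

text \<open>Near each point the form may be rewritten with regular terms without changing the
  contraction, and D preserves the local ring. So the contraction has no poles.\<close>

lemma global_form_eval_constant:
  assumes "global_form E \<pi>" obtains c where "form_eval D \<pi> = con c"
proof (rule regular_constant)
  fix P assume P: "on_curve E P"
  obtain w where w: "form_eq E \<pi> w"
    "\<And>f. f \<in> Poly_Mapping.keys w \<Longrightarrow> f \<in> local_ring E P \<and> Poly_Mapping.lookup w f \<in> local_ring E P"
    using assms P unfolding global_form_def regular_form_at_def by auto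
  have D: "derivation_over_constants E D"
    by (auto simp: derivation_over_constants_def D_add D_mult)
  obtain u v x y where C: "chart con u v x y" "local_ring E P = chart.R con u v x y"
    using chart_ex[OF P] .
  interpret C: chart con u v x y by (rule C(1))
  show "form_eval D \<pi> \<in> local_ring E P"
    unfolding form_eval_eq[OF D w(1)] unfolding form_eval_def C(2)
    using w(2) local_ring_closed_D[OF P] unfolding C(2) by (intro C.R_sum C.R_mult) auto
qed

end

theorem corollary5p14:
  fixes E :: "('c::alg_closed_field, 'k::field) curve"
    and s :: "'c point"
    and \<tau> \<delta> :: "'k \<Rightarrow> 'k"
    and \<pi> :: "'k \<Rightarrow>\<^sub>0 'k"
    and r :: "'c point set \<Rightarrow> 'c point"
    and a :: 'k
    and v :: "'c \<Rightarrow> real"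
  assumes "elliptic_curve E"
    and "non_torsion E s"
    and "translation_automorphism E s \<tau>"
    and "global_form E \<pi>" and "\<not> form_eq E \<pi> 0"
    and "derivation_over_constants E \<delta>" and "\<And>f. form_eq E (dd f) (form_scale (\<delta> f) \<pi>)"
    and "orbit_representatives E s r"
    and "a \<noteq> 0"
    and "nonarchimedean_absolute_value v" and "v (j_invariant E) > 1"
    and "\<And>\<omega>. \<omega> \<in> orbits E s \<Longrightarrow> sum' (\<lambda>\<alpha>. valuation E \<alpha> a) \<omega> = 0"
    and "sum' (\<lambda>\<omega>. sum' (\<lambda>n::int.
           n * valuation E (r \<omega> \<otimes>\<^bsub>points E\<^esub> (s [^]\<^bsub>points E\<^esub> n)) a) UNIV) (orbits E s) = 0"
  shows "summable_wrt \<tau> (\<delta> a / a)"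
proof -
  interpret elliptic E by (unfold_locales, fact)
  \<comment> \<open>The factor by which \<delta> differs from the invariant derivation, read off at
    x; the differentiated Weierstrass equation gives the same factor at y.\<close>
  define h where "h = \<delta> (xfun E) / (2 * yfun E + cst E (a1 E) * xfun E + cst E (a3 E))"
  note \<delta> = assms(6)
  have d: "2 * yfun E + cst E (a1 E) * xfun E + cst E (a3 E) \<noteq> 0"
    by (rule invariant_denominator_nonzero)
  have \<delta>X: "\<delta> (xfun E) = h * (2 * yfun E + cst E (a1 E) * xfun E + cst E (a3 E))"
    using d by (simp add: h_def)
  have \<delta>Y: "\<delta> (yfun E) = h * (3 * (xfun E)\<^sup>2 + 2 * cst E (a2 E) * xfun E + cst E (a4 E) - cst E (a1 E) * yfun E)"
  proof -
    have "e = h * g" if "b * e = g * (h * b)" "b \<noteq> 0" for b e g :: 'k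
      using that by (simp add: mult.left_commute mult.commute)
    from this[OF derivation_Y[OF \<delta>, unfolded \<delta>X] d] show ?thesis .
  qed
  show ?thesis
  proof (cases "h = 0")
    \<comment> \<open>Then \<delta> kills both coordinates, hence everything, and 0 is
      summable.\<close>
    case True
    then have "\<delta> a / a = \<tau> 0 - \<tau> 0"
      using derivation_eqI[OF \<delta>] \<delta>X \<delta>Y by simp
    moreover have "\<tau> 0 = 0"
      using assms(3) hom_zero unfolding translation_automorphism_def automorphism_over_constants_def by metis
    ultimately show ?thesis unfolding summable_wrt_def by metis
  next
    case h: False
    \<comment> \<open>This supplies the invariant derivation: its prescribed values at x and y are
      those of \<delta> divided by h.\<close>
    define D where "D f = \<delta> f / h" for f
    have s: "on_curve E s" "s \<noteq> Infinity"
      using assms(2) points.nat_pow_one[of 1] by (auto simp: non_torsion_def dest: spec[of _ 1])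
    interpret elliptic_translation E D s \<tau>
    proof
      show "D (f + g) = D f + D g" "D (f * g) = f * D g + g * D f" "D (cst E c) = 0" for f g c
        using \<delta> by (simp_all add: D_def derivation_over_constants_def add_divide_distrib)
    qed (use h \<delta>X \<delta>Y s assms(3) in \<open>simp_all add: D_def\<close>)
    have der: "derivation_over_constants E D"
      by (auto simp: derivation_over_constants_def D_add D_mult)
    obtain c where c: "form_eval D \<pi> = cst E c"
      using global_form_eval_constant[OF assms(4)] .
    \<comment> \<open>Contracting dx = \<delta>(x) \<pi> with D. Since \<delta>(x) = h D(x), the
      function h is the inverse of the constant c.\<close>
    have "D (xfun E) = \<delta> (xfun E) * form_eval D \<pi>"
      using form_eval_eq[OF der assms(7)[of "xfun E"]] by (simp add: form_eval_dd form_eval_scale)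
    then have "h * cst E c = 1"
      unfolding c using h d \<delta>X by (simp add: D_def)
    then have hc: "h = cst E (inverse c)" 
      by (metis cst_inverse inverse_unique mult.commute)
    obtain g where g: "dlog a = \<tau> g - g"
      using summable_if_orbit_sums_vanish[OF assms(2,8,9,12,13)] unfolding summable_wrt_def by blast
    have "\<delta> a / a = h * dlog a"
      using h by (simp add: dlog_def D_def)
    \<comment> \<open>Being constant, h is fixed by \<tau> and can be moved inside.\<close>
    also have "\<dots> = \<tau> (h * g) - h * g"
      unfolding g tau_mult by (simp add: hc tau_const algebra_simps)
    finally show ?thesis unfolding summable_wrt_def by blast
  qed
qed

end
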